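(* Let $T>0$ and $g_0,K\in L^1([0,T],\mathbb R_+)$, and let $(\Lambda^n,N^n)_{n\ge n_0}$ be the processes on $[0,T]$ produced by the Hawkes iVi scheme (defined in the context). Then, as $n\to\infty$, $(\Lambda^n,N^n)$ converges weakly (in law), in the Skorokhod $J_1$-topology, to $(\Lambda,N)$, where $N$ is a Hawkes process on $[0,T]$ with exogenous intensity $g_0$ and memory kernel $K$, and $\Lambda$ is its integrated intensity.
   Context: Setting. Fix $T>0$ and integrable measurable functions $g_0,K:[0,T]\to\mathbb R_+=[0,\infty)$. For $n\ge1$ put $t^n_i=iT/n$ ($0\le i\le n$) and $k^n_j=\int_{t^n_j}^{t^n_{j+1}}K(s)\,ds$ ($0\le j\le n-1$). Let $n_0$ be the smallest $n\ge1$ with $k^n_0<1$ (then $k_0^n<1$ for all $n\ge n_0$). Inverse Gaussian law. For $\mu,\lambda>0$, $IG(\mu,\lambda)$ is the law on $(0,\infty)$ with density $\sqrt{\lambda/(2\pi x^3)}\exp(-\lambda(x-\mu)^2/(2\mu^2x))$. $\mathcal P(\xi)$ is the Poisson law with parameter $\xi\ge0$ (with $\mathcal P(0)=\delta_0$). Scheme (Hawkes iVi). All random variables are defined on a complete probability space $(\Omega,\mathcal F,\mathbb P)$. For $n\ge n_0$, recursively for $i=0,\dots,n-1$: (1) $\alpha^n_i=\int_{t^n_i}^{t^n_{i+1}}g_0(s)\,ds+\sum_{j=0}^{i-1}k^n_{i-j}\widehat N^n_{j,j+1}$; (2) conditionally on all previously generated variables, $\xi^n_i\sim IG\big(\frac{\alpha^n_i}{1-k^n_0},(\frac{\alpha^n_i}{k^n_0})^2\big)$;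 (3) conditionally on all previously generated variables and $\xi^n_i$, $\widehat N^n_{i,i+1}\sim\mathcal P(\xi^n_i)$; (4) $\widehat\Lambda^n_{i,i+1}=\alpha^n_i+k^n_0\widehat N^n_{i,i+1}$. Conventions for degenerate parameters: if $\alpha_i^n=0$ then $\xi^n_i=0$; if $k^n_0=0$ then $\xi^n_i=\alpha^n_i$. Define $\Lambda^n_t=\sum_{i=0}^{\lfloor nt/T\rfloor-1}\widehat\Lambda^n_{i,i+1}$ and $N^n_t=\sum_{i=0}^{\lfloor nt/T\rfloor-1}\widehat N^n_{i,i+1}$ for $t\in[0,T]$ (empty sums are $0$). Hawkes process. A Hawkes process on $[0,T]$ with exogenous intensity $g_0$ and memory kernel $K$ is a counting process $N=(N_t)_{t\le T}$ (càdlàg, piecewise constant, $N_0=0$, jumps of size $1$) with intensity $\lambda_t=g_0(t)+\int_0^tK(t-s)\,dN_s$, i.e. $N-\Lambda$ is a martingale in the filtration generated by $N$, where $\Lambda_t=\int_0^t\lambda_s\,ds$ is the integrated intensity. Weak convergence is for laws on the space of càdlàg functions $[0,T]\to\mathbb R^2$ with the $J_1$-topology. *)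

theory Defs
  imports "HOL-Probability.Probability"
begin

section \<open>Skorokhod space and convergence in law\<close>

text \<open>Paths are functions on \<open>[0, T]\<close>, represented as elements of \<^const>\<open>extensional\<close> (the value
  outside \<open>[0, T]\<close> is \<^const>\<open>undefined\<close>), so that equality of paths is equality on \<open>[0, T]\<close>.\<close>

definition cadlag_on :: "real \<Rightarrow> (real \<Rightarrow> 'b::topological_space) \<Rightarrow> bool" where
  "cadlag_on T x \<longleftrightarrow>
     (\<forall>t\<in>{0..<T}. (x \<longlongrightarrow> x t) (at_right t)) \<and>
     (\<forall>t\<in>{0<..T}. \<exists>l. (x \<longlongrightarrow> l) (at_left t))"

definition skorokhod_space :: "real \<Rightarrow> (real \<Rightarrow> 'b::topological_space) set" where
  "skorokhod_space T = {x \<in> extensional {0..T}. cadlag_on T x}"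

text \<open>An increasing bijection of \<open>[0, T]\<close> is automatically continuous and fixes the end points.\<close>

definition time_changes :: "real \<Rightarrow> (real \<Rightarrow> real) set" where
  "time_changes T = {u. strict_mono_on {0..T} u \<and> bij_betw u {0..T} {0..T}}"

definition time_change_cost ::
    "real \<Rightarrow> (real \<Rightarrow> real) \<Rightarrow> (real \<Rightarrow> 'b::metric_space) \<Rightarrow> (real \<Rightarrow> 'b) \<Rightarrow> real" where
  "time_change_cost T u x y =
     max (SUP t\<in>{0..T}. \<bar>u t - t\<bar>) (SUP t\<in>{0..T}. dist (x (u t)) (y t))"

text \<open>Skorokhod's metric for the \<open>J\<^sub>1\<close>-topology. For vector-valued paths all components are subject
  to the same time change. \<^locale>\<open>Metric_space\<close> requires nonnegativity and symmetry on the whole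
  type, whence the value \<open>0\<close> off the space.\<close>

definition skorokhod_dist ::
    "real \<Rightarrow> (real \<Rightarrow> 'b::metric_space) \<Rightarrow> (real \<Rightarrow> 'b) \<Rightarrow> real" where
  "skorokhod_dist T x y =
     (if x \<in> skorokhod_space T \<and> y \<in> skorokhod_space T
      then INF u\<in>time_changes T. time_change_cost T u x y else 0)"

definition J1_topology :: "real \<Rightarrow> (real \<Rightarrow> 'b::metric_space) topology" where
  "J1_topology T = Metric_space.mtopology (skorokhod_space T) (skorokhod_dist T)"

definition borel_sigma :: "'b topology \<Rightarrow> 'b measure" where
  "borel_sigma X = sigma (topspace X) {U. openin X U}"

definition weakly_converges :: "'b topology \<Rightarrow> (nat \<Rightarrow> 'b measure) \<Rightarrow> 'b measure \<Rightarrow> bool" where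
  "weakly_converges X \<mu> \<nu> \<longleftrightarrow>
     (\<forall>f. continuous_map X euclideanreal f \<and> bounded (f ` topspace X) \<longrightarrow>
        (\<lambda>n. \<integral>x. f x \<partial>\<mu> n) \<longlonglongrightarrow> (\<integral>x. f x \<partial>\<nu>))"

text \<open>The measurability requirements say that the variables (for large \<open>n\<close>) and the limit are
  random elements of the space, so that their laws are probability measures.\<close>

definition converges_in_law ::
    "'b topology \<Rightarrow> 'a measure \<Rightarrow> (nat \<Rightarrow> 'a \<Rightarrow> 'b) \<Rightarrow> 'c measure \<Rightarrow> ('c \<Rightarrow> 'b) \<Rightarrow> bool" where
  "converges_in_law X M Y M' Z \<longleftrightarrow>
     (\<forall>\<^sub>F n in sequentially. Y n \<in> M \<rightarrow>\<^sub>M borel_sigma X) \<and>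
     Z \<in> M' \<rightarrow>\<^sub>M borel_sigma X \<and>
     weakly_converges X (\<lambda>n. distr M (borel_sigma X) (Y n)) (distr M' (borel_sigma X) Z)"

definition paths_on :: "real \<Rightarrow> (real \<Rightarrow> 'a \<Rightarrow> 'b) \<Rightarrow> 'a \<Rightarrow> real \<Rightarrow> 'b" where
  "paths_on T X \<omega> = (\<lambda>t\<in>{0..T}. X t \<omega>)"


subsection \<open>The Skorokhod distance is a metric\<close>

lemma cadlag_on_bounded:
  fixes x :: "real \<Rightarrow> 'b::metric_space"
  assumes "cadlag_on T x"
  shows "bounded (x ` {0..T})"
proof -
  define G where "G = {U. open U \<and> bounded (x ` (U \<inter> {0..T}))}"
  have loc: "\<exists>U\<in>G. t \<in> U" if t: "t \<in> {0..T}" for t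
  proof -
    have "\<exists>b>t. bounded (x ` ({t<..<b} \<inter> {0..T}))"
    proof (cases "t = T")
      case True
      then have "{t<..<t+1} \<inter> {0..T} = {}" by auto
      then have "bounded (x ` ({t<..<t+1} \<inter> {0..T}))" by simp
      then show ?thesis by (intro exI[of _ "t+1"]) simp
    next
      case False
      then have "(x \<longlongrightarrow> x t) (at_right t)" using assms t by (auto simp: cadlag_on_def)
      then have "eventually (\<lambda>s. dist (x s) (x t) < 1) (at_right t)" by (rule tendstoD) simp
      then obtain b where b: "b > t" "\<And>s. s > t \<Longrightarrow> s < b \<Longrightarrow> dist (x s) (x t) < 1"
        by (auto simp: eventually_at_right_field)
      then have "x ` ({t<..<b} \<inter> {0..T}) \<subseteq> cball (x t) 1"
        by (auto simp: dist_commute less_imp_le)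
      then show ?thesis using b(1) bounded_subset[OF bounded_cball] by blast
    qed
    then obtain b where b: "b > t" "bounded (x ` ({t<..<b} \<inter> {0..T}))" by blast
    have "\<exists>a<t. bounded (x ` ({a<..<t} \<inter> {0..T}))"
    proof (cases "t = 0")
      case True
      then have "{t-1<..<t} \<inter> {0..T} = {}" by auto
      then have "bounded (x ` ({t-1<..<t} \<inter> {0..T}))" by simp
      then show ?thesis by (intro exI[of _ "t-1"]) simp
    next
      case False
      then obtain l where "(x \<longlongrightarrow> l) (at_left t)" using assms t by (force simp: cadlag_on_def)
      then have "eventually (\<lambda>s. dist (x s) l < 1) (at_left t)" by (rule tendstoD) simp
      then obtain a where a: "a < t" "\<And>s. s > a \<Longrightarrow> s < t \<Longrightarrow> dist (x s) l < 1"
        by (auto simp: eventually_at_left_field)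
      then have "x ` ({a<..<t} \<inter> {0..T}) \<subseteq> cball l 1"
        by (auto simp: dist_commute less_imp_le)
      then show ?thesis using a(1) bounded_subset[OF bounded_cball] by blast
    qed
    then obtain a where a: "a < t" "bounded (x ` ({a<..<t} \<inter> {0..T}))" by blast
    have "{a<..<b} \<inter> {0..T} \<subseteq> ({a<..<t} \<inter> {0..T}) \<union> {t} \<union> ({t<..<b} \<inter> {0..T})" by auto
    then have "x ` ({a<..<b} \<inter> {0..T}) \<subseteq>
        x ` ({a<..<t} \<inter> {0..T}) \<union> {x t} \<union> x ` ({t<..<b} \<inter> {0..T})" by blast
    then have "bounded (x ` ({a<..<b} \<inter> {0..T}))"
      by (rule bounded_subset[rotated]) (use a b in simp)
    then show ?thesis using a b by (intro bexI[of _ "{a<..<b}"]) (auto simp: G_def)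
  qed
  then have "{0..T} \<subseteq> \<Union>G" by blast
  moreover have "\<And>U. U \<in> G \<Longrightarrow> open U" by (auto simp: G_def)
  ultimately obtain F where F: "F \<subseteq> G" "finite F" "{0..T} \<subseteq> \<Union>F"
    by (rule compactE[OF compact_Icc])
  have "bounded (\<Union>U\<in>F. x ` (U \<inter> {0..T}))"
    using F by (intro bounded_UN) (auto simp: G_def)
  moreover have "x ` {0..T} \<subseteq> (\<Union>U\<in>F. x ` (U \<inter> {0..T}))" using F by blast
  ultimately show ?thesis by (rule bounded_subset)
qed

lemma time_changesD:
  assumes "u \<in> time_changes T" "t \<in> {0..T}"
  shows "u t \<in> {0..T}"
  using assms by (auto simp: time_changes_def bij_betw_def)

lemma id_in_time_changes: "(\<lambda>t. t) \<in> time_changes T"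
  by (auto simp: time_changes_def strict_mono_on_def bij_betw_def)

lemma time_changes_fix_end:
  assumes "u \<in> time_changes T" "T > 0"
  shows "u T = T"
proof -
  have "T \<in> u ` {0..T}" using assms by (auto simp: time_changes_def bij_betw_def)
  then obtain s where s: "s \<in> {0..T}" "u s = T" by blast
  have "\<not> s < T"
  proof
    assume "s < T"
    then have "u s < u T" using s assms by (auto simp: time_changes_def strict_mono_on_def)
    then show False using s time_changesD[OF assms(1), of T] assms by auto
  qed
  then show ?thesis using s by auto
qed

lemma time_changes_inv:
  assumes "u \<in> time_changes T"
  shows "inv_into {0..T} u \<in> time_changes T"
proof -
  let ?v = "inv_into {0..T} u"
  have bij: "bij_betw u {0..T} {0..T}" and sm: "strict_mono_on {0..T} u"
    using assms by (auto simp: time_changes_def)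
  have bv: "bij_betw ?v {0..T} {0..T}" using bij by (rule bij_betw_inv_into)
  have "strict_mono_on {0..T} ?v"
  proof (rule strict_mono_onI)
    fix r s assume rs: "r \<in> {0..T}" "s \<in> {0..T}" "r < s"
    have m: "?v r \<in> {0..T}" "?v s \<in> {0..T}" using bv rs by (auto simp: bij_betw_def)
    have e: "u (?v r) = r" "u (?v s) = s" using bij rs by (auto simp: bij_betw_inv_into_right)
    show "?v r < ?v s"
    proof (rule ccontr)
      assume "\<not> ?v r < ?v s"
      then have "u (?v s) \<le> u (?v r)"
        using sm m by (metis less_eq_real_def linorder_not_less strict_mono_onD)
      then show False using e rs by simp
    qed
  qed
  then show ?thesis using bv by (simp add: time_changes_def)
qed

lemma time_changes_comp:
  assumes "u \<in> time_changes T" "v \<in> time_changes T"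
  shows "u \<circ> v \<in> time_changes T"
  using assms time_changesD[OF assms(2)] bij_betw_trans[of v "{0..T}" "{0..T}" u "{0..T}"]
  by (auto simp: time_changes_def strict_mono_on_def)

lemma time_change_cost_bounds:
  fixes x y :: "real \<Rightarrow> 'b::metric_space"
  assumes u: "u \<in> time_changes T" and x: "x \<in> skorokhod_space T" and y: "y \<in> skorokhod_space T"
    and t: "t \<in> {0..T}"
  shows "\<bar>u t - t\<bar> \<le> time_change_cost T u x y"
    and "dist (x (u t)) (y t) \<le> time_change_cost T u x y"
proof -
  have "\<bar>u s - s\<bar> \<le> T" if "s \<in> {0..T}" for s
    using time_changesD[OF u that] that by auto
  then have "bdd_above ((\<lambda>t. \<bar>u t - t\<bar>) ` {0..T})"
    by (intro bdd_aboveI2[where M = T])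
  then have "\<bar>u t - t\<bar> \<le> (SUP t\<in>{0..T}. \<bar>u t - t\<bar>)" using t by (rule cSUP_upper2) simp
  then show "\<bar>u t - t\<bar> \<le> time_change_cost T u x y" by (simp add: time_change_cost_def)
  have "bounded (x ` {0..T} \<union> y ` {0..T})"
    using x y by (auto simp: skorokhod_space_def intro: cadlag_on_bounded)
  then obtain B where B: "\<And>a b. a \<in> x ` {0..T} \<union> y ` {0..T} \<Longrightarrow> b \<in> x ` {0..T} \<union> y ` {0..T}
      \<Longrightarrow> dist a b \<le> B"
    by (metis bounded_two_points)
  have "dist (x (u s)) (y s) \<le> B" if "s \<in> {0..T}" for s
    using B time_changesD[OF u that] that by blast
  then have "bdd_above ((\<lambda>t. dist (x (u t)) (y t)) ` {0..T})"
    by (intro bdd_aboveI2[where M = B])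
  then have "dist (x (u t)) (y t) \<le> (SUP t\<in>{0..T}. dist (x (u t)) (y t))"
    using t by (rule cSUP_upper2) simp
  then show "dist (x (u t)) (y t) \<le> time_change_cost T u x y" by (simp add: time_change_cost_def)
qed

lemma time_change_cost_nonneg:
  assumes "u \<in> time_changes T" "x \<in> skorokhod_space T" "y \<in> skorokhod_space T" "T > 0"
  shows "0 \<le> time_change_cost T u x y"
  using time_change_cost_bounds(2)[OF assms(1-3), of T] assms(4)
  by (auto intro: order_trans[OF zero_le_dist])

lemma skorokhod_dist_le:
  assumes "T > 0" "x \<in> skorokhod_space T" "y \<in> skorokhod_space T" "u \<in> time_changes T"
    and "\<And>t. t \<in> {0..T} \<Longrightarrow> \<bar>u t - t\<bar> \<le> e"
    and "\<And>t. t \<in> {0..T} \<Longrightarrow> dist (x (u t)) (y t) \<le> e"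
  shows "skorokhod_dist T x y \<le> e"
proof -
  have "bdd_below ((\<lambda>u. time_change_cost T u x y) ` time_changes T)"
    using time_change_cost_nonneg assms by (auto intro!: bdd_belowI)
  then have "skorokhod_dist T x y \<le> time_change_cost T u x y"
    using assms by (auto simp: skorokhod_dist_def intro: cINF_lower)
  also have "\<dots> \<le> e"
    using assms by (auto simp: time_change_cost_def intro!: cSUP_least)
  finally show ?thesis .
qed

lemma skorokhod_dist_less:
  assumes "T > 0" "x \<in> skorokhod_space T" "y \<in> skorokhod_space T" "skorokhod_dist T x y < e"
  obtains u where "u \<in> time_changes T"
    and "\<And>t. t \<in> {0..T} \<Longrightarrow> \<bar>u t - t\<bar> < e"
    and "\<And>t. t \<in> {0..T} \<Longrightarrow> dist (x (u t)) (y t) < e"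
proof -
  have ne: "time_changes T \<noteq> {}" using id_in_time_changes by blast
  have "bdd_below ((\<lambda>u. time_change_cost T u x y) ` time_changes T)"
    using time_change_cost_nonneg assms by (auto intro!: bdd_belowI)
  moreover have "(INF u\<in>time_changes T. time_change_cost T u x y) < e"
    using assms by (simp add: skorokhod_dist_def)
  ultimately obtain u where u: "u \<in> time_changes T" "time_change_cost T u x y < e"
    using ne by (auto simp: cINF_less_iff)
  show ?thesis
    using that[OF u(1)] time_change_cost_bounds[OF u(1) assms(2,3)] u(2)
    by (meson order_le_less_trans)
qed

lemma skorokhod_dist_nonneg:
  assumes "T > 0"
  shows "0 \<le> skorokhod_dist T x y"
proof -
  have "time_changes T \<noteq> {}" using id_in_time_changes by blast
  then show ?thesis
    using time_change_cost_nonneg assms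
    by (auto simp: skorokhod_dist_def intro!: cINF_greatest)
qed

lemma skorokhod_dist_commute_le:
  assumes "T > 0" and x: "x \<in> skorokhod_space T" and y: "y \<in> skorokhod_space T"
  shows "skorokhod_dist T y x \<le> skorokhod_dist T x y"
proof (rule dense_ge)
  fix e assume "skorokhod_dist T x y < e"
  then obtain u where u: "u \<in> time_changes T"
    and u1: "\<And>t. t \<in> {0..T} \<Longrightarrow> \<bar>u t - t\<bar> < e"
    and u2: "\<And>t. t \<in> {0..T} \<Longrightarrow> dist (x (u t)) (y t) < e"
    using skorokhod_dist_less[OF assms] by blast
  let ?v = "inv_into {0..T} u"
  have v: "?v \<in> time_changes T" using u by (rule time_changes_inv)
  have uv: "u (?v t) = t" if "t \<in> {0..T}" for t
    using u that by (auto simp: time_changes_def bij_betw_inv_into_right)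
  show "skorokhod_dist T y x \<le> e"
  proof (rule skorokhod_dist_le[OF assms(1) y x v])
    fix t assume t: "t \<in> {0..T}"
    show "\<bar>?v t - t\<bar> \<le> e" using u1[OF time_changesD[OF v t]] uv[OF t] by auto
    show "dist (y (?v t)) (x t) \<le> e"
      using u2[OF time_changesD[OF v t]] uv[OF t] by (simp add: dist_commute)
  qed
qed

lemma skorokhod_dist_self:
  assumes "T > 0" "x \<in> skorokhod_space T"
  shows "skorokhod_dist T x x = 0"
  using skorokhod_dist_le[OF assms(1) assms(2,2) id_in_time_changes, of 0]
    skorokhod_dist_nonneg[OF assms(1), of x x] by auto

lemma skorokhod_dist_eq_0D:
  fixes x y :: "real \<Rightarrow> 'b::metric_space"
  assumes T: "T > 0" and x: "x \<in> skorokhod_space T" and y: "y \<in> skorokhod_space T"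
    and 0: "skorokhod_dist T x y = 0"
  shows "x = y"
proof (rule extensionalityI)
  show "x \<in> extensional {0..T}" "y \<in> extensional {0..T}"
    using x y by (auto simp: skorokhod_space_def)
  fix t assume t: "t \<in> {0..T}"
  have "dist (x t) (y t) \<le> 0 + e" if e: "e > 0" for e
  proof (cases "t = T")
    case True
    obtain u where u: "u \<in> time_changes T" "\<And>t. t \<in> {0..T} \<Longrightarrow> dist (x (u t)) (y t) < e"
      by (rule skorokhod_dist_less[OF T x y, of e]) (use 0 e in auto)
    have "u T = T" using u(1) T by (rule time_changes_fix_end)
    then show ?thesis using u(2)[OF t] True by simp
  next
    case False
    then have lim: "(x \<longlongrightarrow> x t) (at_right t)" "(y \<longlongrightarrow> y t) (at_right t)"
      using x y t by (auto simp: skorokhod_space_def cadlag_on_def)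
    have "eventually (\<lambda>s. dist (x s) (x t) < e/3) (at_right t)"
      "eventually (\<lambda>s. dist (y s) (y t) < e/3) (at_right t)"
      using tendstoD[OF lim(1), of "e/3"] tendstoD[OF lim(2), of "e/3"] e by simp_all
    then obtain b1 b2 where b: "b1 > t" "\<And>s. s > t \<Longrightarrow> s < b1 \<Longrightarrow> dist (x s) (x t) < e/3"
      "b2 > t" "\<And>s. s > t \<Longrightarrow> s < b2 \<Longrightarrow> dist (y s) (y t) < e/3"
      by (auto simp: eventually_at_right_field)
    define d where "d = min (min (b1 - t) (b2 - t)) (T - t)"
    define s where "s = t + d / 2"
    have d: "d > 0" "d \<le> b1 - t" "d \<le> b2 - t" "d \<le> T - t"
      using b False t by (auto simp: d_def)
    have s: "s \<in> {0..T}" using d t by (auto simp: s_def)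
    obtain u where u: "u \<in> time_changes T"
      "\<And>t. t \<in> {0..T} \<Longrightarrow> \<bar>u t - t\<bar> < min (d/4) (e/3)"
      "\<And>t. t \<in> {0..T} \<Longrightarrow> dist (x (u t)) (y t) < min (d/4) (e/3)"
      by (rule skorokhod_dist_less[OF T x y, of "min (d/4) (e/3)"]) (use 0 e d in auto)
    have "\<bar>u s - s\<bar> < d/4" using u(2)[OF s] by simp
    then have us: "t < u s" "u s < b1" using d(1,2) s_def by linarith+
    have "dist (x (u s)) (x t) < e/3" using b(2) us by blast
    moreover have "dist (y s) (y t) < e/3" using b(4)[of s] d by (auto simp: s_def)
    moreover have "dist (x (u s)) (y s) < e/3" using u(3)[OF s] by simp
    moreover have "dist (x t) (y t) \<le> dist (x (u s)) (x t) + dist (x (u s)) (y s) + dist (y s) (y t)"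
      using dist_triangle[of "x t" "y t" "x (u s)"] dist_triangle[of "x (u s)" "y t" "y s"]
      by (simp add: dist_commute)
    ultimately show ?thesis by simp
  qed
  then have "dist (x t) (y t) \<le> 0" by (rule field_le_epsilon)
  then show "x t = y t" by simp
qed

lemma skorokhod_dist_triangle:
  assumes T: "T > 0" and x: "x \<in> skorokhod_space T" and y: "y \<in> skorokhod_space T"
    and z: "z \<in> skorokhod_space T"
  shows "skorokhod_dist T x z \<le> skorokhod_dist T x y + skorokhod_dist T y z"
proof (rule field_le_epsilon)
  fix e :: real assume e: "e > 0"
  define a where "a = skorokhod_dist T x y + e/2"
  define b where "b = skorokhod_dist T y z + e/2"
  obtain u where u: "u \<in> time_changes T" "\<And>t. t \<in> {0..T} \<Longrightarrow> \<bar>u t - t\<bar> < a"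
      "\<And>t. t \<in> {0..T} \<Longrightarrow> dist (x (u t)) (y t) < a"
    by (rule skorokhod_dist_less[OF T x y, of a]) (use e in \<open>auto simp: a_def\<close>)
  obtain v where v: "v \<in> time_changes T" "\<And>t. t \<in> {0..T} \<Longrightarrow> \<bar>v t - t\<bar> < b"
      "\<And>t. t \<in> {0..T} \<Longrightarrow> dist (y (v t)) (z t) < b"
    by (rule skorokhod_dist_less[OF T y z, of b]) (use e in \<open>auto simp: b_def\<close>)
  have "skorokhod_dist T x z \<le> a + b"
  proof (rule skorokhod_dist_le[OF T x z time_changes_comp[OF u(1) v(1)]])
    fix t assume t: "t \<in> {0..T}"
    note vt = time_changesD[OF v(1) t]
    show "\<bar>(u \<circ> v) t - t\<bar> \<le> a + b" using u(2)[OF vt] v(2)[OF t] by auto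
    show "dist (x ((u \<circ> v) t)) (z t) \<le> a + b"
      using u(3)[OF vt] v(3)[OF t] dist_triangle[of "x (u (v t))" "z t" "y (v t)"] by auto
  qed
  then show "skorokhod_dist T x z \<le> skorokhod_dist T x y + skorokhod_dist T y z + e"
    by (simp add: a_def b_def)
qed

lemma Metric_space_skorokhod:
  assumes "T > 0"
  shows "Metric_space (skorokhod_space T :: (real \<Rightarrow> 'b::metric_space) set) (skorokhod_dist T)"
proof
  fix x y :: "real \<Rightarrow> 'b"
  show "0 \<le> skorokhod_dist T x y" using assms by (rule skorokhod_dist_nonneg)
  show "skorokhod_dist T x y = skorokhod_dist T y x"
  proof (cases "x \<in> skorokhod_space T \<and> y \<in> skorokhod_space T")
    case True
    then show ?thesis using skorokhod_dist_commute_le[OF assms] by (intro order_antisym) blast+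
  next
    case False
    then show ?thesis by (auto simp: skorokhod_dist_def)
  qed
qed (use assms skorokhod_dist_self skorokhod_dist_eq_0D skorokhod_dist_triangle in blast)+


section \<open>Inverse Gaussian and Poisson laws\<close>

definition IG_density :: "real \<Rightarrow> real \<Rightarrow> real \<Rightarrow> real" where
  "IG_density \<mu> l x =
     (if 0 < x then sqrt (l / (2 * pi * x ^ 3)) * exp (- l * (x - \<mu>)\<^sup>2 / (2 * \<mu>\<^sup>2 * x)) else 0)"

definition IG :: "real \<Rightarrow> real \<Rightarrow> real measure" where
  "IG \<mu> l = density lborel (\<lambda>x. ennreal (IG_density \<mu> l x))"

text \<open>\<^const>\<open>poisson_pmf\<close> is only specified for positive rates. Negative parameters do not occur
  in the scheme (almost surely).\<close>

definition poisson_law :: "real \<Rightarrow> nat pmf" where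
  "poisson_law r = (if 0 < r then poisson_pmf r else return_pmf 0)"


section \<open>The Hawkes iVi scheme\<close>

text \<open>Only the values of \<open>g\<^sub>0\<close> and \<open>K\<close> on \<open>[0, T]\<close> enter below. They may be Lebesgue measurable,
  hence the integrals with respect to \<^const>\<open>lebesgue\<close>.\<close>

definition grid :: "real \<Rightarrow> nat \<Rightarrow> nat \<Rightarrow> real" where
  "grid T n i = real i * T / real n"

definition kincr :: "real \<Rightarrow> (real \<Rightarrow> real) \<Rightarrow> nat \<Rightarrow> nat \<Rightarrow> real" where
  "kincr T K n j = (LINT s:{grid T n j..grid T n (Suc j)}|lebesgue. K s)"

definition scheme_start :: "real \<Rightarrow> (real \<Rightarrow> real) \<Rightarrow> nat" where
  "scheme_start T K = (LEAST n. 1 \<le> n \<and> kincr T K n 0 < 1)"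

text \<open>In the following, \<open>N j\<close> is the increment of the counting variable over the \<open>j\<close>-th interval of
  the \<open>n\<close>-th grid.\<close>

definition alpha ::
    "real \<Rightarrow> (real \<Rightarrow> real) \<Rightarrow> (real \<Rightarrow> real) \<Rightarrow> nat \<Rightarrow> (nat \<Rightarrow> 'a \<Rightarrow> nat) \<Rightarrow> nat \<Rightarrow> 'a \<Rightarrow> real" where
  "alpha T g0 K n N i \<omega> =
     (LINT s:{grid T n i..grid T n (Suc i)}|lebesgue. g0 s) +
     (\<Sum>j<i. kincr T K n (i - j) * real (N j \<omega>))"

definition xi_law :: "real \<Rightarrow> real \<Rightarrow> real measure" where
  "xi_law a k =
     (if a = 0 then return borel 0
      else if k = 0 then return borel a
      else IG (a / (1 - k)) ((a / k)\<^sup>2))"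

text \<open>The \<open>\<sigma>\<close>-algebras generated by the variables \<open>\<xi>\<^sub>j, N\<^sub>j\<close>, \<open>j < i\<close>, and by these together
  with \<open>\<xi>\<^sub>i\<close>.\<close>

definition past :: "'a measure \<Rightarrow> (nat \<Rightarrow> 'a \<Rightarrow> real) \<Rightarrow> (nat \<Rightarrow> 'a \<Rightarrow> nat) \<Rightarrow> nat \<Rightarrow> 'a measure" where
  "past M \<xi> N i = vimage_algebra (space M) (\<lambda>\<omega>. \<lambda>j\<in>{..<i}. (\<xi> j \<omega>, N j \<omega>))
     (\<Pi>\<^sub>M j\<in>{..<i}. borel \<Otimes>\<^sub>M count_space UNIV)"

definition past_xi :: "'a measure \<Rightarrow> (nat \<Rightarrow> 'a \<Rightarrow> real) \<Rightarrow> (nat \<Rightarrow> 'a \<Rightarrow> nat) \<Rightarrow> nat \<Rightarrow> 'a measure" where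
  "past_xi M \<xi> N i = vimage_algebra (space M) (\<lambda>\<omega>. (\<lambda>j\<in>{..<i}. (\<xi> j \<omega>, N j \<omega>), \<xi> i \<omega>))
     ((\<Pi>\<^sub>M j\<in>{..<i}. borel \<Otimes>\<^sub>M count_space UNIV) \<Otimes>\<^sub>M borel)"

text \<open>Conditionally on the \<open>\<sigma>\<close>-algebra \<open>F\<close>, the variable \<open>X\<close> has the (random) law \<open>\<kappa>\<close>.\<close>

definition has_conditional_law ::
    "'a measure \<Rightarrow> 'a measure \<Rightarrow> 'b measure \<Rightarrow> ('a \<Rightarrow> 'b) \<Rightarrow> ('a \<Rightarrow> 'b measure) \<Rightarrow> bool" where
  "has_conditional_law M F S X \<kappa> \<longleftrightarrow>
     X \<in> M \<rightarrow>\<^sub>M S \<and>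
     (\<forall>B\<in>sets S. AE \<omega> in M. real_cond_exp M F (indicator (X -` B \<inter> space M)) \<omega> = measure (\<kappa> \<omega>) B)"

definition hawkes_iVi ::
    "'a measure \<Rightarrow> real \<Rightarrow> (real \<Rightarrow> real) \<Rightarrow> (real \<Rightarrow> real) \<Rightarrow> nat \<Rightarrow>
     (nat \<Rightarrow> 'a \<Rightarrow> real) \<Rightarrow> (nat \<Rightarrow> 'a \<Rightarrow> nat) \<Rightarrow> bool" where
  "hawkes_iVi M T g0 K n \<xi> N \<longleftrightarrow>
     (\<forall>i<n.
        has_conditional_law M (past M \<xi> N i) borel (\<xi> i)
          (\<lambda>\<omega>. xi_law (alpha T g0 K n N i \<omega>) (kincr T K n 0)) \<and>
        has_conditional_law M (past_xi M \<xi> N i) (count_space UNIV) (N i)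
          (\<lambda>\<omega>. measure_pmf (poisson_law (\<xi> i \<omega>))))"

definition steps :: "real \<Rightarrow> nat \<Rightarrow> real \<Rightarrow> nat" where
  "steps T n t = nat \<lfloor>real n * t / T\<rfloor>"

definition scheme_N :: "real \<Rightarrow> nat \<Rightarrow> (nat \<Rightarrow> 'a \<Rightarrow> nat) \<Rightarrow> real \<Rightarrow> 'a \<Rightarrow> real" where
  "scheme_N T n N t \<omega> = (\<Sum>i<steps T n t. real (N i \<omega>))"

definition scheme_Lambda ::
    "real \<Rightarrow> (real \<Rightarrow> real) \<Rightarrow> (real \<Rightarrow> real) \<Rightarrow> nat \<Rightarrow> (nat \<Rightarrow> 'a \<Rightarrow> nat) \<Rightarrow> real \<Rightarrow> 'a \<Rightarrow> real" where
  "scheme_Lambda T g0 K n N t \<omega> =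
     (\<Sum>i<steps T n t. alpha T g0 K n N i \<omega> + kincr T K n 0 * real (N i \<omega>))"


section \<open>Hawkes processes\<close>

definition jump :: "(real \<Rightarrow> real) \<Rightarrow> real \<Rightarrow> real" where
  "jump x t = x t - Lim (at_left t) x"

definition piecewise_constant_on :: "real \<Rightarrow> (real \<Rightarrow> real) \<Rightarrow> bool" where
  "piecewise_constant_on T x \<longleftrightarrow>
     (\<exists>P. finite P \<and> (\<forall>s\<in>{0..T}. \<forall>t\<in>{0..T}. s \<le> t \<and> {s<..t} \<inter> P = {} \<longrightarrow> x s = x t))"

definition counting_path :: "real \<Rightarrow> (real \<Rightarrow> real) \<Rightarrow> bool" where
  "counting_path T x \<longleftrightarrow>
     cadlag_on T x \<and> piecewise_constant_on T x \<and> x 0 = 0 \<and>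
     (\<forall>t\<in>{0<..T}. jump x t \<noteq> 0 \<longrightarrow> jump x t = 1)"

text \<open>For a piecewise constant path the Stieltjes integral \<open>\<integral>\<^sub>0\<^sup>t K (t - s) dx\<^sub>s\<close> is the sum over the
  finitely many jumps. A jump at time \<open>t\<close> itself is not counted (so the intensity is predictable);
  counting it would change the intensity only at the jump times, hence not its integral.\<close>

definition hawkes_intensity ::
    "(real \<Rightarrow> real) \<Rightarrow> (real \<Rightarrow> real) \<Rightarrow> (real \<Rightarrow> 'a \<Rightarrow> real) \<Rightarrow> real \<Rightarrow> 'a \<Rightarrow> real" where
  "hawkes_intensity g0 K N t \<omega> =
     g0 t + (\<Sum>s | 0 < s \<and> s < t \<and> jump (\<lambda>r. N r \<omega>) s \<noteq> 0. K (t - s) * jump (\<lambda>r. N r \<omega>) s)"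

definition hawkes_Lambda ::
    "(real \<Rightarrow> real) \<Rightarrow> (real \<Rightarrow> real) \<Rightarrow> (real \<Rightarrow> 'a \<Rightarrow> real) \<Rightarrow> real \<Rightarrow> 'a \<Rightarrow> real" where
  "hawkes_Lambda g0 K N t \<omega> = (LINT s:{0..t}|lebesgue. hawkes_intensity g0 K N s \<omega>)"

definition natural_filtration :: "'a measure \<Rightarrow> (real \<Rightarrow> 'a \<Rightarrow> real) \<Rightarrow> real \<Rightarrow> 'a measure" where
  "natural_filtration M X t =
     vimage_algebra (space M) (\<lambda>\<omega>. \<lambda>s\<in>{0..t}. X s \<omega>) (\<Pi>\<^sub>M s\<in>{0..t}. borel)"

definition martingale_on ::
    "'a measure \<Rightarrow> real \<Rightarrow> (real \<Rightarrow> 'a measure) \<Rightarrow> (real \<Rightarrow> 'a \<Rightarrow> real) \<Rightarrow> bool" where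
  "martingale_on M T F X \<longleftrightarrow>
     (\<forall>t\<in>{0..T}. integrable M (X t) \<and> X t \<in> borel_measurable (F t)) \<and>
     (\<forall>s\<in>{0..T}. \<forall>t\<in>{s..T}. AE \<omega> in M. real_cond_exp M (F s) (X t) \<omega> = X s \<omega>)"

definition hawkes_process ::
    "'a measure \<Rightarrow> real \<Rightarrow> (real \<Rightarrow> real) \<Rightarrow> (real \<Rightarrow> real) \<Rightarrow> (real \<Rightarrow> 'a \<Rightarrow> real) \<Rightarrow> bool" where
  "hawkes_process M T g0 K N \<longleftrightarrow>
     (\<forall>t\<in>{0..T}. N t \<in> borel_measurable M) \<and>
     (\<forall>\<omega>\<in>space M. counting_path T (\<lambda>t. N t \<omega>)) \<and>
     martingale_on M T (natural_filtration M N) (\<lambda>t \<omega>. N t \<omega> - hawkes_Lambda g0 K N t \<omega>)"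

end

theory Submission
  imports Defs
begin

text \<open>
The idea is to drive both the scheme and the Hawkes process by the same sequence of independent
standard exponential clocks \<open>w\<^sub>0, w\<^sub>1, \<dots>\<close>; this sequence space is the probability space of the limit.

\<^item> Let \<open>G\<close> and \<open>\<kappa>\<close> be the primitives of \<open>g0\<close> and \<open>K\<close>. After \<open>k\<close> jumps at \<open>\<tau>\<^sub>0 < \<dots> < \<tau>\<^bsub>k-1\<^esub>\<close> the integrated
intensity is \<open>G t + (\<Sum>j<k. \<kappa> (t - \<tau>\<^sub>j))\<close>, and the next jump happens when it reaches \<open>w\<^sub>0 + \<dots> + w\<^sub>k\<close>.
Conditionally on the earlier clocks, the compensated indicator of this jump has mean zero because
the clock is exponential (\<open>integral_hazard_gap_increment\<close>). Summing over the jumps gives the martingale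
property. A delayed Gronwall argument (\<open>expected_counted_bounded\<close>) bounds the expected number of
jumps, so there is no explosion.

\<^item> In the scheme, a cell with parameter \<open>\<alpha>\<close> stays empty with probability exactly \<open>exp (- c \<alpha>)\<close>,
where \<open>c\<close> depends on \<open>n\<close> only and tends to 1: this is the Laplace transform of the inverse Gaussian
law, which exponential tilting reduces to its total mass. By the lack of memory, the grid process
which jumps in the first cell where the accumulated value of \<open>c \<alpha>\<close> since the last jump reaches the
current clock has these same probabilities, except that it never jumps more than once in a cell
(\<open>jump_bit_prob\<close>).

\<^item> On almost every clock sequence the jump times of the grid process converge to the \<open>\<tau>\<^sub>k\<close>
(\<open>tendsto_jump_cell\<close>), and the paths converge in the Skorokhod distance (\<open>J1_convergence\<close>). For this
one only has to avoid that a clock rings exactly on a flat piece of the integrated intensity.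

\<^item> Each 0/1 pattern has under the scheme at least \<open>law_ratio\<close> times its probability under the grid
process, and this ratio tends to 1 along almost every clock sequence (\<open>law_ratio_tendsto_1\<close>). Since
both are probabilities, the laws become close in total variation, and expectations of bounded
continuous functions have the same limit (\<open>scheme_expectation_limit\<close>).
\<close>

section \<open>The inverse Gaussian law and its Poisson mixture\<close>

lemma cdf_std_normal_has_derivative:
  "(cdf std_normal_distribution has_real_derivative std_normal_density x) (at x)"
proof -
  let ?M = "density lborel std_normal_density"
  interpret real_distribution ?M by (rule real_dist_normal_dist)
  have cont: "isCont std_normal_density t" for t
    unfolding std_normal_density_def by (intro continuous_intros) auto
  obtain F where F: "\<And>t. (F has_vector_derivative std_normal_density t) (at t)"
    using einterval_antiderivative[of "-\<infinity>" "\<infinity>" std_normal_density] cont by auto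
  have incr: "cdf ?M b - cdf ?M a = F b - F a" if "a < b" for a b
  proof -
    have int: "set_integrable lborel {a<..b} std_normal_density"
      unfolding set_integrable_def
      by (rule integrable_mult_indicator) (use integrable_std_normal_moment[of 0] in auto)
    have "cdf ?M b - cdf ?M a = measure ?M {a<..b}"
      using cdf_diff_eq[OF that] by simp
    also have "\<dots> = enn2real (\<integral>\<^sup>+t. ennreal (indicator {a<..b} t * std_normal_density t) \<partial>lborel)"
      unfolding measure_def
      by (subst emeasure_density) (auto intro!: arg_cong[where f = enn2real] nn_integral_cong split: split_indicator)
    also have "\<dots> = (LBINT t:{a<..b}. std_normal_density t)"
      using int unfolding set_integrable_def set_lebesgue_integral_def
      by (subst nn_integral_eq_integral) auto
    also have "\<dots> = (LBINT t=ereal a..ereal b. std_normal_density t)"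
      using that by (simp add: interval_integral_Ioc)
    also have "\<dots> = F b - F a"
    proof (rule interval_integral_FTC_finite)
      show "continuous_on {min a b..max a b} std_normal_density"
        using cont by (simp add: continuous_at_imp_continuous_on)
      show "(F has_vector_derivative std_normal_density t) (at t within {min a b..max a b})" for t
        using F by (rule has_vector_derivative_at_within)
    qed
    finally show ?thesis .
  qed
  have "cdf ?M = (\<lambda>t. F t + (cdf ?M 0 - F 0))"
  proof
    show "cdf ?M t = F t + (cdf ?M 0 - F 0)" for t
      using incr[of 0 t] incr[of t 0] by (cases t "0::real" rule: linorder_cases) auto
  qed
  moreover have "((\<lambda>t. F t + (cdf ?M 0 - F 0)) has_real_derivative std_normal_density x) (at x)"
    using F[of x] by (auto simp: has_real_derivative_iff_has_vector_derivative[symmetric] intro!: derivative_eq_intros)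
  ultimately show ?thesis by simp
qed

lemma IG_density_nonneg: "0 \<le> l \<Longrightarrow> 0 \<le> IG_density \<mu> l x"
  by (simp add: IG_density_def)

text \<open>With \<open>\<Phi>\<close> the normal distribution function, \<open>y x = sqrt l (sqrt x / \<mu> - 1 / sqrt x)\<close> and
  \<open>z x = - sqrt l (sqrt x / \<mu> + 1 / sqrt x)\<close>, the exponent of the density is \<open>- (y x)\<^sup>2 / 2\<close> and
  \<open>(z x)\<^sup>2 = (y x)\<^sup>2 + 4 l / \<mu>\<close>. Hence \<open>\<Phi> (y x)\<close> and \<open>exp (2 l / \<mu>) * \<Phi> (z x)\<close> are primitives of
  \<open>(1 + x / \<mu>) / 2\<close> and \<open>(1 - x / \<mu>) / 2\<close> times the density. The first increases from 0 to 1, the second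
  vanishes at both ends, so mass and mean over \<open>\<mu>\<close> have average 1 and are equal.\<close>

lemma IG_density_integrals:
  fixes \<mu> l :: real
  assumes \<mu>: "\<mu> > 0" and l: "l > 0"
  shows "integrable lborel (IG_density \<mu> l)" "integrable lborel (\<lambda>x. x * IG_density \<mu> l x)"
    and "(\<integral>x. IG_density \<mu> l x \<partial>lborel) = 1" "(\<integral>x. x * IG_density \<mu> l x \<partial>lborel) = \<mu>"
proof -
  let ?Phi = "cdf std_normal_distribution"
  let ?f = "IG_density \<mu> l"
  interpret real_distribution std_normal_distribution by (rule real_dist_normal_dist)
  define y where "y x = sqrt l * (sqrt x / \<mu> - 1 / sqrt x)" for x
  define z where "z x = - (sqrt l * (sqrt x / \<mu> + 1 / sqrt x))" for x
  have f: "?f x = sqrt l / (sqrt x * x) * std_normal_density (y x)" if x: "x > 0" for x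
  proof -
    have "(y x)\<^sup>2 = l * (sqrt x / \<mu> - 1 / sqrt x)\<^sup>2" using l by (simp add: y_def power_mult_distrib)
    also have "sqrt x / \<mu> - 1 / sqrt x = (x - \<mu>) / (\<mu> * sqrt x)"
      using x \<mu> by (simp add: field_simps)
    also have "l * ((x - \<mu>) / (\<mu> * sqrt x))\<^sup>2 = l * (x - \<mu>)\<^sup>2 / (\<mu>\<^sup>2 * x)"
      using x by (simp add: power_divide power_mult_distrib)
    finally have y2: "- (y x)\<^sup>2 / 2 = - l * (x - \<mu>)\<^sup>2 / (2 * \<mu>\<^sup>2 * x)" by simp
    have "sqrt (l / (2 * pi * x ^ 3)) = sqrt l / (sqrt (2 * pi) * (sqrt x * x))"
      using x by (simp add: real_sqrt_divide real_sqrt_mult power3_eq_cube)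
    then show ?thesis
      using x unfolding IG_density_def std_normal_density_def y2[symmetric] by simp
  qed
  have z: "std_normal_density (z x) = exp (- 2 * l / \<mu>) * std_normal_density (y x)" if x: "x > 0" for x
  proof -
    have "(z x)\<^sup>2 = (y x)\<^sup>2 + 4 * l / \<mu>"
      using x l \<mu> by (simp add: y_def z_def power2_eq_square field_simps)
    then have "- (z x)\<^sup>2 / 2 = - 2 * l / \<mu> + - (y x)\<^sup>2 / 2" by simp
    then show ?thesis by (simp only: std_normal_density_def exp_add) simp
  qed
  have dy: "(y has_real_derivative sqrt l / (sqrt x * x) * ((1 + x / \<mu>) / 2)) (at x)" if x: "x > 0" for x
    unfolding y_def using x \<mu> by (auto intro!: derivative_eq_intros simp: field_simps)
  have dz: "(z has_real_derivative sqrt l / (sqrt x * x) * ((1 - x / \<mu>) / 2)) (at x)" if x: "x > 0" for x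
    unfolding z_def using x \<mu> by (auto intro!: derivative_eq_intros simp: field_simps)
  have dA: "((\<lambda>x. ?Phi (y x)) has_real_derivative (1 + x / \<mu>) / 2 * ?f x) (at x)" if "x > 0" for x
    using DERIV_chain2[OF cdf_std_normal_has_derivative dy[OF that]] that by (simp add: f mult_ac)
  have dB: "((\<lambda>x. ?Phi (z x)) has_real_derivative exp (- 2 * l / \<mu>) * ((1 - x / \<mu>) / 2 * ?f x)) (at x)" if "x > 0" for x
    using DERIV_chain2[OF cdf_std_normal_has_derivative dz[OF that]] that by (simp add: f z mult_ac)
  have y0: "filterlim y at_bot (at_right 0)" unfolding y_def using l \<mu> by real_asymp
  have y1: "filterlim y at_top at_top" unfolding y_def using l \<mu> by real_asymp
  have z0: "filterlim z at_bot (at_right 0)" unfolding z_def using l \<mu> by real_asymp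
  have z1: "filterlim z at_bot at_top" unfolding z_def using l \<mu> by real_asymp
  have A: "((\<lambda>x. ?Phi (y x)) \<longlongrightarrow> 0) (at_right 0)" "((\<lambda>x. ?Phi (y x)) \<longlongrightarrow> 1) at_top"
    using filterlim_compose[OF cdf_lim_at_bot y0] filterlim_compose[OF cdf_lim_at_top_prob y1] by auto
  have B: "((\<lambda>x. ?Phi (z x)) \<longlongrightarrow> 0) (at_right 0)" "((\<lambda>x. ?Phi (z x)) \<longlongrightarrow> 0) at_top"
    using filterlim_compose[OF cdf_lim_at_bot z0] filterlim_compose[OF cdf_lim_at_bot z1] by auto
  have pos: "0 \<le> ?f x" for x using l by (simp add: IG_density_def)
  have cont: "isCont ?f x" if "x > 0" for x
  proof (rule isCont_cong[THEN iffD2])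
    show "\<forall>\<^sub>F x in nhds x. ?f x = sqrt (l / (2 * pi * x ^ 3)) * exp (- l * (x - \<mu>)\<^sup>2 / (2 * \<mu>\<^sup>2 * x))"
      using eventually_nhds_in_open[of "{0<..}" x] that by (auto elim!: eventually_mono simp: IG_density_def)
    show "isCont (\<lambda>x. sqrt (l / (2 * pi * x ^ 3)) * exp (- l * (x - \<mu>)\<^sup>2 / (2 * \<mu>\<^sup>2 * x))) x"
      using that \<mu> by (intro continuous_intros) auto
  qed
  note FTCA = interval_integral_FTC_nonneg[of "ereal 0" \<infinity> "\<lambda>x. ?Phi (y x)" "\<lambda>x. (1 + x / \<mu>) / 2 * ?f x" 0 1]
  have IA: "set_integrable lborel (einterval (ereal 0) \<infinity>) (\<lambda>x. (1 + x / \<mu>) / 2 * ?f x)"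
    by (rule FTCA) (use dA cont A pos \<mu> in \<open>auto simp: ereal_tendsto_simps intro!: continuous_intros\<close>)
  have VA: "(LBINT x=ereal 0..\<infinity>. (1 + x / \<mu>) / 2 * ?f x) = 1"
    by (subst FTCA) (use dA cont A pos \<mu> in \<open>auto simp: ereal_tendsto_simps intro!: continuous_intros\<close>)
  have ind: "(\<lambda>x. indicator (einterval (ereal 0) \<infinity>) x * (h x * ?f x)) = (\<lambda>x. h x * ?f x)" for h
    by (auto simp: indicator_def einterval_def IG_density_def)
  have meas[measurable]: "?f \<in> borel_measurable lborel" unfolding IG_density_def by measurable
  have IA': "integrable lborel (\<lambda>x. (1 + x / \<mu>) / 2 * ?f x)"
    using IA unfolding set_integrable_def real_scaleR_def ind .
  have VA': "(\<integral>x. (1 + x / \<mu>) / 2 * ?f x \<partial>lborel) = 1"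
    using VA unfolding interval_lebesgue_integral_def set_lebesgue_integral_def real_scaleR_def ind by (simp add: zero_ereal_def[symmetric])
  have fb: "?f x \<noteq> 0 \<Longrightarrow> x > 0" for x by (auto simp: IG_density_def split: if_splits)
  have bnd: "norm (?f x) \<le> norm (2 * ((1 + x / \<mu>) / 2 * ?f x))" "norm (x * ?f x) \<le> norm (2 * \<mu> * ((1 + x / \<mu>) / 2 * ?f x))" for x
    using fb[of x] pos[of x] \<mu> by (cases "?f x = 0"; force simp: abs_mult field_simps)+
  show I1: "integrable lborel ?f"
    by (rule Bochner_Integration.integrable_bound[OF integrable_mult_right[OF IA', of 2]]) (use bnd in auto)
  show I2: "integrable lborel (\<lambda>x. x * ?f x)"
    by (rule Bochner_Integration.integrable_bound[OF integrable_mult_right[OF IA', of "2 * \<mu>"]]) (use bnd in auto)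
  have IB': "integrable lborel (\<lambda>x. exp (- 2 * l / \<mu>) * ((1 - x / \<mu>) / 2 * ?f x))"
  proof -
    have "integrable lborel (\<lambda>x. exp (- 2 * l / \<mu>) * (?f x / 2 - (x * ?f x) / (2 * \<mu>)))"
      using I1 I2 by auto
    then show ?thesis using \<mu> by (simp add: field_simps)
  qed
  then have IB: "set_integrable lborel (einterval (ereal 0) \<infinity>) (\<lambda>x. exp (- 2 * l / \<mu>) * ((1 - x / \<mu>) / 2 * ?f x))"
    unfolding set_integrable_def using ind[of "\<lambda>x. exp (- 2 * l / \<mu>) * ((1 - x / \<mu>) / 2)"] by (simp add: mult.assoc)
  have VB: "(LBINT x=ereal 0..\<infinity>. exp (- 2 * l / \<mu>) * ((1 - x / \<mu>) / 2 * ?f x)) = 0 - 0"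
    by (rule interval_integral_FTC_integrable[where F = "\<lambda>x. ?Phi (z x)"])
      (use dB cont B \<mu> IB in \<open>auto simp: ereal_tendsto_simps has_real_derivative_iff_has_vector_derivative[symmetric] intro!: continuous_intros\<close>)
  have "(\<integral>x. exp (- 2 * l / \<mu>) * ((1 - x / \<mu>) / 2 * ?f x) \<partial>lborel) = 0"
  proof -
    have "(\<lambda>x. indicator (einterval (ereal 0) \<infinity>) x *\<^sub>R (exp (- 2 * l / \<mu>) * ((1 - x / \<mu>) / 2 * ?f x)))
        = (\<lambda>x. exp (- 2 * l / \<mu>) * ((1 - x / \<mu>) / 2 * ?f x))"
      by (auto simp: fun_eq_iff indicator_def einterval_def IG_density_def)
    then show ?thesis using VB unfolding interval_lebesgue_integral_def set_lebesgue_integral_def by simp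
  qed
  then have VB': "(\<integral>x. (1 - x / \<mu>) / 2 * ?f x \<partial>lborel) = 0" by simp
  have "(\<integral>x. (1 + x / \<mu>) / 2 * ?f x \<partial>lborel) = (\<integral>x. ?f x / 2 + (x * ?f x) / (2 * \<mu>) \<partial>lborel)"
    using \<mu> by (intro Bochner_Integration.integral_cong) (auto simp: field_simps)
  also have "\<dots> = (\<integral>x. ?f x \<partial>lborel) / 2 + (\<integral>x. x * ?f x \<partial>lborel) / (2 * \<mu>)"
    using I1 I2 by simp
  finally have e1: "(\<integral>x. ?f x \<partial>lborel) / 2 + (\<integral>x. x * ?f x \<partial>lborel) / (2 * \<mu>) = 1" using VA' by simp
  have "(\<integral>x. (1 - x / \<mu>) / 2 * ?f x \<partial>lborel) = (\<integral>x. ?f x / 2 - (x * ?f x) / (2 * \<mu>) \<partial>lborel)"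
    using \<mu> by (intro Bochner_Integration.integral_cong) (auto simp: field_simps)
  also have "\<dots> = (\<integral>x. ?f x \<partial>lborel) / 2 - (\<integral>x. x * ?f x \<partial>lborel) / (2 * \<mu>)"
    using I1 I2 by simp
  finally have e2: "(\<integral>x. ?f x \<partial>lborel) / 2 = (\<integral>x. x * ?f x \<partial>lborel) / (2 * \<mu>)" using VB' by simp
  show "(\<integral>x. ?f x \<partial>lborel) = 1" using e1 e2 by simp
  show "(\<integral>x. x * ?f x \<partial>lborel) = \<mu>" using e1 e2 \<mu> by (simp add: field_simps)
qed

text \<open>For \<open>\<xi>\<close> with the law of the scheme for the parameters \<open>a\<close> and \<open>k\<close>, a mixed Poisson variable takes
  the value 0 with probability \<open>exp (- ivi_c k * a)\<close> and 1 with probability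
  \<open>exp (- ivi_c k * a) * (ivi_d k * a)\<close>. That the first is exactly exponential in \<open>a\<close> makes the coupling
  with exponential clocks possible.\<close>

definition ivi_c :: "real \<Rightarrow> real" where
  "ivi_c k = 2 / (1 - k + sqrt ((1 - k)\<^sup>2 + 2 * k\<^sup>2))"

definition ivi_d :: "real \<Rightarrow> real" where
  "ivi_d k = 1 / sqrt ((1 - k)\<^sup>2 + 2 * k\<^sup>2)"

lemma ivi_c_pos: "k < 1 \<Longrightarrow> 0 < ivi_c k"
  by (auto simp: ivi_c_def intro!: divide_pos_pos add_pos_nonneg)

lemma ivi_d_pos: "k < 1 \<Longrightarrow> 0 < ivi_d k"
  by (auto simp: ivi_d_def intro!: divide_pos_pos add_pos_nonneg)

lemma ivi_c_0: "ivi_c 0 = 1" and ivi_d_0: "ivi_d 0 = 1"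
  by (auto simp: ivi_c_def ivi_d_def)

lemma ivi_d_le_c: assumes "0 \<le> k" "k < 1" shows "ivi_d k \<le> ivi_c k"
proof -
  have "1 - k = sqrt ((1 - k)\<^sup>2)" using assms by simp
  also have "\<dots> \<le> sqrt ((1 - k)\<^sup>2 + 2 * k\<^sup>2)" by (intro real_sqrt_le_mono) auto
  finally have *: "1 - k \<le> sqrt ((1 - k)\<^sup>2 + 2 * k\<^sup>2)" .
  then have "(1 - k + sqrt ((1 - k)\<^sup>2 + 2 * k\<^sup>2)) \<le> 2 * sqrt ((1 - k)\<^sup>2 + 2 * k\<^sup>2)" by simp
  moreover have "0 < sqrt ((1 - k)\<^sup>2 + 2 * k\<^sup>2)" using * assms by linarith
  ultimately show ?thesis using assms unfolding ivi_c_def ivi_d_def by (simp add: divide_simps)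
qed

lemma isCont_ivi: "isCont ivi_c 0" "isCont ivi_d 0"
  unfolding ivi_c_def ivi_d_def by (intro continuous_intros; simp)+

text \<open>Completing the square: tilting by \<open>exp (- x)\<close> stays within the inverse Gaussian family, so the
  Laplace transform and the tilted mean follow from the mass and the mean.\<close>

lemma IG_density_exp:
  assumes \<mu>: "\<mu> > 0" and l: "l > 0"
  defines "r \<equiv> sqrt (1 + 2 * \<mu>\<^sup>2 / l)"
  shows "exp (- x) * IG_density \<mu> l x = exp (l / \<mu> * (1 - r)) * IG_density (\<mu> / r) l x"
proof (cases "x > 0")
  case True
  have r2: "r\<^sup>2 = 1 + 2 * \<mu>\<^sup>2 / l" unfolding r_def using l by (intro real_sqrt_pow2) (auto intro: add_nonneg_nonneg)
  have r: "r > 0" unfolding r_def using l by (auto intro!: add_pos_nonneg)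
  have e: "- l * (x - m)\<^sup>2 / (2 * m\<^sup>2 * x) = - l * x / 2 * (1 / m)\<^sup>2 + l / m - l / (2 * x)" if "m > 0" for m
    using that True by (simp add: field_simps power2_eq_square)
  have inv: "(1 / (\<mu> / r))\<^sup>2 = (1 / \<mu>)\<^sup>2 + 2 / l"
    using r2 \<mu> l by (simp add: power_divide field_simps)
  have "- x + - l * (x - \<mu>)\<^sup>2 / (2 * \<mu>\<^sup>2 * x) = l / \<mu> * (1 - r) + - l * (x - \<mu> / r)\<^sup>2 / (2 * (\<mu> / r)\<^sup>2 * x)"
    unfolding e[OF \<mu>] e[OF divide_pos_pos[OF \<mu> r]] inv using \<mu> r l by (simp add: field_simps)
  then have "exp (- x) * exp (- l * (x - \<mu>)\<^sup>2 / (2 * \<mu>\<^sup>2 * x)) = exp (l / \<mu> * (1 - r)) * exp (- l * (x - \<mu> / r)\<^sup>2 / (2 * (\<mu> / r)\<^sup>2 * x))"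
    by (simp only: exp_add[symmetric])
  then show ?thesis using True by (simp add: IG_density_def)
qed (simp add: IG_density_def)

lemma integral_IG:
  assumes "l > 0" "f \<in> borel_measurable borel"
  shows "(\<integral>x. f x \<partial>IG \<mu> l) = (\<integral>x. f x * IG_density \<mu> l x \<partial>lborel)"
proof -
  have [measurable]: "IG_density \<mu> l \<in> borel_measurable lborel" unfolding IG_density_def by measurable
  show ?thesis unfolding IG_def using assms
    by (subst integral_density) (auto simp: IG_density_def mult.commute)
qed

lemma mixed_poisson_IG:
  assumes \<mu>: "\<mu> > 0" and l: "l > 0"
  defines "r \<equiv> sqrt (1 + 2 * \<mu>\<^sup>2 / l)"
  shows "(\<integral>x. exp (- x) \<partial>IG \<mu> l) = exp (l / \<mu> * (1 - r))"
    and "(\<integral>x. exp (- x) * x \<partial>IG \<mu> l) = exp (l / \<mu> * (1 - r)) * (\<mu> / r)"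
proof -
  have r: "\<mu> / r > 0" unfolding r_def using l \<mu> by (auto intro!: add_pos_nonneg divide_pos_pos)
  show "(\<integral>x. exp (- x) \<partial>IG \<mu> l) = exp (l / \<mu> * (1 - r))"
    unfolding integral_IG[OF l borel_measurable_continuous_onI[OF continuous_on_exp[OF continuous_on_minus[OF continuous_on_id]]]]
    using IG_density_exp[OF \<mu> l] IG_density_integrals[OF r l] by (simp add: r_def)
  have "(\<integral>x. exp (- x) * x \<partial>IG \<mu> l) = (\<integral>x. exp (- x) * x * IG_density \<mu> l x \<partial>lborel)"
    by (rule integral_IG[OF l]) measurable
  also have "\<dots> = (\<integral>x. exp (l / \<mu> * (1 - r)) * (x * IG_density (\<mu> / r) l x) \<partial>lborel)"
    using IG_density_exp[OF \<mu> l] by (intro Bochner_Integration.integral_cong) (auto simp: r_def mult_ac)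
  finally show "(\<integral>x. exp (- x) * x \<partial>IG \<mu> l) = exp (l / \<mu> * (1 - r)) * (\<mu> / r)"
    using IG_density_integrals(4)[OF r l] by simp
qed

lemma sets_xi_law[simp]: "sets (xi_law a k) = sets borel"
  by (simp add: xi_law_def IG_def)

lemma poisson_law_0: "pmf (poisson_law x) 0 = (if 0 < x then exp (- x) else 1)"
  and poisson_law_1: "pmf (poisson_law x) (Suc 0) = (if 0 < x then exp (- x) * x else 0)"
  by (auto simp: poisson_law_def)

lemma prob_space_xi_law:
  assumes "0 \<le> a" "0 \<le> k" "k < 1"
  shows "prob_space (xi_law a k)"
proof -
  have "prob_space (IG \<mu> l)" if "\<mu> > 0" "l > 0" for \<mu> l
  proof
    have "(\<integral>\<^sup>+x. ennreal (IG_density \<mu> l x) \<partial>lborel) = 1"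
      using IG_density_integrals[OF that] that by (subst nn_integral_eq_integral) (auto intro!: AE_I2 IG_density_nonneg)
    moreover have [measurable]: "IG_density \<mu> l \<in> borel_measurable lborel" unfolding IG_density_def by measurable
    ultimately show "emeasure (IG \<mu> l) (space (IG \<mu> l)) = 1"
      by (simp add: IG_def emeasure_density)
  qed
  then show ?thesis using assms by (auto simp: xi_law_def prob_space_return)
qed

lemma mixed_poisson_xi_law:
  assumes a: "0 \<le> a" and k: "0 \<le> k" "k < 1"
  shows "(\<integral>x. pmf (poisson_law x) 0 \<partial>xi_law a k) = exp (- (ivi_c k * a))"
    and "(\<integral>x. pmf (poisson_law x) (Suc 0) \<partial>xi_law a k) = exp (- (ivi_c k * a)) * (ivi_d k * a)"
proof -
  have m[measurable]: "(\<lambda>x. pmf (poisson_law x) 0) \<in> borel_measurable borel"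
    "(\<lambda>x. pmf (poisson_law x) (Suc 0)) \<in> borel_measurable borel"
    unfolding poisson_law_0 poisson_law_1 by measurable
  consider "a = 0" | "a \<noteq> 0" "k = 0" | "a > 0" "k > 0" using assms by fastforce
  then have "(\<integral>x. pmf (poisson_law x) 0 \<partial>xi_law a k) = exp (- (ivi_c k * a)) \<and>
     (\<integral>x. pmf (poisson_law x) (Suc 0) \<partial>xi_law a k) = exp (- (ivi_c k * a)) * (ivi_d k * a)"
  proof cases
    case 1
    then show ?thesis using m by (simp add: xi_law_def integral_return poisson_law_0 poisson_law_1)
  next
    case 2
    then show ?thesis using m a by (simp add: xi_law_def integral_return poisson_law_0 poisson_law_1 ivi_c_0 ivi_d_0)
  next
    case 3
    define \<mu> where "\<mu> = a / (1 - k)"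
    define l where "l = (a / k)\<^sup>2"
    define q where "q = sqrt ((1 - k)\<^sup>2 + 2 * k\<^sup>2)"
    have \<mu>: "\<mu> > 0" and l: "l > 0" using 3 k by (auto simp: \<mu>_def l_def)
    have q: "q > 0" "q\<^sup>2 = (1 - k)\<^sup>2 + 2 * k\<^sup>2" using k 
      by (auto simp: q_def intro!: add_pos_nonneg)
    have "1 + 2 * \<mu>\<^sup>2 / l = (q / (1 - k))\<^sup>2"
      unfolding power_divide q(2) using 3 k by (simp add: \<mu>_def l_def field_simps)
    then have r: "sqrt (1 + 2 * \<mu>\<^sup>2 / l) = q / (1 - k)" using q k by simp
    have "(q - (1 - k)) * (q + (1 - k)) = 2 * k\<^sup>2" using q(2) by (simp add: power2_eq_square algebra_simps)
    then have "2 / (1 - k + q) = (q - (1 - k)) / k\<^sup>2" using q k 3 by (simp add: field_simps)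
    then have c: "l / \<mu> * (1 - q / (1 - k)) = - (ivi_c k * a)"
      unfolding ivi_c_def q_def[symmetric] \<open>2 / (1 - k + q) = (q - (1 - k)) / k\<^sup>2\<close> using 3 k
      by (simp add: l_def \<mu>_def divide_simps) (simp add: power2_eq_square algebra_simps)
    have d: "\<mu> / (q / (1 - k)) = ivi_d k * a"
      unfolding ivi_d_def q_def[symmetric] using 3 k q by (simp add: \<mu>_def)
    have I: "(\<integral>x. pmf (poisson_law x) 0 \<partial>IG \<mu> l) = (\<integral>x. exp (- x) \<partial>IG \<mu> l)"
      "(\<integral>x. pmf (poisson_law x) (Suc 0) \<partial>IG \<mu> l) = (\<integral>x. exp (- x) * x \<partial>IG \<mu> l)"
    proof -
      have e: "(\<integral>x. f x \<partial>IG \<mu> l) = (\<integral>x. g x \<partial>IG \<mu> l)"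
        if [measurable]: "f \<in> borel_measurable borel" "g \<in> borel_measurable borel"
          and "\<And>x. x > 0 \<Longrightarrow> f x = g x" for f g :: "real \<Rightarrow> real"
        unfolding integral_IG[OF l that(1)] integral_IG[OF l that(2)]
        using that by (intro Bochner_Integration.integral_cong) (auto simp: IG_density_def)
      show "(\<integral>x. pmf (poisson_law x) 0 \<partial>IG \<mu> l) = (\<integral>x. exp (- x) \<partial>IG \<mu> l)"
        "(\<integral>x. pmf (poisson_law x) (Suc 0) \<partial>IG \<mu> l) = (\<integral>x. exp (- x) * x \<partial>IG \<mu> l)"
        using m by (auto intro!: e simp: poisson_law_0 poisson_law_1)
    qed
    show ?thesis using mixed_poisson_IG[OF \<mu> l] 3 unfolding r c d I[symmetric]
      by (simp add: xi_law_def \<mu>_def l_def)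
  qed
  then show "(\<integral>x. pmf (poisson_law x) 0 \<partial>xi_law a k) = exp (- (ivi_c k * a))"
    and "(\<integral>x. pmf (poisson_law x) (Suc 0) \<partial>xi_law a k) = exp (- (ivi_c k * a)) * (ivi_d k * a)" by auto
qed

section \<open>Probabilities of 0/1 patterns under the scheme\<close>

lemma hawkes_iVi_measurable:
  assumes "hawkes_iVi M T g0 K n \<xi> N" "i < n"
  shows "\<xi> i \<in> borel_measurable M" "N i \<in> M \<rightarrow>\<^sub>M count_space UNIV"
  using assms by (auto simp: hawkes_iVi_def has_conditional_law_def)

lemma sigma_finite_subalgebra_past:
  assumes "prob_space M" "hawkes_iVi M T g0 K n \<xi> N" "i < n"
  shows "sigma_finite_subalgebra M (past M \<xi> N i)" "sigma_finite_subalgebra M (past_xi M \<xi> N i)"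
proof -
  interpret prob_space M by fact
  have [measurable]: "\<xi> j \<in> borel_measurable M" "N j \<in> M \<rightarrow>\<^sub>M count_space UNIV" if "j \<le> i" for j
    using hawkes_iVi_measurable[OF assms(2), of j] that assms(3) by auto
  have "sets (past M \<xi> N i) \<subseteq> sets M" "sets (past_xi M \<xi> N i) \<subseteq> sets M"
    unfolding past_def past_xi_def by (intro sets_image_in_sets; measurable)+
  then have "finite_measure_subalgebra M (past M \<xi> N i)" "finite_measure_subalgebra M (past_xi M \<xi> N i)"
    by (auto simp: finite_measure_subalgebra_def finite_measure_subalgebra_axioms_def subalgebra_def
         finite_measure_axioms past_def past_xi_def)
  then show "sigma_finite_subalgebra M (past M \<xi> N i)" "sigma_finite_subalgebra M (past_xi M \<xi> N i)"
    by (auto intro: finite_measure_subalgebra_is_sigma_finite)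
qed

lemma conditional_law_on_event:
  assumes "prob_space M" "sigma_finite_subalgebra M F" "has_conditional_law M F S X \<kappa>"
    and A: "A \<in> sets F" and B: "B \<in> sets S" and m: "\<And>w. w \<in> A \<Longrightarrow> measure (\<kappa> w) B = f w"
    and f[measurable]: "f \<in> borel_measurable M"
  shows "measure M (A \<inter> X -` B) = (\<integral>w\<in>A. f w \<partial>M)"
proof -
  interpret prob_space M by fact
  interpret sigma_finite_subalgebra M F by fact
  have X[measurable]: "X \<in> M \<rightarrow>\<^sub>M S" and
    ae: "AE w in M. real_cond_exp M F (indicator (X -` B \<inter> space M)) w = measure (\<kappa> w) B"
    using assms(3) B by (auto simp: has_conditional_law_def)
  have A'[measurable]: "A \<in> sets M" using A subalg by (auto simp: subalgebra_def)
  have XB[measurable]: "X -` B \<inter> space M \<in> sets M" using B by measurable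
  have "measure M (A \<inter> X -` B) = measure M (A \<inter> (X -` B \<inter> space M))"
    using sets.sets_into_space[OF A'] by (intro arg_cong[where f = "measure M"]) auto
  also have "\<dots> = (\<integral>w\<in>A. indicator (X -` B \<inter> space M) w \<partial>M)"
    unfolding set_lebesgue_integral_def by (simp add: indicator_inter_arith[symmetric] Int_absorb1 Int_assoc)
  also have "\<dots> = (\<integral>w\<in>A. real_cond_exp M F (indicator (X -` B \<inter> space M)) w \<partial>M)"
    by (rule real_cond_exp_intA[OF _ A]) (auto intro!: integrable_real_indicator simp: emeasure_eq_measure)
  also have "\<dots> = (\<integral>w\<in>A. f w \<partial>M)"
    unfolding set_lebesgue_integral_def
    using ae by (intro integral_cong_AE) (auto simp: indicator_def m intro: borel_measurable_cond_exp2)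
  finally show ?thesis .
qed

text \<open>On the event that the past equals \<open>b\<close> the parameter \<open>alpha\<close> is a constant. The law of \<open>\<xi> i\<close>
  restricted to this event is therefore a multiple of a fixed mixing law, and integrating the Poisson
  probabilities against it gives the factor.\<close>

lemma scheme_step:
  fixes b :: "nat \<Rightarrow> nat"
  assumes M: "prob_space M" and S: "hawkes_iVi M T g0 K n \<xi> N" and i: "i < n"
    and a: "0 \<le> alpha T g0 K n (\<lambda>j _. b j) i ()" and k: "0 \<le> kincr T K n 0" "kincr T K n 0 < 1"
  shows "measure M {w\<in>space M. (\<forall>j<i. N j w = b j) \<and> N i w = m} =
     measure M {w\<in>space M. \<forall>j<i. N j w = b j} *
     (\<integral>x. pmf (poisson_law x) m \<partial>xi_law (alpha T g0 K n (\<lambda>j _. b j) i ()) (kincr T K n 0))"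
proof -
  interpret prob_space M by fact
  define A where "A = {w\<in>space M. \<forall>j<i. N j w = b j}"
  define \<nu> where "\<nu> = xi_law (alpha T g0 K n (\<lambda>j _. b j) i ()) (kincr T K n 0)"
  interpret \<nu>: prob_space \<nu> unfolding \<nu>_def by (rule prob_space_xi_law[OF a k])
  have sets_\<nu>[measurable_cong]: "sets \<nu> = sets borel" by (simp add: \<nu>_def)
  have [measurable]: "\<xi> j \<in> borel_measurable M" "N j \<in> M \<rightarrow>\<^sub>M count_space UNIV" if "j \<le> i" for j
    using hawkes_iVi_measurable[OF S, of j] that i by auto
  have \<xi>i[measurable]: "\<xi> i \<in> borel_measurable M" by simp
  note sub = sigma_finite_subalgebra_past[OF M S i]
  have law: "has_conditional_law M (past M \<xi> N i) borel (\<xi> i) (\<lambda>w. xi_law (alpha T g0 K n N i w) (kincr T K n 0))"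
    "has_conditional_law M (past_xi M \<xi> N i) (count_space UNIV) (N i) (\<lambda>w. measure_pmf (poisson_law (\<xi> i w)))"
    using S i by (auto simp: hawkes_iVi_def)
  have A1: "A \<in> sets (past M \<xi> N i)"
  proof -
    have "{g\<in>space (\<Pi>\<^sub>M j\<in>{..<i}. borel \<Otimes>\<^sub>M count_space UNIV). \<forall>j\<in>{..<i}. snd (g j) = b j}
       \<in> sets (\<Pi>\<^sub>M j\<in>{..<i}. (borel :: real measure) \<Otimes>\<^sub>M count_space UNIV)" by measurable
    moreover have "A = (\<lambda>w. \<lambda>j\<in>{..<i}. (\<xi> j w, N j w)) -`
       {g\<in>space (\<Pi>\<^sub>M j\<in>{..<i}. (borel :: real measure) \<Otimes>\<^sub>M count_space UNIV). \<forall>j\<in>{..<i}. snd (g j) = b j} \<inter> space M"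
      by (auto simp: A_def space_PiM space_pair_measure)
    ultimately show ?thesis unfolding past_def by (metis (lifting) in_vimage_algebra)
  qed
  have A2: "A \<in> sets (past_xi M \<xi> N i)"
  proof -
    let ?S = "(\<Pi>\<^sub>M j\<in>{..<i}. (borel :: real measure) \<Otimes>\<^sub>M count_space (UNIV :: nat set)) \<Otimes>\<^sub>M (borel :: real measure)"
    have "{g\<in>space ?S. \<forall>j\<in>{..<i}. snd (fst g j) = b j} \<in> sets ?S" by measurable
    moreover have "A = (\<lambda>w. (\<lambda>j\<in>{..<i}. (\<xi> j w, N j w), \<xi> i w)) -`
       {g\<in>space ?S. \<forall>j\<in>{..<i}. snd (fst g j) = b j} \<inter> space M"
      by (auto simp: A_def space_PiM space_pair_measure)
    ultimately show ?thesis unfolding past_xi_def by (metis (lifting) in_vimage_algebra)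
  qed
  have A[measurable]: "A \<in> sets M"
    using A1 sub(1) by (auto simp: sigma_finite_subalgebra_def subalgebra_def)
  have \<alpha>: "alpha T g0 K n N i w = alpha T g0 K n (\<lambda>j _. b j) i ()" if "w \<in> A" for w
    using that by (simp add: A_def alpha_def)
  have pm[measurable]: "(\<lambda>x. pmf (poisson_law x) m) \<in> borel_measurable borel"
    unfolding poisson_law_def
    by (subst measurable_cong[where g = "\<lambda>x. if 0 < x then x ^ m / fact m * exp (- x) else indicator {0} m"])
      (auto simp: indicator_def)
  have distr: "distr (density M (indicator A)) borel (\<xi> i) = density \<nu> (\<lambda>_. ennreal (measure M A))"
  proof (rule measure_eqI)
    fix B :: "real set" assume "B \<in> sets (distr (density M (indicator A)) borel (\<xi> i))"
    then have B[measurable]: "B \<in> sets borel" by simp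
    have "emeasure (distr (density M (indicator A)) borel (\<xi> i)) B = emeasure (density M (indicator A)) (\<xi> i -` B \<inter> space M)"
      by (subst emeasure_distr) auto
    also have "\<dots> = (\<integral>\<^sup>+w. indicator (A \<inter> \<xi> i -` B) w \<partial>M)"
      by (subst emeasure_density) (auto intro!: nn_integral_cong split: split_indicator)
    also have "A \<inter> \<xi> i -` B = A \<inter> (\<xi> i -` B \<inter> space M)" by (auto simp: A_def)
    also have "(\<integral>\<^sup>+w. indicator (A \<inter> (\<xi> i -` B \<inter> space M)) w \<partial>M) = ennreal (measure M (A \<inter> (\<xi> i -` B \<inter> space M)))"
      by (subst nn_integral_indicator) (auto simp: emeasure_eq_measure)
    also have "A \<inter> (\<xi> i -` B \<inter> space M) = A \<inter> \<xi> i -` B" by (auto simp: A_def)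
    also have "measure M (A \<inter> \<xi> i -` B) = (\<integral>w\<in>A. measure \<nu> B \<partial>M)"
      by (rule conditional_law_on_event[OF M sub(1) law(1) A1]) (auto simp: \<alpha> \<nu>_def)
    also have "\<dots> = measure M A * measure \<nu> B"
      by (simp add: set_lebesgue_integral_def)
    also have "ennreal \<dots> = emeasure (density \<nu> (\<lambda>_. ennreal (measure M A))) B"
      by (subst emeasure_density) (auto simp: \<nu>.emeasure_eq_measure ennreal_mult nn_integral_cmult_indicator)
    finally show "emeasure (distr (density M (indicator A)) borel (\<xi> i)) B = emeasure (density \<nu> (\<lambda>_. ennreal (measure M A))) B" .
  qed (simp add: sets_\<nu>)
  have "{w\<in>space M. (\<forall>j<i. N j w = b j) \<and> N i w = m} = A \<inter> N i -` {m}" by (auto simp: A_def)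
  also have "measure M \<dots> = (\<integral>w\<in>A. pmf (poisson_law (\<xi> i w)) m \<partial>M)"
    by (rule conditional_law_on_event[OF M sub(2) law(2) A2]) (auto simp: measure_pmf_single)
  also have "\<dots> = (\<integral>x. pmf (poisson_law x) m \<partial>distr (density M (indicator A)) borel (\<xi> i))"
  proof -
    have "density M (indicator A) = density M (\<lambda>w. ennreal (indicator A w))"
      by (simp add: ennreal_indicator)
    then show ?thesis
      by (simp add: integral_distr integral_density set_lebesgue_integral_def)
  qed
  also have "\<dots> = measure M A * (\<integral>x. pmf (poisson_law x) m \<partial>\<nu>)"
    unfolding distr by (subst integral_density) auto
  finally show ?thesis by (simp add: A_def \<nu>_def)
qed

lemma scheme_law:
  fixes b :: "nat \<Rightarrow> nat"
  assumes M: "prob_space M" and S: "hawkes_iVi M T g0 K n \<xi> N" and i: "i \<le> n"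
    and a: "\<And>j. j < i \<Longrightarrow> 0 \<le> alpha T g0 K n (\<lambda>j _. b j) j ()"
    and k: "0 \<le> kincr T K n 0" "kincr T K n 0 < 1" and b: "\<And>j. b j \<le> 1"
  shows "measure M {w\<in>space M. \<forall>j<i. N j w = b j} =
     (\<Prod>j<i. exp (- (ivi_c (kincr T K n 0) * alpha T g0 K n (\<lambda>j _. b j) j ())) *
        (if b j = 0 then 1 else ivi_d (kincr T K n 0) * alpha T g0 K n (\<lambda>j _. b j) j ()))"
  using i a
proof (induction i)
  case 0
  interpret prob_space M by fact
  show ?case by (simp add: prob_space)
next
  case (Suc i)
  have "{w\<in>space M. \<forall>j<Suc i. N j w = b j} = {w\<in>space M. (\<forall>j<i. N j w = b j) \<and> N i w = b i}"
    by (auto simp: less_Suc_eq)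
  also have "measure M \<dots> = measure M {w\<in>space M. \<forall>j<i. N j w = b j} *
     (\<integral>x. pmf (poisson_law x) (b i) \<partial>xi_law (alpha T g0 K n (\<lambda>j _. b j) i ()) (kincr T K n 0))"
    using Suc by (intro scheme_step[OF M S _ _ k]) auto
  also have "(\<integral>x. pmf (poisson_law x) (b i) \<partial>xi_law (alpha T g0 K n (\<lambda>j _. b j) i ()) (kincr T K n 0)) =
    exp (- (ivi_c (kincr T K n 0) * alpha T g0 K n (\<lambda>j _. b j) i ())) *
        (if b i = 0 then 1 else ivi_d (kincr T K n 0) * alpha T g0 K n (\<lambda>j _. b j) i ())"
  proof -
    have a0: "0 \<le> alpha T g0 K n (\<lambda>j _. b j) i ()" using Suc.prems by auto
    have "b i = 0 \<or> b i = Suc 0" using b[of i] by linarith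
    then show ?thesis using mixed_poisson_xi_law[OF a0 k] by auto
  qed
  finally show ?case using Suc by simp
qed

section \<open>Jump times driven by clocks\<close>

text \<open>The restriction to \<open>0 \<le> t\<close> makes \<open>hit_le_iff\<close> valid for all levels \<open>y\<close>, so that hitting times are
  measurable without positivity of the clocks.\<close>

definition hit :: "(real \<Rightarrow> real) \<Rightarrow> real \<Rightarrow> real" where
  "hit F y = Inf {t. 0 \<le> t \<and> y \<le> F t}"

lemma hit_le_iff:
  fixes F :: "real \<Rightarrow> real"
  assumes cont: "continuous_on UNIV F" and mono: "mono F" and lim: "filterlim F at_top at_top" and t: "0 \<le> t"
  shows "hit F y \<le> t \<longleftrightarrow> y \<le> F t"
proof -
  let ?A = "{t. 0 \<le> t \<and> y \<le> F t}"
  have "\<forall>\<^sub>F t in at_top. y \<le> F t \<and> 0 \<le> t"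
    using lim by (auto simp: filterlim_at_top eventually_ge_at_top intro!: eventually_conj)
  then obtain s where "y \<le> F s" "0 \<le> s" by (auto simp: eventually_at_top_linorder)
  then have ne: "?A \<noteq> {}" by auto
  have bb: "bdd_below ?A" by (auto intro!: bdd_belowI)
  have "?A = {0..} \<inter> F -` {y..}" by auto
  moreover have "closed (F -` {y..})" by (rule closed_vimage) (use cont in auto)
  ultimately have "closed ?A" by auto
  then have in_A: "Inf ?A \<in> ?A" using ne bb by (intro closed_contains_Inf)
  show ?thesis
  proof
    assume "hit F y \<le> t"
    then show "y \<le> F t" using in_A monoD[OF mono, of "hit F y" t] by (auto simp: hit_def)
  next
    assume "y \<le> F t" then show "hit F y \<le> t" unfolding hit_def using t bb by (intro cInf_lower) auto
  qed
qed

lemma hit_nonneg: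
  fixes F :: "real \<Rightarrow> real"
  assumes "filterlim F at_top at_top"
  shows "0 \<le> hit F y"
proof -
  have "\<forall>\<^sub>F t in at_top. y \<le> F t \<and> 0 \<le> t"
    using assms by (auto simp: filterlim_at_top eventually_ge_at_top intro!: eventually_conj)
  then obtain s where "y \<le> F s" "0 \<le> s" by (auto simp: eventually_at_top_linorder)
  then show ?thesis unfolding hit_def by (intro cInf_greatest) auto
qed

text \<open>The jump times are defined by course-of-values recursion inside a sum; with this rule the recursive
  calls are seen to be at smaller arguments.\<close>

lemma map_sum_cong[fundef_cong]:
  "xs = ys \<Longrightarrow> (\<And>x. x \<in> set ys \<Longrightarrow> f x = g x) \<Longrightarrow> (\<Sum>x\<leftarrow>xs. f x) = (\<Sum>x\<leftarrow>ys. g x)"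
  by (auto intro!: arg_cong[where f = sum_list])

text \<open>\<open>G\<close> and \<open>\<kappa>\<close> stand for the primitives of the exogenous intensity and of the kernel. They are extended
  to the whole line: constant to the left of 0, and beyond \<open>T\<close> in such a way that \<open>G\<close> is unbounded. So
  every clock rings at a finite time, and the jumps after \<open>T\<close> are artificial.\<close>

locale hawkes_clock =
  fixes T :: real and G \<kappa> :: "real \<Rightarrow> real"
  assumes T: "T > 0"
    and cont_G: "continuous_on UNIV G" and mono_G: "mono G" and G_neg: "\<And>t. t \<le> 0 \<Longrightarrow> G t = 0"
    and G_lim: "filterlim G at_top at_top"
    and cont_\<kappa>: "continuous_on UNIV \<kappa>" and mono_\<kappa>: "mono \<kappa>" and \<kappa>_neg: "\<And>t. t \<le> 0 \<Longrightarrow> \<kappa> t = 0"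
    and \<kappa>_const: "\<And>t. T \<le> t \<Longrightarrow> \<kappa> t = \<kappa> T"
begin

fun \<tau> :: "(nat \<Rightarrow> real) \<Rightarrow> nat \<Rightarrow> real" where
  "\<tau> w k = hit (\<lambda>t. G t + (\<Sum>j\<leftarrow>[0..<k]. \<kappa> (t - \<tau> w j))) (\<Sum>j\<le>k. w j)"

declare \<tau>.simps[simp del]

text \<open>The integrated intensity as it would be if there were no jump after the first \<open>k\<close> ones.\<close>

definition compensator :: "(nat \<Rightarrow> real) \<Rightarrow> nat \<Rightarrow> real \<Rightarrow> real" where
  "compensator w k t = G t + (\<Sum>j<k. \<kappa> (t - \<tau> w j))"

lemma \<tau>_eq: "\<tau> w k = hit (compensator w k) (\<Sum>j<Suc k. w j)"
  by (subst \<tau>.simps) (simp add: compensator_def[abs_def] sum_list_distinct_conv_sum_set lessThan_Suc_atMost atLeast0LessThan)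

lemma G_nonneg: "0 \<le> G t" and \<kappa>_nonneg: "0 \<le> \<kappa> t"
  using monoD[OF mono_G, of "min t 0" t] G_neg[of "min t 0"] monoD[OF mono_\<kappa>, of "min t 0" t] \<kappa>_neg[of "min t 0"] by auto

lemma \<kappa>_le: "\<kappa> t \<le> \<kappa> T"
  using monoD[OF mono_\<kappa>, of t T] \<kappa>_const[of t] by (cases "t \<le> T") auto

lemma cont_G'[continuous_intros]: "continuous_on A f \<Longrightarrow> continuous_on A (\<lambda>x. G (f x))"
  using continuous_on_compose2[OF cont_G] by auto

lemma cont_\<kappa>'[continuous_intros]: "continuous_on A f \<Longrightarrow> continuous_on A (\<lambda>x. \<kappa> (f x))"
  using continuous_on_compose2[OF cont_\<kappa>] by auto

lemma meas_G[measurable]: "G \<in> borel_measurable borel" and meas_\<kappa>[measurable]: "\<kappa> \<in> borel_measurable borel"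
  using cont_G cont_\<kappa> by (auto intro: borel_measurable_continuous_onI)

lemma compensator_cont: "continuous_on UNIV (compensator w k)"
  unfolding compensator_def by (intro continuous_intros)

lemma compensator_mono: "mono (compensator w k)"
  unfolding compensator_def by (intro monoI add_mono sum_mono monoD[OF mono_G] monoD[OF mono_\<kappa>]) auto

lemma compensator_lim: "filterlim (compensator w k) at_top at_top"
  by (rule filterlim_at_top_mono[OF G_lim]) (auto simp: compensator_def intro!: sum_nonneg \<kappa>_nonneg always_eventually)

lemma \<tau>_nonneg: "0 \<le> \<tau> w k"
  unfolding \<tau>_eq by (rule hit_nonneg[OF compensator_lim])

lemma \<tau>_le_iff: "0 \<le> t \<Longrightarrow> \<tau> w k \<le> t \<longleftrightarrow> (\<Sum>j<Suc k. w j) \<le> compensator w k t"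
  unfolding \<tau>_eq by (rule hit_le_iff[OF compensator_cont compensator_mono compensator_lim])

lemma \<tau>_le_iff': "\<tau> w k \<le> t \<longleftrightarrow> 0 \<le> t \<and> (\<Sum>j<Suc k. w j) \<le> compensator w k t"
  using \<tau>_le_iff[of t w k] \<tau>_nonneg[of w k] by auto

lemma \<tau>_cong: "(\<And>j. j \<le> k \<Longrightarrow> w j = w' j) \<Longrightarrow> \<tau> w k = \<tau> w' k"
proof (induction k rule: less_induct)
  case (less k)
  have "compensator w k = compensator w' k" unfolding compensator_def using less by (auto intro!: sum.cong ext)
  moreover have "(\<Sum>j<Suc k. w j) = (\<Sum>j<Suc k. w' j)" using less.prems by (intro sum.cong) auto
  ultimately show ?case unfolding \<tau>_eq by simp
qed

lemma compensator_cong: "(\<And>j. j < k \<Longrightarrow> w j = w' j) \<Longrightarrow> compensator w k t = compensator w' k t"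
  unfolding compensator_def
  by (intro arg_cong2[where f = "(+)"] sum.cong refl arg_cong[where f = \<kappa>] arg_cong2[where f = "(-)"] \<tau>_cong) auto

text \<open>The part of the integrated intensity up to \<open>t\<close> that is consumed by the clock of jump \<open>k\<close>, as long as
  that jump has not occurred.\<close>

definition hazard :: "(nat \<Rightarrow> real) \<Rightarrow> nat \<Rightarrow> real \<Rightarrow> real" where
  "hazard w k t = max 0 (compensator w k t - (\<Sum>j<k. w j))"

context
  fixes w :: "nat \<Rightarrow> real"
  assumes pos: "\<And>j. 0 < w j"
begin

lemma compensator_0: "t \<le> 0 \<Longrightarrow> compensator w k t = 0"
  using \<tau>_nonneg by (auto simp: compensator_def G_neg intro!: sum.neutral \<kappa>_neg) (smt (verit))

lemma sum_pos': "0 < (\<Sum>j<Suc k. w j)"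
  by (intro sum_pos) (auto simp: pos)

lemma \<tau>_pos: "0 < \<tau> w k"
proof -
  have "\<not> \<tau> w k \<le> 0" using \<tau>_le_iff[of 0 w k] compensator_0[of 0 k] sum_pos'[of k] by auto
  then show ?thesis by simp
qed

lemma compensator_\<tau>: "compensator w k (\<tau> w k) = (\<Sum>j<Suc k. w j)"
proof (rule antisym)
  show "(\<Sum>j<Suc k. w j) \<le> compensator w k (\<tau> w k)" using \<tau>_le_iff[of "\<tau> w k" w k] \<tau>_nonneg by simp
  have "\<forall>\<^sub>F t in at_left (\<tau> w k). compensator w k t \<le> (\<Sum>j<Suc k. w j)"
  proof (rule eventually_at_leftI)
    show "0 < \<tau> w k" by (rule \<tau>_pos)
    show "compensator w k t \<le> (\<Sum>j<Suc k. w j)" if "t \<in> {0<..<\<tau> w k}" for t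
      using \<tau>_le_iff[of t w k] that by auto
  qed
  moreover have "(compensator w k \<longlongrightarrow> compensator w k (\<tau> w k)) (at_left (\<tau> w k))"
    using compensator_cont[of w k] by (auto simp: continuous_on_def intro: tendsto_within_subset)
  ultimately show "compensator w k (\<tau> w k) \<le> (\<Sum>j<Suc k. w j)"
    by (intro tendsto_upperbound) auto
qed

lemma compensator_Suc: "compensator w (Suc k) t = compensator w k t + \<kappa> (t - \<tau> w k)"
  by (simp add: compensator_def)

lemma \<tau>_less_Suc: "\<tau> w k < \<tau> w (Suc k)"
proof (rule ccontr)
  assume "\<not> \<tau> w k < \<tau> w (Suc k)"
  then have "(\<Sum>j<Suc (Suc k). w j) \<le> compensator w (Suc k) (\<tau> w k)" using \<tau>_le_iff[of "\<tau> w k" w "Suc k"] \<tau>_nonneg by simp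
  also have "\<dots> = (\<Sum>j<Suc k. w j)" using compensator_\<tau> by (simp add: compensator_Suc \<kappa>_neg)
  finally show False using pos[of "Suc k"] by simp
qed

lemma \<tau>_strict_mono: "strict_mono (\<tau> w)"
  by (rule strict_monoI_Suc) (rule \<tau>_less_Suc)

lemma \<tau>_le_iff_index: "\<tau> w j \<le> \<tau> w k \<longleftrightarrow> j \<le> k"
  using \<tau>_strict_mono by (auto simp: strict_mono_less strict_mono_less_eq)

lemma compensator_extend: "k \<le> m \<Longrightarrow> t \<le> \<tau> w k \<Longrightarrow> compensator w m t = compensator w k t"
proof (induction m rule: dec_induct)
  case (step m)
  then show ?case using \<tau>_le_iff_index[of k m] by (simp add: compensator_Suc \<kappa>_neg)
qed simp

lemma \<tau>_le_hazard: "\<tau> w k \<le> t \<longleftrightarrow> w k \<le> hazard w k t"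
proof (cases "0 \<le> t")
  case True
  then show ?thesis using \<tau>_le_iff[OF True, of w k] pos[of k] by (auto simp: hazard_def)
next
  case False
  have "0 \<le> (\<Sum>j<k. w j)" by (intro sum_nonneg) (simp add: pos less_imp_le)
  then show ?thesis using False \<tau>_pos[of k] pos[of k] compensator_0[of t k] by (auto simp: hazard_def)
qed

text \<open>The clocks of the first \<open>m\<close> jumps consume the integrated intensity stopped at the last of these jumps.\<close>

lemma sum_min_hazard:
  "(\<Sum>k<m. min (hazard w k t) (w k)) = min (compensator w m t) (\<Sum>k<m. w k)"
proof (induction m)
  case 0
  then show ?case using compensator_def G_nonneg[of t] by simp
next
  case (Suc m)
  show ?case
  proof (cases "\<tau> w m \<le> t")
    case True
    have "compensator w m t \<ge> (\<Sum>j<Suc m. w j)" using compensator_\<tau>[of m] monoD[OF compensator_mono True, of w m] by simp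
    then show ?thesis using Suc True \<tau>_le_hazard[of m t] \<kappa>_nonneg[of "t - \<tau> w m"] pos[of m] by (simp add: compensator_Suc)
  next
    case False
    then have "compensator w (Suc m) t = compensator w m t" by (simp add: compensator_Suc \<kappa>_neg)
    moreover have "hazard w m t < w m" using False \<tau>_le_hazard[of m t] by simp
    ultimately show ?thesis using Suc by (simp add: hazard_def)
  qed
qed

end

definition counted :: "(nat \<Rightarrow> real) \<Rightarrow> nat \<Rightarrow> real \<Rightarrow> real" where
  "counted w m t = (\<Sum>j<m. if \<tau> w j \<le> t then 1 else 0)"

definition count :: "(nat \<Rightarrow> real) \<Rightarrow> real \<Rightarrow> real" where
  "count w t = (\<Sum>j. if \<tau> w j \<le> t then 1 else 0)"

definition Lam :: "(nat \<Rightarrow> real) \<Rightarrow> real \<Rightarrow> real" where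
  "Lam w t = G t + (\<Sum>j. \<kappa> (t - \<tau> w j))"

lemma counted_nonneg: "0 \<le> counted w m t"
  unfolding counted_def by (intro sum_nonneg) auto

lemma counted_le: "counted w m t \<le> real m"
  unfolding counted_def using sum_bounded_above[of "{..<m}" "\<lambda>j. if \<tau> w j \<le> t then 1 else 0" "1::real"] by auto

lemma count_eq:
  assumes pos: "\<And>j. 0 < w j" and "t < \<tau> w m" "m \<le> k"
  shows "count w t = counted w k t" "Lam w t = compensator w k t"
proof -
  have later: "t < \<tau> w j" if "j \<ge> k" for j
    using \<tau>_le_iff_index[of w m j] pos that assms by auto
  show "count w t = counted w k t" unfolding count_def counted_def
    using later by (intro suminf_finite) (auto simp: not_less not_le)
  show "Lam w t = compensator w k t" unfolding Lam_def compensator_def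
    using later by (subst suminf_finite[of "{..<k}"]) (auto intro!: \<kappa>_neg less_imp_le[of t] simp: not_less)
qed

end

section \<open>Exponential clocks and non-explosion\<close>

definition exp1 :: "real measure" where
  "exp1 = density lborel (\<lambda>x. ennreal (exponential_density 1 x))"

definition clocks :: "(nat \<Rightarrow> real) measure" where
  "clocks = PiM UNIV (\<lambda>_. exp1)"

lemma prob_space_exp1: "prob_space exp1"
  unfolding exp1_def by (rule prob_space_exponential_density) simp

lemma sets_exp1[measurable_cong, simp]: "sets exp1 = sets borel" and space_exp1[simp]: "space exp1 = UNIV"
  by (simp_all add: exp1_def)

lemma prob_space_clocks: "prob_space clocks"
  unfolding clocks_def by (rule prob_space_PiM) (rule prob_space_exp1)

lemma sets_clocks[measurable_cong]: "sets clocks = sets (PiM UNIV (\<lambda>_. borel))"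
  unfolding clocks_def by (rule sets_PiM_cong) auto

lemma space_clocks[simp]: "space clocks = UNIV"
  by (simp add: clocks_def space_PiM)

interpretation exp1: prob_space exp1 by (rule prob_space_exp1)
interpretation clocks: prob_space clocks by (rule prob_space_clocks)
interpretation seqclocks: sequence_space exp1 ..

lemma exp1_distributed: "distributed exp1 lborel (\<lambda>x. x) (exponential_density 1)"
  unfolding distributed_def exp1_def
  by (auto simp: distr_id2 exponential_density_nonneg intro!: distr_id2)

lemma AE_exp1_pos: "AE e in exp1. 0 < e"
proof -
  have "AE e in lborel. e \<noteq> (0::real)" by (rule AE_lborel_singleton)
  then show ?thesis unfolding exp1_def
    by (subst AE_density) (auto simp: exponential_density_def elim: eventually_mono split: if_splits)
qed

lemma AE_exp1_neq: "AE e in exp1. e \<noteq> c"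
proof -
  have "AE e in lborel. e \<noteq> c" by (rule AE_lborel_singleton)
  then show ?thesis unfolding exp1_def by (subst AE_density) (auto elim: eventually_mono)
qed

lemma prob_exp1_gt: "0 \<le> a \<Longrightarrow> measure exp1 {a<..} = exp (- a)"
  using exp1.exponential_distributedD_gt[OF exp1_distributed, of a] by (simp add: greaterThan_def)

text \<open>Replacing one clock by an independent copy does not change the law. Independence of a clock and the
  others is used in this form only: expectations are first taken over the replaced clock.\<close>

lemma clocks_resample: "distr (exp1 \<Otimes>\<^sub>M clocks) clocks (\<lambda>(e, w). w (k := e)) = clocks"
  unfolding clocks_def using distr_pair_PiM_eq_PiM[of UNIV "\<lambda>_. exp1" k] prob_space_exp1 by simp

lemma measurable_clocks_upd[measurable]:
  "(\<lambda>(e, w). w (k := e)) \<in> exp1 \<Otimes>\<^sub>M clocks \<rightarrow>\<^sub>M clocks"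
proof -
  have "(\<lambda>x. ((snd x)(k := fst x)) i) \<in> exp1 \<Otimes>\<^sub>M PiM UNIV (\<lambda>_. exp1) \<rightarrow>\<^sub>M exp1" for i
    by (cases "i = k") auto
  then show ?thesis unfolding clocks_def case_prod_beta'
    by (intro measurable_PiM_single') (auto simp: space_PiM)
qed

lemma measurable_clocks_component: "(\<lambda>w. w k) \<in> borel_measurable clocks"
  by measurable

lemma meas_clock_sum[measurable]: "(\<lambda>w. \<Sum>j<n. w j) \<in> borel_measurable clocks"
  by (intro borel_measurable_sum measurable_clocks_component)

interpretation pc: pair_prob_space exp1 clocks ..

lemma integral_clocks_resample:
  fixes f :: "(nat \<Rightarrow> real) \<Rightarrow> real"
  assumes "integrable clocks f"
  shows "(\<integral>w. f w \<partial>clocks) = (\<integral>w. (\<integral>e. f (w (k := e)) \<partial>exp1) \<partial>clocks)"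
proof -
  have [measurable]: "f \<in> borel_measurable clocks" using assms by simp
  have "integrable (distr (exp1 \<Otimes>\<^sub>M clocks) clocks (\<lambda>(e, w). w (k := e))) f"
    using assms by (simp add: clocks_resample)
  then have I: "integrable (exp1 \<Otimes>\<^sub>M clocks) (\<lambda>(e, w). f (w (k := e)))"
    by (subst (asm) integrable_distr_eq) (auto simp: case_prod_beta')
  have "(\<integral>w. f w \<partial>clocks) = (\<integral>w. f w \<partial>distr (exp1 \<Otimes>\<^sub>M clocks) clocks (\<lambda>(e, w). w (k := e)))"
    by (simp add: clocks_resample)
  also have "\<dots> = (\<integral>x. (case x of (e, w) \<Rightarrow> f (w (k := e))) \<partial>(exp1 \<Otimes>\<^sub>M clocks))"
    by (subst integral_distr) (auto simp: case_prod_beta')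
  also have "\<dots> = (\<integral>w. (\<integral>e. f (w (k := e)) \<partial>exp1) \<partial>clocks)"
    by (rule pc.integral_snd[symmetric]) (rule I)
  finally show ?thesis .
qed

lemma AE_clocks_resample:
  assumes [measurable]: "Measurable.pred clocks P" and "\<And>w. AE e in exp1. P (w (k := e))"
  shows "AE w in clocks. P w"
proof -
  have m: "Measurable.pred (exp1 \<Otimes>\<^sub>M clocks) (\<lambda>x. P ((snd x)(k := fst x)))"
    using measurable_compose[OF measurable_clocks_upd assms(1), of k] by (simp add: case_prod_beta')
  have "AE w in clocks. AE e in exp1. P (w (k := e))" using assms by simp
  then have "AE e in exp1. AE w in clocks. P (w (k := e))"
    by (subst pc.AE_commute[OF m[unfolded pred_def]])
  then have "AE x in exp1 \<Otimes>\<^sub>M clocks. P ((snd x)(k := fst x))"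
    by (intro pc.AE_pair_measure[OF m[unfolded pred_def]]) auto
  then have "AE w in distr (exp1 \<Otimes>\<^sub>M clocks) clocks (\<lambda>(e, w). w (k := e)). P w"
    using assms(1) by (subst AE_distr_iff) (auto simp: case_prod_beta' pred_def)
  then show ?thesis unfolding clocks_resample .
qed

text \<open>The compensated indicator that a clock \<open>e\<close> has rung by the time when the accumulated hazard is \<open>a\<close>.\<close>

definition hazard_gap :: "real \<Rightarrow> real \<Rightarrow> real" where
  "hazard_gap a e = (if e \<le> a then 1 else 0) - min a e"

lemma meas_hazard_gap[measurable]: "(\<lambda>x. hazard_gap (f x) (g x)) \<in> borel_measurable M" 
  if [measurable]: "f \<in> borel_measurable M" "g \<in> borel_measurable M"
  unfolding hazard_gap_def by measurable

lemma meas_hazard_gap': "hazard_gap a \<in> borel_measurable exp1"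
  unfolding hazard_gap_def[abs_def] by measurable

lemma hazard_gap_bound: "0 < e \<Longrightarrow> 0 \<le> a \<Longrightarrow> \<bar>hazard_gap a e\<bar> \<le> 1 + a"
  by (auto simp: hazard_gap_def)

lemma integrable_hazard_gap: "0 \<le> a \<Longrightarrow> integrable exp1 (hazard_gap a)"
proof (rule exp1.integrable_const_bound[where B = "1 + a"])
  assume "0 \<le> a"
  then show "AE e in exp1. norm (hazard_gap a e) \<le> 1 + a"
    using AE_exp1_pos hazard_gap_bound[of _ a] by (auto elim!: eventually_mono)
qed (rule meas_hazard_gap')

text \<open>A primitive of \<open>(1 - e) * exp (- e)\<close> is \<open>e * exp (- e)\<close>. So the contribution of \<open>e \<le> a\<close> is
  \<open>a * exp (- a)\<close>, and that of \<open>e > a\<close> is the opposite.\<close>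

lemma integral_hazard_gap: 
  assumes a: "0 \<le> a"
  shows "(\<integral>e. hazard_gap a e \<partial>exp1) = 0"
proof -
  have "((\<lambda>e. e * exp (- e)) has_real_derivative ((1 - e) * exp (- e))) (at e)" for e :: real
    by (auto intro!: derivative_eq_intros simp: algebra_simps)
  then have "has_bochner_integral lborel (\<lambda>e. indicator {0..a} e *\<^sub>R ((1 - e) * exp (- e))) (a * exp (- a) - 0 * exp (- 0))"
    using a by (intro has_bochner_integral_FTC_Icc)
      (auto intro!: continuous_intros simp: has_real_derivative_iff_has_vector_derivative[symmetric] intro: has_field_derivative_at_within)
  then have "has_bochner_integral lborel (\<lambda>e. exponential_density 1 e * (indicator {0..a} e * (1 - e))) (a * exp (- a))"
    by (rule has_bochner_integral_cong[THEN iffD1, rotated -1]) (auto simp: exponential_density_def split: split_indicator)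
  then have 1: "has_bochner_integral exp1 (\<lambda>e. indicator {0..a} e * (1 - e)) (a * exp (- a))"
    unfolding exp1_def by (intro has_bochner_integral_density) (auto simp: exponential_density_nonneg)
  have 2: "has_bochner_integral exp1 (\<lambda>e. indicator {a<..} e * a) (exp (- a) * a)"
    using prob_exp1_gt[OF a] by (auto simp: has_bochner_integral_iff exp1.emeasure_eq_measure)
  have "(\<integral>e. hazard_gap a e \<partial>exp1) = (\<integral>e. indicator {0..a} e * (1 - e) - indicator {a<..} e * a \<partial>exp1)"
  proof (rule integral_cong_AE)
    show "AE e in exp1. hazard_gap a e = indicator {0..a} e * (1 - e) - indicator {a<..} e * a"
      using AE_exp1_pos by eventually_elim (auto simp: hazard_gap_def split: split_indicator)
  qed (rule meas_hazard_gap', measurable)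
  also have "\<dots> = a * exp (- a) - exp (- a) * a"
    using has_bochner_integral_integral_eq[OF has_bochner_integral_diff[OF 1 2]] by simp
  finally show ?thesis by simp
qed

lemma AE_clocks_pos: "AE w in clocks. \<forall>j. 0 < w j"
  unfolding AE_all_countable clocks_def
  by (intro allI AE_PiM_component) (auto intro: prob_space_exp1 AE_exp1_pos)

context hawkes_clock
begin

lemma meas_\<tau>[measurable]: "(\<lambda>w. \<tau> w k) \<in> borel_measurable clocks"
proof (induction k rule: less_induct)
  case (less k)
  have [measurable]: "(\<lambda>w. compensator w k t) \<in> borel_measurable clocks" for t
  proof -
    have [measurable]: "(\<lambda>w. \<kappa> (t - \<tau> w j)) \<in> borel_measurable clocks" if "j < k" for j
      by (rule measurable_compose[OF _ meas_\<kappa>]) (use less[OF that] in measurable)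
    show ?thesis unfolding compensator_def by (intro borel_measurable_add borel_measurable_const borel_measurable_sum) auto
  qed
  show ?case
  proof (rule borel_measurableI_le)
    fix t
    show "{w\<in>space clocks. \<tau> w k \<le> t} \<in> sets clocks"
    proof (cases "0 \<le> t")
      case True
      then show ?thesis unfolding \<tau>_le_iff'[of _ k t]
        using borel_measurable_le[OF meas_clock_sum[of "Suc k"] \<open>\<And>t. (\<lambda>w. compensator w k t) \<in> borel_measurable clocks\<close>[of t]] by simp
    next
      case False
      then have "{w\<in>space clocks. \<tau> w k \<le> t} = {}" unfolding \<tau>_le_iff'[of _ k t] by simp
      then show ?thesis by simp
    qed
  qed
qed

lemma meas_compensator[measurable]: "(\<lambda>w. compensator w k t) \<in> borel_measurable clocks"
  unfolding compensator_def by measurable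

lemma meas_hazard[measurable]: "(\<lambda>w. hazard w k t) \<in> borel_measurable clocks"
  unfolding hazard_def by measurable

lemma meas_counted[measurable]: "(\<lambda>w. counted w k t) \<in> borel_measurable clocks"
  unfolding counted_def by measurable

lemma meas_count[measurable]: "(\<lambda>w. count w t) \<in> borel_measurable clocks"
  unfolding count_def by measurable

lemma meas_Lam[measurable]: "(\<lambda>w. Lam w t) \<in> borel_measurable clocks"
  unfolding Lam_def by measurable

lemma hazard_nonneg: "0 \<le> hazard w k t"
  by (simp add: hazard_def)

lemma compensator_le: "compensator w k t \<le> G t + real k * \<kappa> T"
  unfolding compensator_def using sum_bounded_above[of "{..<k}" "\<lambda>j. \<kappa> (t - \<tau> w j)" "\<kappa> T"] \<kappa>_le by auto

lemma hazard_le: "(\<And>j. 0 < w j) \<Longrightarrow> hazard w k t \<le> G t + real k * \<kappa> T"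
  unfolding hazard_def using compensator_le[of w k t] sum_nonneg[of "{..<k}" w] G_nonneg[of t] \<kappa>_nonneg[of T]
  by (auto simp: less_imp_le intro: order_trans)

lemma hazard_cong: "(\<And>j. j < k \<Longrightarrow> w j = w' j) \<Longrightarrow> hazard w k t = hazard w' k t"
  unfolding hazard_def using compensator_cong[of k w w'] by (simp cong: sum.cong_simp)

lemma hazard_mono: "s \<le> t \<Longrightarrow> hazard w k s \<le> hazard w k t"
  unfolding hazard_def using monoD[OF compensator_mono, of s t w k] by auto

lemma meas_hazard_gap_hazard[measurable]: "(\<lambda>w. hazard_gap (hazard w k t) (w k)) \<in> borel_measurable clocks"
  by (rule meas_hazard_gap[OF meas_hazard measurable_clocks_component])

lemma integrable_hazard_gap_hazard: "integrable clocks (\<lambda>w. hazard_gap (hazard w k t) (w k))"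
proof (rule clocks.integrable_const_bound[where B = "1 + (G t + real k * \<kappa> T)"])
  show "AE w in clocks. norm (hazard_gap (hazard w k t) (w k)) \<le> 1 + (G t + real k * \<kappa> T)"
    using AE_clocks_pos
  proof eventually_elim
    case (elim w)
    then show ?case using hazard_gap_bound[of "w k" "hazard w k t"] hazard_nonneg hazard_le[of w k t] by force
  qed
qed measurable

text \<open>Neither \<open>\<psi>\<close> nor the hazard depends on clock \<open>k\<close>, so integrating over this clock alone already gives 0.\<close>

lemma integral_hazard_gap_increment:
  assumes [measurable]: "Measurable.pred clocks \<psi>"
    and \<psi>: "\<And>w w'. (\<And>j. j < k \<Longrightarrow> w j = w' j) \<Longrightarrow> \<psi> w = \<psi> w'"
  shows "(\<integral>w. indicator {w. \<psi> w} w * (hazard_gap (hazard w k t) (w k) - hazard_gap (hazard w k s) (w k)) \<partial>clocks) = 0"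
proof -
  have "{w. \<psi> w} \<in> sets clocks" using assms(1) by (simp add: pred_def)
  then have "integrable clocks (\<lambda>w. indicator {w. \<psi> w} w *\<^sub>R (hazard_gap (hazard w k t) (w k) - hazard_gap (hazard w k s) (w k)))"
    using integrable_hazard_gap_hazard by (intro integrable_mult_indicator Bochner_Integration.integrable_diff) auto
  then have "(\<integral>w. indicator {w. \<psi> w} w * (hazard_gap (hazard w k t) (w k) - hazard_gap (hazard w k s) (w k)) \<partial>clocks)
    = (\<integral>w. (\<integral>e. indicator {w. \<psi> w} (w (k := e)) * (hazard_gap (hazard (w (k := e)) k t) ((w (k := e)) k)
         - hazard_gap (hazard (w (k := e)) k s) ((w (k := e)) k)) \<partial>exp1) \<partial>clocks)"
    by (intro integral_clocks_resample) simp
  also have "\<dots> = (\<integral>w. (\<integral>e. indicator {w. \<psi> w} w * (hazard_gap (hazard w k t) e - hazard_gap (hazard w k s) e) \<partial>exp1) \<partial>clocks)"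
  proof -
    have "indicator {w. \<psi> w} (w (k := e)) = (indicator {w. \<psi> w} w :: real)" for w e
      using \<psi>[of "w (k := e)" w] by (auto simp: indicator_def)
    moreover have "hazard (w (k := e)) k t = hazard w k t" for w e t
      by (rule hazard_cong) auto
    ultimately show ?thesis by simp
  qed
  also have "\<dots> = (\<integral>w. 0 \<partial>clocks)"
    using hazard_nonneg by (intro Bochner_Integration.integral_cong refl) (simp add: integrable_hazard_gap integral_hazard_gap)
  finally show ?thesis by simp
qed

text \<open>If jump \<open>k\<close> happens by time \<open>s\<close>, its compensated indicator no longer changes after \<open>s\<close>. Otherwise an event
  \<open>A\<close> of the past of \<open>s\<close> coincides with an event \<open>\<psi>\<close> in terms of the first \<open>k\<close> clocks.\<close>

lemma integral_hazard_gap_increment_past: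
  assumes A[measurable]: "Measurable.pred clocks A" and [measurable]: "Measurable.pred clocks \<psi>"
    and \<psi>: "\<And>w w'. (\<And>j. j < k \<Longrightarrow> w j = w' j) \<Longrightarrow> \<psi> w = \<psi> w'"
    and past: "\<And>w. (\<And>j. 0 < w j) \<Longrightarrow> s < \<tau> w k \<Longrightarrow> A w = \<psi> w" and st: "s \<le> t"
  shows "(\<integral>w. indicator {w. A w} w * (hazard_gap (hazard w k t) (w k) - hazard_gap (hazard w k s) (w k)) \<partial>clocks) = 0"
proof -
  have [measurable]: "{w. \<psi> w} \<in> sets clocks" "{w. A w} \<in> sets clocks" using assms(1,2) by (simp_all add: pred_def)
  have "(\<integral>w. indicator {w. A w} w * (hazard_gap (hazard w k t) (w k) - hazard_gap (hazard w k s) (w k)) \<partial>clocks)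
    = (\<integral>w. indicator {w. \<psi> w} w * (hazard_gap (hazard w k t) (w k) - hazard_gap (hazard w k s) (w k)) \<partial>clocks)"
  proof (rule integral_cong_AE)
    show "AE w in clocks. indicator {w. A w} w * (hazard_gap (hazard w k t) (w k) - hazard_gap (hazard w k s) (w k)) =
      indicator {w. \<psi> w} w * (hazard_gap (hazard w k t) (w k) - hazard_gap (hazard w k s) (w k))"
      using AE_clocks_pos
    proof eventually_elim
      case (elim w)
      show ?case
      proof (cases "s < \<tau> w k")
        case True
        then show ?thesis using past[of w] elim by (simp add: indicator_def)
      next
        case False
        then have "w k \<le> hazard w k s" using \<tau>_le_hazard[of w k s] elim by simp
        then show ?thesis using hazard_mono[OF st, of w k] by (simp add: hazard_gap_def)
      qed
    qed
  qed measurable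
  also have "\<dots> = 0" by (rule integral_hazard_gap_increment[OF assms(2) \<psi>])
  finally show ?thesis .
qed

text \<open>The compensated counting process stopped at the \<open>m\<close>-th jump.\<close>

definition stopped :: "nat \<Rightarrow> real \<Rightarrow> (nat \<Rightarrow> real) \<Rightarrow> real" where
  "stopped m t w = (\<Sum>k<m. hazard_gap (hazard w k t) (w k))"

lemma meas_stopped[measurable]: "stopped m t \<in> borel_measurable clocks"
  unfolding stopped_def by measurable

lemma stopped_eq:
  assumes "\<And>j. 0 < w j"
  shows "stopped m t w = counted w m t - min (compensator w m t) (\<Sum>k<m. w k)"
  unfolding stopped_def hazard_gap_def counted_def sum_min_hazard[OF assms, symmetric]
  by (simp add: sum_subtractf \<tau>_le_hazard[OF assms])

lemma integrable_counted: "integrable clocks (\<lambda>w. counted w m t)"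
proof (rule clocks.integrable_const_bound[where B = "real m"])
  show "AE w in clocks. norm (counted w m t) \<le> real m"
    by (intro AE_I2) (simp add: counted_nonneg counted_le)
qed measurable

lemma integrable_compensator: "integrable clocks (\<lambda>w. compensator w m t)"
proof (rule clocks.integrable_const_bound[where B = "G t + real m * \<kappa> T"])
  show "AE w in clocks. norm (compensator w m t) \<le> G t + real m * \<kappa> T"
  proof (rule AE_I2)
    fix w have "0 \<le> compensator w m t" unfolding compensator_def by (intro add_nonneg_nonneg sum_nonneg G_nonneg \<kappa>_nonneg)
    then show "norm (compensator w m t) \<le> G t + real m * \<kappa> T" using compensator_le[of w m t] by simp
  qed
qed measurable

lemma expected_counted_le: "(\<integral>w. counted w m t \<partial>clocks) \<le> (\<integral>w. compensator w m t \<partial>clocks)"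
proof -
  have I: "integrable clocks (stopped m t)"
    unfolding stopped_def by (intro Bochner_Integration.integrable_sum integrable_hazard_gap_hazard)
  have "(\<integral>w. hazard_gap (hazard w k t) (w k) \<partial>clocks) = 0" for k
    unfolding integral_clocks_resample[OF integrable_hazard_gap_hazard, of k t k]
  proof -
    have "hazard (w (k := e)) k t = hazard w k t" for w e by (rule hazard_cong) auto
    then show "(\<integral>w. (\<integral>e. hazard_gap (hazard (w (k := e)) k t) ((w (k := e)) k) \<partial>exp1) \<partial>clocks) = 0"
      by (simp add: integral_hazard_gap hazard_nonneg)
  qed
  then have "(\<integral>w. stopped m t w \<partial>clocks) = 0"
    unfolding stopped_def by (simp add: Bochner_Integration.integral_sum integrable_hazard_gap_hazard)
  moreover have "(\<integral>w. counted w m t - compensator w m t \<partial>clocks) \<le> (\<integral>w. stopped m t w \<partial>clocks)"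
    using AE_clocks_pos by (intro integral_mono_AE Bochner_Integration.integrable_diff integrable_counted integrable_compensator I)
      (auto elim!: eventually_mono simp: stopped_eq)
  ultimately show ?thesis by (simp add: integrable_counted integrable_compensator)
qed

text \<open>Choose \<open>\<delta>\<close> with \<open>\<kappa> \<delta> \<le> 1/2\<close>. A jump at age at most \<open>\<delta>\<close> contributes at most 1/2 to the integrated
  intensity, an older one at most \<open>\<kappa> T\<close>. As the expected number of jumps is at most the expected
  integrated intensity, \<open>u t \<le> G t + u t / 2 + \<kappa> T * u (t - \<delta>)\<close> for the expected number \<open>u t\<close> of counted
  jumps, with a bound independent of the truncation \<open>m\<close> after finitely many steps of length \<open>\<delta>\<close>.\<close>

lemma expected_counted_bounded: "\<exists>C. \<forall>m. (\<integral>w. counted w m t \<partial>clocks) \<le> C"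
proof -
  have "isCont \<kappa> 0" using cont_\<kappa> by (simp add: continuous_on_eq_continuous_at)
  then have "\<forall>\<^sub>F x in nhds 0. \<kappa> x < 1/2"
    using order_tendstoD(2)[of \<kappa> "\<kappa> 0" "nhds 0" "1/2"] \<kappa>_neg[of 0] by (simp add: isCont_def tendsto_nhds_iff)
  then obtain d where d: "d > 0" "\<And>x. dist x 0 < d \<Longrightarrow> \<kappa> x < 1/2" by (auto simp: eventually_nhds_metric)
  define \<delta> where "\<delta> = d / 2"
  have \<delta>: "\<delta> > 0" "\<kappa> \<delta> \<le> 1/2" using d by (auto simp: \<delta>_def intro!: less_imp_le)
  have compensator_bound: "compensator w m t \<le> G t + counted w m t / 2 + \<kappa> T * counted w m (t - \<delta>)" for w m t
  proof -
    have "\<kappa> (t - \<tau> w j) \<le> (if \<tau> w j \<le> t then 1 else 0) / 2 + \<kappa> T * (if \<tau> w j \<le> t - \<delta> then 1 else 0)" for j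
      using monoD[OF mono_\<kappa>, of "t - \<tau> w j" \<delta>] \<delta> \<kappa>_le[of "t - \<tau> w j"] \<kappa>_neg[of "t - \<tau> w j"] by auto
    then have "(\<Sum>j<m. \<kappa> (t - \<tau> w j)) \<le> (\<Sum>j<m. (if \<tau> w j \<le> t then 1 else 0) / 2 + \<kappa> T * (if \<tau> w j \<le> t - \<delta> then 1 else 0))"
      by (rule sum_mono)
    then show ?thesis unfolding compensator_def counted_def by (simp add: sum.distrib sum_divide_distrib sum_distrib_left)
  qed
  let ?u = "\<lambda>m t. (\<integral>w. counted w m t \<partial>clocks)"
  have step: "?u m t \<le> 2 * G t + 2 * \<kappa> T * ?u m (t - \<delta>)" for m t
  proof -
    have "?u m t \<le> (\<integral>w. G t + counted w m t / 2 + \<kappa> T * counted w m (t - \<delta>) \<partial>clocks)"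
      by (rule order_trans[OF expected_counted_le integral_mono])
        (use compensator_bound integrable_compensator integrable_counted in auto)
    also have "\<dots> = G t + ?u m t / 2 + \<kappa> T * ?u m (t - \<delta>)"
      using integrable_counted clocks.prob_space by simp
    finally show ?thesis by simp
  qed
  have "\<exists>C. \<forall>m t. t \<le> real i * \<delta> \<longrightarrow> ?u m t \<le> C" for i
  proof (induction i)
    case 0
    have "?u m t = 0" if "t \<le> 0" for m t
    proof -
      have "AE w in clocks. counted w m t = 0"
        using AE_clocks_pos
      proof eventually_elim
        case (elim w)
        have "\<not> \<tau> w j \<le> t" for j using \<tau>_pos[of w j] elim that by auto
        then show ?case by (simp add: counted_def)
      qed
      then show ?thesis by (simp add: integral_cong_AE[where g = "\<lambda>_. 0"])
    qed
    then show ?case by (intro exI[of _ 0]) auto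
  next
    case (Suc i)
    then obtain C where C: "\<And>m t. t \<le> real i * \<delta> \<Longrightarrow> ?u m t \<le> C" by blast
    have "?u m t \<le> 2 * G (real (Suc i) * \<delta>) + 2 * \<kappa> T * C" if "t \<le> real (Suc i) * \<delta>" for m t
      using step[of m t] monoD[OF mono_G that] mult_left_mono[OF C[of "t - \<delta>" m] \<kappa>_nonneg[of T]] that
      by (auto simp: algebra_simps)
    then show ?case by blast
  qed
  moreover obtain i :: nat where "t / \<delta> \<le> real i" using real_arch_simple by blast
  ultimately show ?thesis using \<delta> by (metis pos_divide_le_eq)
qed

lemma AE_finitely_many_jumps: "AE w in clocks. \<exists>m. t < \<tau> w m"
  and integrable_count: "integrable clocks (\<lambda>w. count w t)"
proof -
  obtain C where C: "\<And>m. (\<integral>w. counted w m t \<partial>clocks) \<le> C" using expected_counted_bounded by blast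
  let ?i = "\<lambda>j w. ennreal (if \<tau> w j \<le> t then 1 else 0)"
  have "(\<integral>\<^sup>+w. (\<Sum>j. ?i j w) \<partial>clocks) = (\<Sum>j. \<integral>\<^sup>+w. ?i j w \<partial>clocks)"
    by (rule nn_integral_suminf) measurable
  also have "\<dots> \<le> ennreal C"
  proof (rule suminf_le_const)
    fix m
    have "(\<Sum>j<m. \<integral>\<^sup>+w. ?i j w \<partial>clocks) = (\<integral>\<^sup>+w. (\<Sum>j<m. ?i j w) \<partial>clocks)"
      by (rule nn_integral_sum[symmetric]) measurable
    also have "\<dots> = (\<integral>\<^sup>+w. ennreal (counted w m t) \<partial>clocks)"
      unfolding counted_def by (subst sum_ennreal) auto
    also have "\<dots> = ennreal (\<integral>w. counted w m t \<partial>clocks)"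
      by (rule nn_integral_eq_integral[OF integrable_counted]) (auto simp: counted_def intro!: sum_nonneg)
    also have "\<dots> \<le> ennreal C" using C by (rule ennreal_leI)
    finally show "(\<Sum>j<m. \<integral>\<^sup>+w. ?i j w \<partial>clocks) \<le> ennreal C" .
  qed auto
  finally have fin: "(\<integral>\<^sup>+w. (\<Sum>j. ?i j w) \<partial>clocks) \<le> ennreal C" .
  then have "(\<integral>\<^sup>+w. (\<Sum>j. ?i j w) \<partial>clocks) \<noteq> \<infinity>" by (auto simp: top_unique)
  then have "AE w in clocks. (\<Sum>j. ?i j w) \<noteq> \<infinity>"
    by (intro nn_integral_noteq_infinite) measurable
  then have summ: "AE w in clocks. summable (\<lambda>j. if \<tau> w j \<le> t then 1 else 0 :: real)"
  proof eventually_elim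
    case (elim w)
    then show ?case by (intro summable_suminf_not_top) auto
  qed
  then show "AE w in clocks. \<exists>m. t < \<tau> w m"
  proof eventually_elim
    case (elim w)
    have "\<forall>\<^sub>F j in sequentially. (if \<tau> w j \<le> t then 1 else 0 :: real) < 1/2"
      by (rule order_tendstoD(2)[OF summable_LIMSEQ_zero[OF elim]]) simp
    then obtain m where "(if \<tau> w m \<le> t then 1 else 0 :: real) < 1/2"
      by (auto simp: eventually_sequentially)
    then show ?case by (intro exI[of _ m]) (auto split: if_splits)
  qed
  show "integrable clocks (\<lambda>w. count w t)"
  proof (rule integrableI_bounded)
    have "(\<integral>\<^sup>+w. ennreal (norm (count w t)) \<partial>clocks) = (\<integral>\<^sup>+w. (\<Sum>j. ?i j w) \<partial>clocks)"
    proof (rule nn_integral_cong_AE)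
      show "AE w in clocks. ennreal (norm (count w t)) = (\<Sum>j. ?i j w)"
        using summ by eventually_elim (auto simp: count_def suminf_nonneg intro!: suminf_ennreal2[symmetric])
    qed
    then show "(\<integral>\<^sup>+w. ennreal (norm (count w t)) \<partial>clocks) < \<infinity>"
      using fin by (simp add: order_le_less_trans[OF _ ennreal_less_top])
  qed measurable
qed

end

section \<open>The martingale property\<close>

lemma pred_in_sets:
  assumes "f \<in> M \<rightarrow>\<^sub>M N" "B \<in> sets N" shows "Measurable.pred M (\<lambda>x. f x \<in> B)"
proof -
  have "{x\<in>space M. f x \<in> B} = f -` B \<inter> space M" by auto
  then show ?thesis using measurable_sets[OF assms] by (simp add: pred_def)
qed

context hawkes_clock
begin

text \<open>The clock sequences on which everything converges. The last condition says that at rational times and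
  at time \<open>T\<close> the integrated intensity is not at a level where a clock rings: so it exceeds that level
  immediately after the jump, and no jump happens at \<open>T\<close>.\<close>

definition good :: "(nat \<Rightarrow> real) \<Rightarrow> bool" where
  "good w \<longleftrightarrow> (\<forall>j. 0 < w j) \<and> (\<exists>m. T < \<tau> w m) \<and>
     (\<forall>k. \<forall>q\<in>insert T \<rat>. compensator w k q \<noteq> (\<Sum>j<Suc k. w j))"

lemma pred_good[measurable]: "Measurable.pred clocks good"
proof -
  have c: "countable (insert T \<rat>)" by (simp add: countable_rat)
  have "{w\<in>space clocks. good w} = 
    (\<Inter>j. {w\<in>space clocks. 0 < w j}) \<inter> (\<Union>m. {w\<in>space clocks. T < \<tau> w m}) \<inter>
    (\<Inter>k. \<Inter>q\<in>insert T \<rat>. {w\<in>space clocks. compensator w k q \<noteq> (\<Sum>j<Suc k. w j)})"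
    by (auto simp: good_def)
  also have "\<dots> \<in> sets clocks"
    by (intro sets.Int sets.countable_INT' sets.countable_UN c countableI_type image_subsetI
        borel_measurable_less borel_measurable_neq borel_measurable_const measurable_clocks_component
        meas_\<tau> meas_compensator meas_clock_sum) auto
  finally show ?thesis by (simp add: pred_def)
qed

text \<open>Given the other clocks, the last condition excludes one value of clock \<open>k\<close> for each of the countably many times.\<close>

lemma AE_good: "AE w in clocks. good w"
proof -
  have "AE w in clocks. compensator w k q \<noteq> (\<Sum>j<Suc k. w j)" for k q
  proof (rule AE_clocks_resample[where k = k])
    show "Measurable.pred clocks (\<lambda>w. compensator w k q \<noteq> (\<Sum>j<Suc k. w j))"
      unfolding pred_def by (intro borel_measurable_neq meas_compensator meas_clock_sum)
    show "AE e in exp1. compensator (w (k := e)) k q \<noteq> (\<Sum>j<Suc k. (w (k := e)) j)" for w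
    proof -
      have "compensator (w (k := e)) k q = compensator w k q" "(\<Sum>j<Suc k. (w (k := e)) j) = (\<Sum>j<k. w j) + e" for e
        by (auto intro!: compensator_cong sum.cong)
      then show ?thesis using AE_exp1_neq[of "compensator w k q - (\<Sum>j<k. w j)"]
        by (simp only:) (auto elim!: eventually_mono)
    qed
  qed
  then have "AE w in clocks. \<forall>k. \<forall>q\<in>insert T \<rat>. compensator w k q \<noteq> (\<Sum>j<Suc k. w j)"
    unfolding AE_all_countable by (intro allI AE_ball_countable') (auto simp: countable_rat)
  then show ?thesis using AE_clocks_pos AE_finitely_many_jumps[of T]
    by eventually_elim (simp add: good_def)
qed

lemma ex_good: "\<exists>w. good w"
proof (rule ccontr)
  assume "\<nexists>w. good w"
  then have "AE w in clocks. False" using AE_good by simp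
  then show False by (simp add: clocks.AE_False)
qed

text \<open>All paths of a Hawkes process have to be counting paths, without an exceptional null set. Bad clock
  sequences are therefore replaced by a fixed good one.\<close>

definition regularised :: "(nat \<Rightarrow> real) \<Rightarrow> nat \<Rightarrow> real" where
  "regularised w = (if good w then w else (SOME w. good w))"

lemma good_regularised: "good (regularised w)"
  using someI_ex[OF ex_good] by (simp add: regularised_def)

lemma regularised_eq: "good w \<Longrightarrow> regularised w = w"
  by (simp add: regularised_def)

lemma AE_regularised: "AE w in clocks. regularised w = w"
  using AE_good by eventually_elim (rule regularised_eq)

lemma meas_regularised[measurable]: "regularised \<in> clocks \<rightarrow>\<^sub>M clocks"
  unfolding regularised_def[abs_def] by (rule measurable_If) (use pred_good in \<open>auto simp: pred_def\<close>)

lemma good_pos: "good w \<Longrightarrow> 0 < w j"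
  by (simp add: good_def)

lemma counted_mono: "m \<le> m' \<Longrightarrow> t \<le> t' \<Longrightarrow> counted w m t \<le> counted w m' t'"
proof -
  assume mm: "m \<le> m'" "t \<le> t'"
  have "counted w m t \<le> counted w m t'" unfolding counted_def by (rule sum_mono) (use mm in auto)
  also have "\<dots> \<le> counted w m' t'" unfolding counted_def by (rule sum_mono2) (use mm in auto)
  finally show ?thesis .
qed

lemma counted_le_count: "good w \<Longrightarrow> t \<le> T \<Longrightarrow> counted w m t \<le> count w T"
proof -
  assume g: "good w" and t: "t \<le> T"
  then obtain m0 where m0: "T < \<tau> w m0" by (auto simp: good_def)
  have "counted w m t \<le> counted w (max m m0) T" using t by (intro counted_mono) auto
  also have "\<dots> = count w T" using count_eq(1)[of w T m0 "max m m0"] good_pos[OF g] m0 by simp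
  finally show ?thesis .
qed

lemma compensator_nonneg: "0 \<le> compensator w m t"
  unfolding compensator_def by (intro add_nonneg_nonneg sum_nonneg G_nonneg \<kappa>_nonneg)

lemma compensator_le_count:
  assumes g: "good w" and t: "t \<le> T"
  shows "compensator w m t \<le> G T + \<kappa> T * count w T"
proof -
  have "(\<Sum>j<m. \<kappa> (t - \<tau> w j)) \<le> (\<Sum>j<m. \<kappa> T * (if \<tau> w j \<le> T then 1 else 0))"
    using \<kappa>_le \<kappa>_neg t by (intro sum_mono) auto
  also have "\<dots> = \<kappa> T * counted w m T" by (simp add: counted_def sum_distrib_left)
  also have "\<dots> \<le> \<kappa> T * count w T" using counted_le_count[OF g] \<kappa>_nonneg by (intro mult_left_mono) auto
  finally show ?thesis using monoD[OF mono_G t] by (simp add: compensator_def)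
qed

lemma stopped_bound:
  assumes g: "good w" and t: "t \<le> T"
  shows "\<bar>stopped m t w\<bar> \<le> count w T + (G T + \<kappa> T * count w T)"
proof -
  have "0 \<le> (\<Sum>k<m. w k)" using good_pos[OF g] by (intro sum_nonneg) (simp add: less_imp_le)
  then show ?thesis
    unfolding stopped_eq[OF good_pos[OF g]]
    using counted_nonneg[of w m t] counted_le_count[OF g t, of m] compensator_nonneg[of w m t] compensator_le_count[OF g t, of m]
    by (auto simp: min_def)
qed

lemma stopped_eventually:
  assumes g: "good w" and t: "0 \<le> t" "t \<le> T"
  shows "\<forall>\<^sub>F m in sequentially. stopped m t w = count w t - Lam w t"
proof -
  obtain m0 where m0: "T < \<tau> w m0" using g by (auto simp: good_def)
  then have m0': "t < \<tau> w m0" using t by simp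
  have "stopped m t w = count w t - Lam w t" if "m \<ge> Suc m0" for m
  proof -
    note e = count_eq[OF good_pos[OF g] m0', of m]
    have "compensator w m t = compensator w m0 t" using compensator_extend[of w m0 m t] good_pos[OF g] that m0' by simp
    also have "\<dots> \<le> (\<Sum>j<Suc m0. w j)" using \<tau>_le_iff[OF t(1), of w m0] m0' by simp
    also have "\<dots> \<le> (\<Sum>j<m. w j)" using that good_pos[OF g] by (intro sum_mono2) (auto intro: less_imp_le)
    finally show ?thesis using e that by (simp add: stopped_eq[OF good_pos[OF g]])
  qed
  then show ?thesis by (auto simp: eventually_sequentially)
qed

lemma Lam_bounds:
  assumes g: "good w" and t: "t \<le> T"
  shows "0 \<le> Lam w t" "Lam w t \<le> G T + \<kappa> T * count w T"
proof -
  obtain m0 where m0: "T < \<tau> w m0" using g by (auto simp: good_def)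
  then have e: "Lam w t = compensator w m0 t" using t by (intro count_eq(2)[OF good_pos[OF g], where m = m0]) auto
  show "0 \<le> Lam w t" "Lam w t \<le> G T + \<kappa> T * count w T"
    unfolding e using compensator_nonneg compensator_le_count[OF g t] by auto
qed

lemma integrable_Lam: 
  assumes "t \<le> T" shows "integrable clocks (\<lambda>w. Lam w t)"
proof (rule Bochner_Integration.integrable_bound)
  show "integrable clocks (\<lambda>w. G T + \<kappa> T * count w T)" using integrable_count by simp
  show "AE w in clocks. norm (Lam w t) \<le> norm (G T + \<kappa> T * count w T)"
    using AE_good by eventually_elim (use Lam_bounds assms in force)
qed measurable

text \<open>For the process stopped at the \<open>m\<close>-th jump the increments of the first \<open>m\<close> compensated indicators are
  summed; then \<open>m\<close> tends to infinity, dominated by the number of jumps up to \<open>T\<close>.\<close>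

lemma martingale_increment:
  assumes A: "Measurable.pred clocks A" and m: "\<And>k. Measurable.pred clocks (\<psi> k)"
    and \<psi>: "\<And>k w w'. (\<And>j. j < k \<Longrightarrow> w j = w' j) \<Longrightarrow> \<psi> k w = \<psi> k w'"
    and past: "\<And>k w. (\<And>j. 0 < w j) \<Longrightarrow> s < \<tau> w k \<Longrightarrow> A w = \<psi> k w"
    and st: "0 \<le> s" "s \<le> t" "t \<le> T"
  shows "(\<integral>w. indicator {w. A w} w * ((count w t - Lam w t) - (count w s - Lam w s)) \<partial>clocks) = 0"
proof -
  have [measurable]: "{w. A w} \<in> sets clocks" using A by (simp add: pred_def)
  let ?B = "\<lambda>w. 2 * (count w T + (G T + \<kappa> T * count w T))"
  have "(\<integral>w. indicator {w. A w} w * (stopped m t w - stopped m s w) \<partial>clocks) = 0" for m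
  proof -
    have "(\<integral>w. indicator {w. A w} w * (stopped m t w - stopped m s w) \<partial>clocks) =
      (\<integral>w. (\<Sum>k<m. indicator {w. A w} w * (hazard_gap (hazard w k t) (w k) - hazard_gap (hazard w k s) (w k))) \<partial>clocks)"
      by (simp add: stopped_def sum_distrib_left[symmetric] sum_subtractf)
    also have "\<dots> = (\<Sum>k<m. (\<integral>w. indicator {w. A w} w * (hazard_gap (hazard w k t) (w k) - hazard_gap (hazard w k s) (w k)) \<partial>clocks))"
    proof (rule Bochner_Integration.integral_sum)
      fix k
      have "integrable clocks (\<lambda>w. indicator {w. A w} w *\<^sub>R (hazard_gap (hazard w k t) (w k) - hazard_gap (hazard w k s) (w k)))"
        by (intro integrable_mult_indicator Bochner_Integration.integrable_diff integrable_hazard_gap_hazard) auto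
      then show "integrable clocks (\<lambda>w. indicator {w. A w} w * (hazard_gap (hazard w k t) (w k) - hazard_gap (hazard w k s) (w k)))"
        by simp
    qed
    also have "\<dots> = 0"
      by (intro sum.neutral ballI integral_hazard_gap_increment_past[OF A m \<psi> past st(2)])
    finally show ?thesis .
  qed
  moreover have "(\<lambda>m. \<integral>w. indicator {w. A w} w * (stopped m t w - stopped m s w) \<partial>clocks) \<longlonglongrightarrow>
    (\<integral>w. indicator {w. A w} w * ((count w t - Lam w t) - (count w s - Lam w s)) \<partial>clocks)"
  proof (rule integral_dominated_convergence[where w = ?B])
    show "integrable clocks ?B" using integrable_count by simp
    show "AE w in clocks. (\<lambda>m. indicator {w. A w} w * (stopped m t w - stopped m s w)) \<longlonglongrightarrow>
      indicator {w. A w} w * ((count w t - Lam w t) - (count w s - Lam w s))"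
      using AE_good
    proof eventually_elim
      case (elim w)
      have "\<forall>\<^sub>F m in sequentially. indicator {w. A w} w * (stopped m t w - stopped m s w) =
        indicator {w. A w} w * ((count w t - Lam w t) - (count w s - Lam w s))"
      proof -
        have "\<forall>\<^sub>F m in sequentially. stopped m t w = count w t - Lam w t"
          "\<forall>\<^sub>F m in sequentially. stopped m s w = count w s - Lam w s"
          using st by (auto intro: stopped_eventually[OF elim])
        then show ?thesis by eventually_elim simp
      qed
      then show ?case by (rule tendsto_eventually)
    qed
    show "AE w in clocks. norm (indicator {w. A w} w * (stopped m t w - stopped m s w)) \<le> ?B w" for m
      using AE_good
    proof eventually_elim
      case (elim w)
      have "norm (indicator {w. A w} w * (stopped m t w - stopped m s w)) \<le> \<bar>stopped m t w\<bar> + \<bar>stopped m s w\<bar>"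
        by (auto simp: indicator_def)
      then show ?case using stopped_bound[OF elim, of t m] stopped_bound[OF elim, of s m] st by simp
    qed
  qed measurable
  ultimately show ?thesis by (simp add: LIMSEQ_const_iff)
qed

definition hawkes_N :: "real \<Rightarrow> (nat \<Rightarrow> real) \<Rightarrow> real" where
  "hawkes_N t w = count (regularised w) t"

definition hawkes_L :: "real \<Rightarrow> (nat \<Rightarrow> real) \<Rightarrow> real" where
  "hawkes_L t w = Lam (regularised w) t"

lemma meas_hawkes_N[measurable]: "hawkes_N t \<in> borel_measurable clocks"
  unfolding hawkes_N_def[abs_def] by measurable

lemma meas_hawkes_L[measurable]: "hawkes_L t \<in> borel_measurable clocks"
  unfolding hawkes_L_def[abs_def] by measurable

lemma \<tau>_le_iff_count: 
  assumes g: "good w" and t: "t \<le> T" shows "\<tau> w j \<le> t \<longleftrightarrow> real j + 1 \<le> count w t"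
proof -
  obtain m0 where m0: "T < \<tau> w m0" using g by (auto simp: good_def)
  have mono: "\<tau> w i \<le> \<tau> w j \<longleftrightarrow> i \<le> j" for i j using \<tau>_le_iff_index[of w i j] good_pos[OF g] by simp
  define k where "k = (LEAST k. t < \<tau> w k)"
  have k1: "t < \<tau> w k" unfolding k_def using m0 t by (intro LeastI[where P = "\<lambda>k. t < \<tau> w k" and k = m0]) simp
  have k2: "\<tau> w i \<le> t" if "i < k" for i using not_less_Least[OF that[unfolded k_def]] by simp
  have eq: "\<tau> w i \<le> t \<longleftrightarrow> i < k" for i
    using k1 k2 mono[of k i] by (cases "i < k") auto
  have "count w t = counted w k t" using count_eq(1)[OF good_pos[OF g] k1] by simp
  also have "\<dots> = real k" unfolding counted_def eq by simp
  finally show ?thesis using eq[of j] by auto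
qed

abbreviation "hawkes_F \<equiv> natural_filtration clocks hawkes_N"

lemma space_hawkes_F: "space (hawkes_F t) = UNIV"
  by (simp add: natural_filtration_def)

lemma hawkes_N_adapted: "0 \<le> s \<Longrightarrow> s \<le> t \<Longrightarrow> hawkes_N s \<in> borel_measurable (hawkes_F t)"
proof -
  assume s: "0 \<le> s" "s \<le> t"
  have "(\<lambda>w. \<lambda>s\<in>{0..t}. hawkes_N s w) \<in> hawkes_F t \<rightarrow>\<^sub>M (\<Pi>\<^sub>M s\<in>{0..t}. borel)"
    unfolding natural_filtration_def by (rule measurable_vimage_algebra1) (auto simp: space_PiM)
  from measurable_compose[OF this measurable_component_singleton[of s]] s
  have "(\<lambda>w. (\<lambda>s\<in>{0..t}. hawkes_N s w) s) \<in> borel_measurable (hawkes_F t)" by simp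
  then show ?thesis using s by simp
qed

text \<open>The jump times truncated at \<open>t\<close> can be read off the counting process up to \<open>t\<close>, and
  \<open>\<kappa> (t - min r t) = \<kappa> (t - r)\<close> since \<open>\<kappa>\<close> vanishes to the left of 0.\<close>

lemma hawkes_L_adapted: 
  assumes t: "0 \<le> t" "t \<le> T" shows "hawkes_L t \<in> borel_measurable (hawkes_F t)"
proof -
  have "(\<lambda>w. min (\<tau> (regularised w) j) t) \<in> borel_measurable (hawkes_F t)" for j
  proof (rule borel_measurableI_le)
    fix r
    consider "r < 0" | "t \<le> r" | "0 \<le> r" "r < t" by linarith
    then show "{w\<in>space (hawkes_F t). min (\<tau> (regularised w) j) t \<le> r} \<in> sets (hawkes_F t)"
    proof cases
      case 1
      then have e: "{w\<in>space (hawkes_F t). min (\<tau> (regularised w) j) t \<le> r} = {}"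
        using \<tau>_nonneg t by (auto simp: min_le_iff_disj not_le intro: less_le_trans)
      show ?thesis unfolding e by simp
    next
      case 2
      then have e: "{w\<in>space (hawkes_F t). min (\<tau> (regularised w) j) t \<le> r} = space (hawkes_F t)" by auto
      show ?thesis unfolding e by simp
    next
      case 3
      then have "{w\<in>space (hawkes_F t). min (\<tau> (regularised w) j) t \<le> r} = {w\<in>space (hawkes_F t). real j + 1 \<le> hawkes_N r w}"
        using \<tau>_le_iff_count[OF good_regularised, of r] t by (auto simp: hawkes_N_def min_le_iff_disj)
      also have "\<dots> \<in> sets (hawkes_F t)"
        using hawkes_N_adapted[of r t] 3 by (intro borel_measurable_le) auto
      finally show ?thesis .
    qed
  qed
  then have "(\<lambda>w. \<kappa> (t - min (\<tau> (regularised w) j) t)) \<in> borel_measurable (hawkes_F t)" for j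
    by (intro measurable_compose[OF _ meas_\<kappa>] borel_measurable_diff borel_measurable_const)
  then have "(\<lambda>w. G t + (\<Sum>j. \<kappa> (t - min (\<tau> (regularised w) j) t))) \<in> borel_measurable (hawkes_F t)"
    by (intro borel_measurable_add borel_measurable_const borel_measurable_suminf)
  moreover have "\<kappa> (t - min x t) = \<kappa> (t - x)" for x by (auto simp: min_def \<kappa>_neg)
  ultimately show ?thesis by (simp add: hawkes_L_def[abs_def] Lam_def)
qed

lemma hawkes_F_sub: 
  shows "sigma_finite_subalgebra clocks (hawkes_F t)"
proof -
  have "(\<lambda>w. \<lambda>s\<in>{0..t}. hawkes_N s w) \<in> clocks \<rightarrow>\<^sub>M (\<Pi>\<^sub>M s\<in>{0..t}. borel)"
    by (rule measurable_restrict) measurable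
  then have "sets (hawkes_F t) \<subseteq> sets clocks"
    unfolding natural_filtration_def by (intro sets_image_in_sets) auto
  then have "finite_measure_subalgebra clocks (hawkes_F t)"
    by (auto simp: finite_measure_subalgebra_def finite_measure_subalgebra_axioms_def subalgebra_def
         clocks.finite_measure_axioms space_hawkes_F)
  then show ?thesis by (rule finite_measure_subalgebra_is_sigma_finite)
qed

lemma martingale: "martingale_on clocks T hawkes_F (\<lambda>t w. hawkes_N t w - hawkes_L t w)"
proof -
  have I: "integrable clocks (\<lambda>w. hawkes_N t w - hawkes_L t w)" if "t \<le> T" for t
  proof -
    have "integrable clocks (\<lambda>w. count w t - Lam w t)"
      using integrable_count integrable_Lam[OF that] by simp
    then show ?thesis
      by (rule integrable_cong_AE_imp) (use AE_regularised in \<open>auto simp: hawkes_N_def hawkes_L_def elim: eventually_mono\<close>)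
  qed
  have adapted: "(\<lambda>w. hawkes_N t w - hawkes_L t w) \<in> borel_measurable (hawkes_F t)" if "0 \<le> t" "t \<le> T" for t
    using hawkes_N_adapted[of t t] hawkes_L_adapted[of t] that by (intro borel_measurable_diff) auto
  have "AE w in clocks. real_cond_exp clocks (hawkes_F s) (\<lambda>w. hawkes_N t w - hawkes_L t w) w = hawkes_N s w - hawkes_L s w"
    if st: "0 \<le> s" "s \<le> t" "t \<le> T" for s t
  proof -
    interpret S: sigma_finite_subalgebra clocks "hawkes_F s" by (rule hawkes_F_sub)
    show ?thesis
    proof (rule S.real_cond_exp_charact)
      fix E assume E: "E \<in> sets (hawkes_F s)"
      then obtain B where B: "B \<in> sets (\<Pi>\<^sub>M s\<in>{0..s}. (borel :: real measure))"
        and EB: "E = (\<lambda>w. \<lambda>r\<in>{0..s}. hawkes_N r w) -` B"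
        unfolding natural_filtration_def by (subst (asm) sets_vimage_algebra2) (auto simp: space_PiM)
      define A where "A w \<longleftrightarrow> (\<lambda>r\<in>{0..s}. count w r) \<in> B" for w
      define \<psi> where "\<psi> k w \<longleftrightarrow> (\<lambda>r\<in>{0..s}. counted w k r) \<in> B" for k w
      have mA: "Measurable.pred clocks A" unfolding A_def
        by (rule pred_in_sets[OF _ B]) (intro measurable_restrict meas_count)
      have m\<psi>: "Measurable.pred clocks (\<psi> k)" for k unfolding \<psi>_def
        by (rule pred_in_sets[OF _ B]) (intro measurable_restrict meas_counted)
      have dep: "\<psi> k w = \<psi> k w'" if "\<And>j. j < k \<Longrightarrow> w j = w' j" for k w w'
      proof -
        have "\<tau> w j = \<tau> w' j" if "j < k" for j using \<open>\<And>j. j < k \<Longrightarrow> w j = w' j\<close> that by (intro \<tau>_cong) auto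
        then have "counted w k r = counted w' k r" for r unfolding counted_def by (intro sum.cong) auto
        then show ?thesis by (simp add: \<psi>_def)
      qed
      have past: "A w = \<psi> k w" if "\<And>j. 0 < w j" "s < \<tau> w k" for k w
      proof -
        have "count w r = counted w k r" if "r \<in> {0..s}" for r
          using count_eq(1)[of w r k k] that \<open>\<And>j. 0 < w j\<close> \<open>s < \<tau> w k\<close> by auto
        then show ?thesis unfolding A_def \<psi>_def by (metis (mono_tags, lifting) restrict_ext)
      qed
      have E'[measurable]: "E \<in> sets clocks" using E S.subalg by (auto simp: subalgebra_def)
      have Is: "integrable clocks (\<lambda>w. indicator E w * (hawkes_N t w - hawkes_L t w))" if "t \<le> T" for t
        using integrable_mult_indicator[OF E' I[OF that]] by simp
      have "(\<integral>w\<in>E. hawkes_N t w - hawkes_L t w \<partial>clocks) - (\<integral>w\<in>E. hawkes_N s w - hawkes_L s w \<partial>clocks) =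
        (\<integral>w. indicator E w * ((hawkes_N t w - hawkes_L t w) - (hawkes_N s w - hawkes_L s w)) \<partial>clocks)"
        unfolding set_lebesgue_integral_def real_scaleR_def right_diff_distrib[of _ "hawkes_N t _ - hawkes_L t _"]
        using Is[of t] Is[of s] st by (intro Bochner_Integration.integral_diff[symmetric]) auto
      also have "\<dots> = (\<integral>w. indicator {w. A w} w * ((count w t - Lam w t) - (count w s - Lam w s)) \<partial>clocks)"
      proof (rule integral_cong_AE)
        have [measurable]: "{w. A w} \<in> sets clocks" using mA by (simp add: pred_def)
        show "(\<lambda>w. indicator {w. A w} w * ((count w t - Lam w t) - (count w s - Lam w s))) \<in> borel_measurable clocks"
          by measurable
        show "AE w in clocks. indicator E w * ((hawkes_N t w - hawkes_L t w) - (hawkes_N s w - hawkes_L s w)) =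
          indicator {w. A w} w * ((count w t - Lam w t) - (count w s - Lam w s))"
          using AE_regularised by eventually_elim (simp add: EB A_def hawkes_N_def hawkes_L_def indicator_def)
      qed measurable
      also have "\<dots> = 0" by (rule martingale_increment[OF mA m\<psi> dep past st])
      finally show "(\<integral>w\<in>E. hawkes_N t w - hawkes_L t w \<partial>clocks) = (\<integral>w\<in>E. hawkes_N s w - hawkes_L s w \<partial>clocks)" by simp
    qed (use I adapted st in auto)
  qed
  then show ?thesis using I adapted by (auto simp: martingale_on_def)
qed

end

section \<open>The grid process driven by the same clocks\<close>

lemma nn_integral_clocks_split:
  assumes [measurable]: "f \<in> borel_measurable clocks"
  shows "(\<integral>\<^sup>+w. f w \<partial>clocks) = (\<integral>\<^sup>+w. (\<integral>\<^sup>+e. f (case_nat e w) \<partial>exp1) \<partial>clocks)"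
proof -
  have m[measurable]: "(\<lambda>(e, w). case_nat e w) \<in> exp1 \<Otimes>\<^sub>M clocks \<rightarrow>\<^sub>M clocks"
    unfolding clocks_def by measurable
  have "(\<integral>\<^sup>+w. f w \<partial>clocks) = (\<integral>\<^sup>+w. f w \<partial>distr (exp1 \<Otimes>\<^sub>M clocks) clocks (\<lambda>(e, w). case_nat e w))"
    using seqclocks.PiM_iter by (simp add: clocks_def)
  also have "\<dots> = (\<integral>\<^sup>+x. (case x of (e, w) \<Rightarrow> f (case_nat e w)) \<partial>(exp1 \<Otimes>\<^sub>M clocks))"
    by (subst nn_integral_distr[OF m]) (auto simp: case_prod_beta')
  also have "\<dots> = (\<integral>\<^sup>+w. (\<integral>\<^sup>+e. f (case_nat e w) \<partial>exp1) \<partial>clocks)"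
    using measurable_compose[OF m assms] by (subst pc.nn_integral_snd[symmetric]) (auto simp: case_prod_beta')
  finally show ?thesis .
qed

lemma exp1_memoryless:
  assumes a: "0 \<le> a" and f[measurable]: "f \<in> borel_measurable borel"
  shows "(\<integral>\<^sup>+e. indicator {a<..} e * f (e - a) \<partial>exp1) = ennreal (exp (- a)) * (\<integral>\<^sup>+e. f e \<partial>exp1)"
proof -
  have [measurable]: "exponential_density 1 \<in> borel_measurable borel" by measurable
  have "(\<integral>\<^sup>+e. indicator {a<..} e * f (e - a) \<partial>exp1)
     = (\<integral>\<^sup>+e. ennreal (exponential_density 1 e) * (indicator {a<..} e * f (e - a)) \<partial>lborel)"
    unfolding exp1_def by (subst nn_integral_density) auto
  also have "\<dots> = (\<integral>\<^sup>+x. ennreal (exponential_density 1 (a + 1 * x)) * (indicator {a<..} (a + 1 * x) * f (a + 1 * x - a)) \<partial>lborel)"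
    by (subst nn_integral_real_affine[where c = 1 and t = a]) auto
  also have "\<dots> = (\<integral>\<^sup>+x. ennreal (exp (- a)) * (ennreal (exponential_density 1 x) * f x) \<partial>lborel)"
  proof (rule nn_integral_cong_AE)
    have "AE x in lborel. x \<noteq> (0::real)" by (rule AE_lborel_singleton)
    then show "AE x in lborel. ennreal (exponential_density 1 (a + 1 * x)) * (indicator {a<..} (a + 1 * x) * f (a + 1 * x - a))
      = ennreal (exp (- a)) * (ennreal (exponential_density 1 x) * f x)"
    proof eventually_elim
      case (elim x)
      have "exponential_density 1 (a + x) = exp (- a) * exponential_density 1 x" if "0 < x"
        using that a by (simp add: exponential_density_def exp_add[symmetric])
      moreover have "exponential_density 1 x = 0" if "x < 0" using that by (simp add: exponential_density_def)
      ultimately show ?case using elim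
        by (cases "0 < x") (auto simp: ennreal_mult exponential_density_nonneg mult.assoc)
    qed
  qed
  also have "\<dots> = ennreal (exp (- a)) * (\<integral>\<^sup>+e. f e \<partial>exp1)"
    unfolding exp1_def by (subst nn_integral_cmult, simp, subst nn_integral_density) auto
  finally show ?thesis .
qed

text \<open>One step of the grid process on the clock sequence: if the first clock exceeds \<open>a\<close>, the amount \<open>a\<close> is
  subtracted from it, otherwise it is dropped. In both cases the remaining sequence has the original law
  and is independent of which case occurred.\<close>

lemma clocks_memoryless:
  assumes a: "0 \<le> a" and f[measurable]: "f \<in> borel_measurable clocks"
  shows "(\<lambda>w. indicator {w. a < w 0} w * f (w (0 := w 0 - a))) \<in> borel_measurable clocks"
    and "(\<lambda>w. indicator {w. w 0 \<le> a} w * f (\<lambda>j. w (Suc j))) \<in> borel_measurable clocks"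
    and "(\<integral>\<^sup>+w. indicator {w. a < w 0} w * f (w (0 := w 0 - a)) \<partial>clocks) = ennreal (exp (- a)) * (\<integral>\<^sup>+w. f w \<partial>clocks)"
    and "(\<integral>\<^sup>+w. indicator {w. w 0 \<le> a} w * f (\<lambda>j. w (Suc j)) \<partial>clocks) = ennreal (1 - exp (- a)) * (\<integral>\<^sup>+w. f w \<partial>clocks)"
proof -
  have [measurable]: "(\<lambda>w. w (0 := w 0 - a)) \<in> clocks \<rightarrow>\<^sub>M clocks"
  proof -
    have "(\<lambda>w. (w (0 := w 0 - a)) i) \<in> clocks \<rightarrow>\<^sub>M exp1" for i
      using measurable_clocks_component by (cases "i = 0") (auto simp: measurable_cong_sets[OF refl sets_exp1])
    then show ?thesis unfolding clocks_def by (intro measurable_PiM_single') (auto simp: space_PiM)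
  qed
  have [measurable]: "(\<lambda>w j. w (Suc j)) \<in> clocks \<rightarrow>\<^sub>M clocks"
  proof -
    have "(\<lambda>w. w (Suc i)) \<in> clocks \<rightarrow>\<^sub>M exp1" for i
      using measurable_clocks_component by (auto simp: measurable_cong_sets[OF refl sets_exp1])
    then show ?thesis unfolding clocks_def by (intro measurable_PiM_single') (auto simp: space_PiM)
  qed
  have [measurable]: "{w. a < w 0} \<in> sets clocks" "{w. w 0 \<le> a} \<in> sets clocks"
    using borel_measurable_less[OF borel_measurable_const[of a clocks] measurable_clocks_component[of 0]]
      borel_measurable_le[OF measurable_clocks_component[of 0] borel_measurable_const[of a clocks]] by auto
  show m1[measurable]: "(\<lambda>w. indicator {w. a < w 0} w * f (w (0 := w 0 - a))) \<in> borel_measurable clocks"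
    by measurable
  show m2[measurable]: "(\<lambda>w. indicator {w. w 0 \<le> a} w * f (\<lambda>j. w (Suc j))) \<in> borel_measurable clocks"
    by measurable
  have f': "(\<lambda>e. f (case_nat e w)) \<in> borel_measurable borel" for w
  proof -
    have "(\<lambda>e. case_nat e w) \<in> exp1 \<rightarrow>\<^sub>M clocks" 
      unfolding clocks_def by (intro measurable_PiM_single') (auto simp: space_PiM split: nat.split)
    from measurable_compose[OF this f] show ?thesis by (simp add: measurable_cong_sets[OF sets_exp1 refl])
  qed
  have "(\<integral>\<^sup>+w. indicator {w. a < w 0} w * f (w (0 := w 0 - a)) \<partial>clocks) =
     (\<integral>\<^sup>+w. (\<integral>\<^sup>+e. indicator {a<..} e * f (case_nat (e - a) w) \<partial>exp1) \<partial>clocks)"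
  proof (subst nn_integral_clocks_split[OF m1], intro nn_integral_cong)
    fix w :: "nat \<Rightarrow> real" and e
    have "(case_nat e w)(0 := e - a) = case_nat (e - a) w" by (auto simp: fun_eq_iff split: nat.split)
    then show "indicator {w. a < w 0} (case_nat e w) * f ((case_nat e w)(0 := case_nat e w 0 - a)) =
      indicator {a<..} e * f (case_nat (e - a) w)" by (simp add: indicator_def)
  qed
  also have "\<dots> = (\<integral>\<^sup>+w. ennreal (exp (- a)) * (\<integral>\<^sup>+e. f (case_nat e w) \<partial>exp1) \<partial>clocks)"
    by (intro nn_integral_cong exp1_memoryless[OF a f'])
  also have "\<dots> = ennreal (exp (- a)) * (\<integral>\<^sup>+w. f w \<partial>clocks)"
  proof -
    have m: "(\<lambda>(e, w). case_nat e w) \<in> exp1 \<Otimes>\<^sub>M clocks \<rightarrow>\<^sub>M clocks"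
      unfolding clocks_def by measurable
    have "(\<lambda>(w, e). f (case_nat e w)) \<in> borel_measurable (clocks \<Otimes>\<^sub>M exp1)"
      using measurable_compose[OF measurable_pair_swap'[of clocks exp1] measurable_compose[OF m f]] by (simp add: case_prod_beta')
    then have "(\<lambda>w. \<integral>\<^sup>+e. f (case_nat e w) \<partial>exp1) \<in> borel_measurable clocks"
      by (intro exp1.borel_measurable_nn_integral)
    then show ?thesis by (simp add: nn_integral_cmult nn_integral_clocks_split[OF f])
  qed
  finally show "(\<integral>\<^sup>+w. indicator {w. a < w 0} w * f (w (0 := w 0 - a)) \<partial>clocks) = ennreal (exp (- a)) * (\<integral>\<^sup>+w. f w \<partial>clocks)" .
  have "measure exp1 {..a} = 1 - exp (- a)"
    using exp1.prob_compl[of "{a<..}"] prob_exp1_gt[OF a] by (simp add: Compl_eq_Diff_UNIV[symmetric] not_less)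
  then have le: "emeasure exp1 {..a} = ennreal (1 - exp (- a))" by (simp add: exp1.emeasure_eq_measure)
  have "(\<integral>\<^sup>+w. indicator {w. w 0 \<le> a} w * f (\<lambda>j. w (Suc j)) \<partial>clocks) =
     (\<integral>\<^sup>+w. (\<integral>\<^sup>+e. f w * indicator {..a} e \<partial>exp1) \<partial>clocks)"
    by (subst nn_integral_clocks_split[OF m2], intro nn_integral_cong) (simp add: indicator_def)
  also have "\<dots> = (\<integral>\<^sup>+w. ennreal (1 - exp (- a)) * f w \<partial>clocks)"
    using le by (intro nn_integral_cong, subst nn_integral_cmult_indicator) (auto simp: mult.commute)
  also have "\<dots> = ennreal (1 - exp (- a)) * (\<integral>\<^sup>+w. f w \<partial>clocks)" by (rule nn_integral_cmult) simp
  finally show "(\<integral>\<^sup>+w. indicator {w. w 0 \<le> a} w * f (\<lambda>j. w (Suc j)) \<partial>clocks) = ennreal (1 - exp (- a)) * (\<integral>\<^sup>+w. f w \<partial>clocks)" .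
qed

context hawkes_clock
begin

text \<open>Jump \<open>k\<close> of the grid process takes place in the cell with right end point \<open>grid T n (jump_cell n c w (Suc k))\<close>,
  which is the time at which the scheme registers it. The two sums are the values of \<open>grid_compensator\<close>
  below at \<open>u\<close> and at the last jump. Clocks restart at the end of the cell of a jump: the overshoot is
  discarded, so that by the lack of memory every cell sees fresh clocks.\<close>

fun jump_cell :: "nat \<Rightarrow> real \<Rightarrow> (nat \<Rightarrow> real) \<Rightarrow> nat \<Rightarrow> nat" where
  "jump_cell n c w 0 = 0"
| "jump_cell n c w (Suc k) = (LEAST u. jump_cell n c w k < u \<and> w k \<le> c *
     (G (grid T n u) + (\<Sum>j\<leftarrow>[0..<k]. \<kappa> (grid T n u - grid T n (jump_cell n c w (Suc j)) + grid T n 1) - \<kappa> (grid T n 1))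
    - (G (grid T n (jump_cell n c w k)) + (\<Sum>j\<leftarrow>[0..<k]. \<kappa> (grid T n (jump_cell n c w k) - grid T n (jump_cell n c w (Suc j)) + grid T n 1) - \<kappa> (grid T n 1)))))"

declare jump_cell.simps(2)[simp del]

text \<open>The sum of the parameters \<open>cell_hazard\<close> of the cells before cell \<open>u\<close>, after \<open>k\<close> jumps. A jump contributes
  to the following cells only, so the increment of \<open>\<kappa>\<close> over the cell of the jump is subtracted.\<close>

definition grid_compensator :: "nat \<Rightarrow> real \<Rightarrow> (nat \<Rightarrow> real) \<Rightarrow> nat \<Rightarrow> nat \<Rightarrow> real" where
  "grid_compensator n c w k u = G (grid T n u) + (\<Sum>j<k. \<kappa> (grid T n u - grid T n (jump_cell n c w (Suc j)) + grid T n 1) - \<kappa> (grid T n 1))"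

lemma jump_cell_Suc: "jump_cell n c w (Suc k) = (LEAST u. jump_cell n c w k < u \<and> w k \<le> c * (grid_compensator n c w k u - grid_compensator n c w k (jump_cell n c w k)))"
  by (subst jump_cell.simps(2)) (simp only: grid_compensator_def sum_list_distinct_conv_sum_set distinct_upt set_upt atLeast0LessThan)

lemma grid_mono: "i \<le> j \<Longrightarrow> grid T n i \<le> grid T n j"
  using T by (auto simp: grid_def intro!: divide_right_mono mult_right_mono)

lemma grid_less_iff: "0 < n \<Longrightarrow> grid T n i < grid T n j \<longleftrightarrow> i < j"
  and grid_le_iff: "0 < n \<Longrightarrow> grid T n i \<le> grid T n j \<longleftrightarrow> i \<le> j"
  using T by (auto simp: grid_def divide_less_cancel divide_le_cancel)

lemma grid_0[simp]: "grid T n 0 = 0"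
  by (simp add: grid_def)

lemma grid_nonneg: "0 \<le> grid T n i"
  using grid_mono[of 0 i n] by simp

lemma grid_add: "grid T n (i + j) = grid T n i + grid T n j"
  by (simp add: grid_def algebra_simps add_divide_distrib)

lemma grid_diff: "j \<le> i \<Longrightarrow> grid T n (i - j) = grid T n i - grid T n j"
  using grid_add[of n "i - j" j] by simp

lemma grid_compensator_mono: "u \<le> v \<Longrightarrow> grid_compensator n c w k u \<le> grid_compensator n c w k v"
  unfolding grid_compensator_def using grid_mono[of u v n]
  by (intro add_mono sum_mono diff_mono monoD[OF mono_G] monoD[OF mono_\<kappa>]) auto

lemma grid_at_top: "0 < n \<Longrightarrow> filterlim (grid T n) at_top sequentially"
  unfolding grid_def using T by real_asymp

lemma grid_compensator_at_top:
  assumes "0 < n" shows "filterlim (grid_compensator n c w k) at_top sequentially"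
proof -
  have "filterlim (\<lambda>u. - (real k * \<kappa> (grid T n 1)) + G (grid T n u)) at_top sequentially"
    by (intro filterlim_tendsto_add_at_top[OF tendsto_const] filterlim_compose[OF G_lim grid_at_top[OF assms]])
  then show ?thesis
  proof (rule filterlim_at_top_mono, intro always_eventually allI)
    fix u
    have "- (real k * \<kappa> (grid T n 1)) = (\<Sum>j<k. 0 - \<kappa> (grid T n 1))" by simp
    also have "\<dots> \<le> (\<Sum>j<k. \<kappa> (grid T n u - grid T n (jump_cell n c w (Suc j)) + grid T n 1) - \<kappa> (grid T n 1))"
      by (intro sum_mono diff_mono \<kappa>_nonneg order_refl)
    finally show "- (real k * \<kappa> (grid T n 1)) + G (grid T n u) \<le> grid_compensator n c w k u"
      unfolding grid_compensator_def by simp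
  qed
qed

lemma jump_cell_props:
  assumes n: "0 < n" and c: "0 < c"
  shows "jump_cell n c w k < jump_cell n c w (Suc k)"
    and "jump_cell n c w k < u \<Longrightarrow> jump_cell n c w (Suc k) \<le> u \<longleftrightarrow> w k \<le> c * (grid_compensator n c w k u - grid_compensator n c w k (jump_cell n c w k))"
proof -
  let ?P = "\<lambda>u. jump_cell n c w k < u \<and> w k \<le> c * (grid_compensator n c w k u - grid_compensator n c w k (jump_cell n c w k))"
  have "\<forall>\<^sub>F u in sequentially. w k / c + grid_compensator n c w k (jump_cell n c w k) \<le> grid_compensator n c w k u"
    using grid_compensator_at_top[OF n] by (simp add: filterlim_at_top)
  then have "\<forall>\<^sub>F u in sequentially. ?P u"
    using eventually_gt_at_top[of "jump_cell n c w k"]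
    by eventually_elim (use c in \<open>auto simp: field_simps\<close>)
  then obtain u0 where "?P u0" by (auto simp: eventually_sequentially)
  then have P: "?P (jump_cell n c w (Suc k))" unfolding jump_cell_Suc by (rule LeastI)
  then show "jump_cell n c w k < jump_cell n c w (Suc k)" by simp
  show "jump_cell n c w (Suc k) \<le> u \<longleftrightarrow> w k \<le> c * (grid_compensator n c w k u - grid_compensator n c w k (jump_cell n c w k))" if "jump_cell n c w k < u"
  proof
    assume "jump_cell n c w (Suc k) \<le> u"
    then have "c * (grid_compensator n c w k (jump_cell n c w (Suc k)) - grid_compensator n c w k (jump_cell n c w k)) \<le> c * (grid_compensator n c w k u - grid_compensator n c w k (jump_cell n c w k))"
      using c grid_compensator_mono by (intro mult_left_mono diff_mono) auto
    then show "w k \<le> c * (grid_compensator n c w k u - grid_compensator n c w k (jump_cell n c w k))" using P by simp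
  next
    assume "w k \<le> c * (grid_compensator n c w k u - grid_compensator n c w k (jump_cell n c w k))"
    then show "jump_cell n c w (Suc k) \<le> u" unfolding jump_cell_Suc using that by (intro Least_le) simp
  qed
qed

lemma jump_cell_strict_mono: "0 < n \<Longrightarrow> 0 < c \<Longrightarrow> strict_mono (jump_cell n c w)"
  by (intro strict_monoI_Suc jump_cell_props)

lemma tendsto_grid_steps: "0 \<le> t \<Longrightarrow> (\<lambda>n. grid T n (steps T n t)) \<longlonglongrightarrow> t"
proof -
  assume t: "0 \<le> t"
  show ?thesis
  proof (rule tendsto_sandwich)
    have b: "t - T / real n \<le> grid T n (steps T n t) \<and> grid T n (steps T n t) \<le> t" if "n > 0" for n
    proof -
      have "real (steps T n t) = of_int \<lfloor>real n * t / T\<rfloor>" unfolding steps_def using t T by simp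
      then have "real n * t / T - 1 \<le> real (steps T n t)" "real (steps T n t) \<le> real n * t / T" by linarith+
      from mult_right_mono[OF this(1), of "T / real n"] mult_right_mono[OF this(2), of "T / real n"]
      show ?thesis using that T unfolding grid_def by (simp add: algebra_simps)
    qed
    show "\<forall>\<^sub>F n in sequentially. t - T / real n \<le> grid T n (steps T n t)"
      "\<forall>\<^sub>F n in sequentially. grid T n (steps T n t) \<le> t"
      using eventually_gt_at_top[of 0] by (eventually_elim, use b in blast)+
    show "(\<lambda>n. t - T / real n) \<longlonglongrightarrow> t" by real_asymp
  qed simp
qed

lemma tendsto_G: "(f \<longlongrightarrow> l) F \<Longrightarrow> ((\<lambda>x. G (f x)) \<longlongrightarrow> G l) F"
  and tendsto_\<kappa>: "(f \<longlongrightarrow> l) F \<Longrightarrow> ((\<lambda>x. \<kappa> (f x)) \<longlongrightarrow> \<kappa> l) F"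
  using cont_G cont_\<kappa> by (auto intro: isCont_tendsto_compose simp: continuous_on_eq_continuous_at)

lemma tendsto_grid_1: "(\<lambda>n. grid T n 1) \<longlonglongrightarrow> 0"
  unfolding grid_def by real_asymp

lemma tendsto_grid_compensator:
  assumes "\<And>j. j < k \<Longrightarrow> (\<lambda>n. grid T n (jump_cell n (c n) w (Suc j))) \<longlonglongrightarrow> \<tau> w j" and "(\<lambda>n. grid T n (u n)) \<longlonglongrightarrow> t"
  shows "(\<lambda>n. grid_compensator n (c n) w k (u n)) \<longlonglongrightarrow> compensator w k t"
proof -
  have "(\<lambda>n. grid_compensator n (c n) w k (u n)) \<longlonglongrightarrow> G t + (\<Sum>j<k. \<kappa> (t - \<tau> w j + 0) - \<kappa> 0)"
    unfolding grid_compensator_def using assms by (intro tendsto_intros tendsto_G tendsto_\<kappa> tendsto_grid_1) auto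
  then show ?thesis by (simp add: compensator_def \<kappa>_neg)
qed

text \<open>By induction the previous jump times converge, hence also the accumulated hazard at each fixed time.
  Before \<open>\<tau> w k\<close> its limit is below the clock, so the jump is late enough; after \<open>\<tau> w k\<close> there is a rational
  time at which the limit exceeds the clock strictly, so the jump is not too late.\<close>

lemma tendsto_jump_cell:
  assumes g: "good w" and c: "c \<longlonglongrightarrow> 1"
  shows "(\<lambda>n. grid T n (jump_cell n (c n) w (Suc k))) \<longlonglongrightarrow> \<tau> w k"
proof (induction k rule: less_induct)
  case (less k)
  note pos = good_pos[OF g]
  \<comment> \<open>\<open>\<sigma>\<close> is the limit of the last restart of the clocks.\<close>
  define \<sigma> where "\<sigma> = (case k of 0 \<Rightarrow> 0 | Suc j \<Rightarrow> \<tau> w j)"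
  have \<sigma>: "0 \<le> \<sigma>" "\<sigma> < \<tau> w k" "compensator w k \<sigma> = (\<Sum>j<k. w j)"
  proof -
    have "\<tau> w j < \<tau> w (Suc j)" "compensator w (Suc j) (\<tau> w j) = (\<Sum>i<Suc j. w i)" "0 < \<tau> w 0" "compensator w 0 0 = 0" for j
      using \<tau>_less_Suc[of w j] compensator_\<tau>[of w j] \<tau>_pos[of w 0] compensator_Suc[of w j "\<tau> w j"] compensator_0[of w 0 0] pos by (auto simp: \<kappa>_neg)
    then show "0 \<le> \<sigma>" "\<sigma> < \<tau> w k" "compensator w k \<sigma> = (\<Sum>j<k. w j)"
      using \<tau>_nonneg unfolding \<sigma>_def by (cases k; simp)+
  qed
  have U\<sigma>: "(\<lambda>n. grid T n (jump_cell n (c n) w k)) \<longlonglongrightarrow> \<sigma>"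
    using less by (cases k) (auto simp: \<sigma>_def)
  have ev: "\<forall>\<^sub>F n in sequentially. 0 < n \<and> 0 < c n"
    using eventually_gt_at_top[of 0] order_tendstoD(1)[OF c, of 0] by (auto intro: eventually_conj)
  have lim: "(\<lambda>n. c n * (grid_compensator n (c n) w k (steps T n t) - grid_compensator n (c n) w k (jump_cell n (c n) w k))) \<longlonglongrightarrow> 1 * (compensator w k t - (\<Sum>j<k. w j))"
    if "0 \<le> t" for t
  proof -
    have "(\<lambda>n. grid_compensator n (c n) w k (steps T n t)) \<longlonglongrightarrow> compensator w k t"
      by (rule tendsto_grid_compensator[OF less tendsto_grid_steps[OF that]])
    moreover have "(\<lambda>n. grid_compensator n (c n) w k (jump_cell n (c n) w k)) \<longlonglongrightarrow> (\<Sum>j<k. w j)"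
      unfolding \<sigma>(3)[symmetric] by (rule tendsto_grid_compensator[OF less U\<sigma>])
    ultimately show ?thesis by (intro tendsto_mult tendsto_diff c)
  qed
  have after: "\<forall>\<^sub>F n in sequentially. jump_cell n (c n) w k < steps T n t" if "\<sigma> < t" for t
  proof -
    have "\<forall>\<^sub>F n in sequentially. grid T n (jump_cell n (c n) w k) < (\<sigma> + t) / 2" "\<forall>\<^sub>F n in sequentially. (\<sigma> + t) / 2 < grid T n (steps T n t)"
      using order_tendstoD(2)[OF U\<sigma>, of "(\<sigma> + t) / 2"] order_tendstoD(1)[OF tendsto_grid_steps, of t "(\<sigma> + t) / 2"] that \<sigma>(1) by auto
    then show ?thesis using ev
    proof eventually_elim
      case (elim n)
      then have "grid T n (jump_cell n (c n) w k) < grid T n (steps T n t)" by linarith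
      then show ?case using grid_less_iff elim(3) by blast
    qed
  qed
  show ?case
  proof (rule order_tendstoI)
    fix a assume a: "a < \<tau> w k"
    define t where "t = (max a \<sigma> + \<tau> w k) / 2"
    have t: "a < t" "\<sigma> < t" "t < \<tau> w k" using a \<sigma> by (auto simp: t_def)
    then have "compensator w k t - (\<Sum>j<k. w j) < w k" using \<tau>_le_iff[of t w k] \<sigma>(1) by auto
    then have "\<forall>\<^sub>F n in sequentially. c n * (grid_compensator n (c n) w k (steps T n t) - grid_compensator n (c n) w k (jump_cell n (c n) w k)) < w k"
      using t \<sigma> by (intro order_tendstoD(2)[OF lim]) auto
    moreover have "\<forall>\<^sub>F n in sequentially. a < grid T n (steps T n t)"
      using t \<sigma> by (intro order_tendstoD(1)[OF tendsto_grid_steps]) auto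
    ultimately show "\<forall>\<^sub>F n in sequentially. a < grid T n (jump_cell n (c n) w (Suc k))"
      using ev after[OF t(2)]
    proof eventually_elim
      case (elim n)
      then have "steps T n t \<le> jump_cell n (c n) w (Suc k)" using jump_cell_props(2)[of n "c n" w k "steps T n t"] by auto
      then show ?case using elim(2) grid_mono[of "steps T n t" "jump_cell n (c n) w (Suc k)" n] by simp
    qed
  next
    fix b assume b: "\<tau> w k < b"
    then obtain q where q: "q \<in> \<rat>" "\<tau> w k < q" "q < b" using Rats_dense_in_real by blast
    have "(\<Sum>j<Suc k. w j) \<le> compensator w k q" using compensator_\<tau>[of w k] pos monoD[OF compensator_mono, of "\<tau> w k" q w k] q by simp
    moreover have "compensator w k q \<noteq> (\<Sum>j<Suc k. w j)" using g q unfolding good_def by blast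
    ultimately have "w k < 1 * (compensator w k q - (\<Sum>j<k. w j))" by simp
    then have "\<forall>\<^sub>F n in sequentially. w k < c n * (grid_compensator n (c n) w k (steps T n q) - grid_compensator n (c n) w k (jump_cell n (c n) w k))"
      using q \<sigma> by (intro order_tendstoD(1)[OF lim]) auto
    moreover have "\<forall>\<^sub>F n in sequentially. grid T n (steps T n q) < b"
      using q \<sigma> by (intro order_tendstoD(2)[OF tendsto_grid_steps]) auto
    ultimately show "\<forall>\<^sub>F n in sequentially. grid T n (jump_cell n (c n) w (Suc k)) < b"
      using ev after[OF less_trans[OF \<sigma>(2) q(2)]]
    proof eventually_elim
      case (elim n)
      then have "jump_cell n (c n) w (Suc k) \<le> steps T n q" using jump_cell_props(2)[of n "c n" w k "steps T n q"] by auto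
      then show ?case using elim(2) grid_mono[of "jump_cell n (c n) w (Suc k)" "steps T n q" n] by simp
    qed
  qed
qed

definition jump_bit :: "nat \<Rightarrow> real \<Rightarrow> (nat \<Rightarrow> real) \<Rightarrow> nat \<Rightarrow> nat" where
  "jump_bit n c w i = (if Suc i \<in> range (\<lambda>k. jump_cell n c w (Suc k)) then 1 else 0)"

text \<open>The parameter \<open>alpha\<close> of the scheme in terms of the primitives.\<close>

definition cell_hazard :: "nat \<Rightarrow> (nat \<Rightarrow> nat) \<Rightarrow> nat \<Rightarrow> real" where
  "cell_hazard n b i = (G (grid T n (Suc i)) - G (grid T n i)) +
     (\<Sum>j<i. (\<kappa> (grid T n (Suc (i - j))) - \<kappa> (grid T n (i - j))) * real (b j))"

lemma cell_hazard_nonneg: "0 \<le> cell_hazard n b i"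
  unfolding cell_hazard_def using monoD[OF mono_G grid_mono] monoD[OF mono_\<kappa> grid_mono]
  by (intro add_nonneg_nonneg sum_nonneg mult_nonneg_nonneg) auto

lemma cell_hazard_cong: "(\<And>j. j < i \<Longrightarrow> b j = b' j) \<Longrightarrow> cell_hazard n b i = cell_hazard n b' i"
  unfolding cell_hazard_def by (auto intro!: sum.cong)

definition jumps_before :: "nat \<Rightarrow> real \<Rightarrow> (nat \<Rightarrow> real) \<Rightarrow> nat \<Rightarrow> nat" where
  "jumps_before n c w i = (LEAST k. i < jump_cell n c w (Suc k))"

text \<open>The clocks not yet used at the beginning of cell \<open>i\<close>, with the current one reduced by the hazard
  accumulated since the last jump.\<close>

definition remaining_clocks :: "nat \<Rightarrow> real \<Rightarrow> (nat \<Rightarrow> real) \<Rightarrow> nat \<Rightarrow> nat \<Rightarrow> real" where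
  "remaining_clocks n c w i = (let k = jumps_before n c w i in
     (\<lambda>j. if j = 0 then w k - c * (grid_compensator n c w k i - grid_compensator n c w k (jump_cell n c w k)) else w (k + j)))"

context
  fixes n :: nat and c :: real
  assumes n: "0 < n" and c: "0 < c"
begin

lemma jump_cell_less_iff: "jump_cell n c w j < jump_cell n c w k \<longleftrightarrow> j < k" and jump_cell_le_iff: "jump_cell n c w j \<le> jump_cell n c w k \<longleftrightarrow> j \<le> k"
  using jump_cell_strict_mono[OF n c] by (auto simp: strict_mono_less strict_mono_less_eq)

lemma jumps_before_eqI: "jump_cell n c w k \<le> i \<Longrightarrow> i < jump_cell n c w (Suc k) \<Longrightarrow> jumps_before n c w i = k"
  unfolding jumps_before_def
proof (rule Least_equality)
  fix y assume "jump_cell n c w k \<le> i" "i < jump_cell n c w (Suc y)"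
  then have "jump_cell n c w k < jump_cell n c w (Suc y)" by simp
  then show "k \<le> y" by (simp add: jump_cell_less_iff)
qed

lemma jumps_before_props: "jump_cell n c w (jumps_before n c w i) \<le> i" "i < jump_cell n c w (Suc (jumps_before n c w i))"
proof -
  have "Suc i \<le> jump_cell n c w (Suc i)" using strict_mono_imp_increasing[OF jump_cell_strict_mono[OF n c]] by blast
  then show *: "i < jump_cell n c w (Suc (jumps_before n c w i))" unfolding jumps_before_def by (intro LeastI[where P = "\<lambda>k. i < jump_cell n c w (Suc k)" and k = i]) simp
  show "jump_cell n c w (jumps_before n c w i) \<le> i"
  proof (cases "jumps_before n c w i")
    case (Suc k)
    then have "\<not> i < jump_cell n c w (Suc k)" using not_less_Least[of k "\<lambda>k. i < jump_cell n c w (Suc k)"] by (simp add: jumps_before_def)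
    then show ?thesis using Suc by simp
  qed simp
qed

lemma sum_jump_bit:
  fixes f :: "nat \<Rightarrow> real"
  assumes k: "jump_cell n c w k \<le> i" "i < jump_cell n c w (Suc k)"
  shows "(\<Sum>j<i. f j * real (jump_bit n c w j)) = (\<Sum>l<k. f (jump_cell n c w (Suc l) - 1))"
proof -
  have U0: "0 < jump_cell n c w (Suc l)" for l using jump_cell_less_iff[of w 0 "Suc l"] by simp
  have inj: "inj_on (\<lambda>l. jump_cell n c w (Suc l) - 1) {..<k}"
  proof (rule inj_onI)
    fix x y assume "jump_cell n c w (Suc x) - 1 = jump_cell n c w (Suc y) - 1"
    then have "jump_cell n c w (Suc x) = jump_cell n c w (Suc y)" using U0[of x] U0[of y] by simp
    then show "x = y" using jump_cell_less_iff[of w "Suc x" "Suc y"] jump_cell_less_iff[of w "Suc y" "Suc x"] by simp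
  qed
  have img: "(\<lambda>l. jump_cell n c w (Suc l) - 1) ` {..<k} = {j\<in>{..<i}. jump_bit n c w j = 1}"
  proof (intro set_eqI iffI)
    fix j assume "j \<in> (\<lambda>l. jump_cell n c w (Suc l) - 1) ` {..<k}"
    then obtain l where l: "l < k" "j = jump_cell n c w (Suc l) - 1" by auto
    then have "jump_cell n c w (Suc l) \<le> i" using jump_cell_le_iff[of w "Suc l" k] k by simp
    then show "j \<in> {j\<in>{..<i}. jump_bit n c w j = 1}" using l U0[of l] by (auto simp: jump_bit_def)
  next
    fix j assume "j \<in> {j\<in>{..<i}. jump_bit n c w j = 1}"
    then obtain l where l: "j < i" "Suc j = jump_cell n c w (Suc l)" by (auto simp: jump_bit_def split: if_splits)
    then have "jump_cell n c w (Suc l) < jump_cell n c w (Suc k)" using k by simp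
    then show "j \<in> (\<lambda>l. jump_cell n c w (Suc l) - 1) ` {..<k}" using l by (auto simp: jump_cell_less_iff image_iff intro!: bexI[of _ l])
  qed
  have "(\<Sum>j<i. f j * real (jump_bit n c w j)) = (\<Sum>j\<in>{j\<in>{..<i}. jump_bit n c w j = 1}. f j)"
    by (subst sum.inter_filter) (auto simp: jump_bit_def intro!: sum.cong)
  also have "\<dots> = (\<Sum>l<k. f (jump_cell n c w (Suc l) - 1))"
    unfolding img[symmetric] by (subst sum.reindex[OF inj]) simp
  finally show ?thesis .
qed

lemma cell_hazard_jump_bit: 
  assumes k: "jump_cell n c w k \<le> i" "i < jump_cell n c w (Suc k)"
  shows "cell_hazard n (jump_bit n c w) i = grid_compensator n c w k (Suc i) - grid_compensator n c w k i"
proof -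
  have "grid T n (Suc (i - (jump_cell n c w (Suc l) - 1))) = grid T n (Suc i) - grid T n (jump_cell n c w (Suc l)) + grid T n 1"
    "grid T n (i - (jump_cell n c w (Suc l) - 1)) = grid T n i - grid T n (jump_cell n c w (Suc l)) + grid T n 1" if "l < k" for l
  proof -
    have "jump_cell n c w (Suc l) \<le> i" "0 < jump_cell n c w (Suc l)"
      using jump_cell_le_iff[of w "Suc l" k] that k jump_cell_less_iff[of w 0 "Suc l"] by simp_all
    then have e: "Suc (i - (jump_cell n c w (Suc l) - 1)) = Suc i - jump_cell n c w (Suc l) + 1"
      "i - (jump_cell n c w (Suc l) - 1) = i - jump_cell n c w (Suc l) + 1" "jump_cell n c w (Suc l) \<le> Suc i" "jump_cell n c w (Suc l) \<le> i" by auto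
    show "grid T n (Suc (i - (jump_cell n c w (Suc l) - 1))) = grid T n (Suc i) - grid T n (jump_cell n c w (Suc l)) + grid T n 1"
      unfolding e(1) grid_add grid_diff[OF e(3)] ..
    show "grid T n (i - (jump_cell n c w (Suc l) - 1)) = grid T n i - grid T n (jump_cell n c w (Suc l)) + grid T n 1"
      unfolding e(2) grid_add grid_diff[OF e(4)] ..
  qed
  then have "(\<Sum>l<k. \<kappa> (grid T n (Suc (i - (jump_cell n c w (Suc l) - 1)))) - \<kappa> (grid T n (i - (jump_cell n c w (Suc l) - 1)))) =
    (\<Sum>l<k. (\<kappa> (grid T n (Suc i) - grid T n (jump_cell n c w (Suc l)) + grid T n 1) - \<kappa> (grid T n 1))
       - (\<kappa> (grid T n i - grid T n (jump_cell n c w (Suc l)) + grid T n 1) - \<kappa> (grid T n 1)))"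
    by (intro sum.cong) auto
  then show ?thesis unfolding cell_hazard_def sum_jump_bit[OF k] grid_compensator_def sum_subtractf by simp
qed

lemma remaining_clocks_0: "remaining_clocks n c w 0 = w"
proof -
  have "jumps_before n c w 0 = 0" by (rule jumps_before_eqI) (use jump_cell_less_iff[of w 0 1] in auto)
  then show ?thesis by (auto simp: remaining_clocks_def fun_eq_iff)
qed

lemma remaining_clocks_Suc:
  defines "a \<equiv> \<lambda>w i. c * cell_hazard n (jump_bit n c w) i"
  shows "a w i < remaining_clocks n c w i 0 \<Longrightarrow> jump_bit n c w i = 0 \<and> remaining_clocks n c w (Suc i) = (remaining_clocks n c w i)(0 := remaining_clocks n c w i 0 - a w i)"
    and "remaining_clocks n c w i 0 \<le> a w i \<Longrightarrow> jump_bit n c w i = 1 \<and> remaining_clocks n c w (Suc i) = (\<lambda>j. remaining_clocks n c w i (Suc j))"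
proof -
  define k where "k = jumps_before n c w i"
  have k: "jump_cell n c w k \<le> i" "i < jump_cell n c w (Suc k)" using jumps_before_props unfolding k_def by auto
  have a: "a w i = c * (grid_compensator n c w k (Suc i) - grid_compensator n c w k i)" unfolding a_def cell_hazard_jump_bit[OF k] ..
  have r: "remaining_clocks n c w i = (\<lambda>j. if j = 0 then w k - c * (grid_compensator n c w k i - grid_compensator n c w k (jump_cell n c w k)) else w (k + j))"
    unfolding remaining_clocks_def Let_def k_def[symmetric] ..
  have iff: "jump_cell n c w (Suc k) \<le> Suc i \<longleftrightarrow> remaining_clocks n c w i 0 \<le> a w i"
    using jump_cell_props(2)[OF n c, of w k "Suc i"] k unfolding a r by (simp add: algebra_simps)
  show "jump_bit n c w i = 0 \<and> remaining_clocks n c w (Suc i) = (remaining_clocks n c w i)(0 := remaining_clocks n c w i 0 - a w i)" if "a w i < remaining_clocks n c w i 0"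
  proof
    have less: "Suc i < jump_cell n c w (Suc k)" using iff that by simp
    then have "jumps_before n c w (Suc i) = k" using k by (intro jumps_before_eqI) auto
    then show "remaining_clocks n c w (Suc i) = (remaining_clocks n c w i)(0 := remaining_clocks n c w i 0 - a w i)"
      unfolding r a by (simp add: remaining_clocks_def fun_eq_iff algebra_simps)
    have "Suc i \<noteq> jump_cell n c w (Suc l)" for l
    proof (cases "l < k")
      case True then show ?thesis using jump_cell_le_iff[of w "Suc l" k] k by simp
    next
      case False then show ?thesis using jump_cell_le_iff[of w "Suc k" "Suc l"] less by simp
    qed
    then show "jump_bit n c w i = 0" by (auto simp: jump_bit_def)
  qed
  show "jump_bit n c w i = 1 \<and> remaining_clocks n c w (Suc i) = (\<lambda>j. remaining_clocks n c w i (Suc j))" if "remaining_clocks n c w i 0 \<le> a w i"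
  proof
    have eq: "jump_cell n c w (Suc k) = Suc i" using iff that k by simp
    then have "jumps_before n c w (Suc i) = Suc k" using jump_cell_less_iff[of w "Suc k" "Suc (Suc k)"] by (intro jumps_before_eqI) auto
    then show "remaining_clocks n c w (Suc i) = (\<lambda>j. remaining_clocks n c w i (Suc j))"
      unfolding r using eq by (simp add: remaining_clocks_def fun_eq_iff)
    show "jump_bit n c w i = 1" unfolding jump_bit_def using eq by (auto simp: image_iff intro!: exI[of _ k])
  qed
qed

text \<open>By induction on the cells, with the memoryless step: given the first \<open>i\<close> bits, the remaining clocks are
  again independent exponential. The arbitrary function \<open>f\<close> carries this through the induction.\<close>

lemma jump_bit_law:
  assumes b: "\<And>j. b j \<le> 1" and f: "f \<in> borel_measurable clocks"
  shows "(\<lambda>w. indicator {w. \<forall>j<i. jump_bit n c w j = b j} w * f (remaining_clocks n c w i)) \<in> borel_measurable clocks"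
    and "(\<integral>\<^sup>+w. indicator {w. \<forall>j<i. jump_bit n c w j = b j} w * f (remaining_clocks n c w i) \<partial>clocks) =
      ennreal (\<Prod>j<i. if b j = 0 then exp (- (c * cell_hazard n b j)) else 1 - exp (- (c * cell_hazard n b j))) * (\<integral>\<^sup>+w. f w \<partial>clocks)"
proof -
  have "(\<lambda>w. indicator {w. \<forall>j<i. jump_bit n c w j = b j} w * f (remaining_clocks n c w i)) \<in> borel_measurable clocks \<and>
    (\<integral>\<^sup>+w. indicator {w. \<forall>j<i. jump_bit n c w j = b j} w * f (remaining_clocks n c w i) \<partial>clocks) =
      ennreal (\<Prod>j<i. if b j = 0 then exp (- (c * cell_hazard n b j)) else 1 - exp (- (c * cell_hazard n b j))) * (\<integral>\<^sup>+w. f w \<partial>clocks)"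
    using f
  proof (induction i arbitrary: f)
    case 0
    then show ?case by (simp add: remaining_clocks_0)
  next
    case (Suc i)
    define a where "a = c * cell_hazard n b i"
    have a: "0 \<le> a" unfolding a_def using c cell_hazard_nonneg by simp
    define g where "g v = (if b i = 0 then indicator {v. a < v 0} v * f (v (0 := v 0 - a))
      else indicator {v. v 0 \<le> a} v * f (\<lambda>j. v (Suc j)))" for v :: "nat \<Rightarrow> real"
    note cm = clocks_memoryless[OF a Suc.prems]
    have g: "g \<in> borel_measurable clocks"
      unfolding g_def[abs_def] using cm(1,2) by (cases "b i = 0") (simp_all only: if_True if_False simp_thms)
    have gi: "(\<integral>\<^sup>+w. g w \<partial>clocks) = ennreal (if b i = 0 then exp (- a) else 1 - exp (- a)) * (\<integral>\<^sup>+w. f w \<partial>clocks)"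
      unfolding g_def using cm(3,4) by (cases "b i = 0") (simp_all only: if_True if_False simp_thms)
    have eq: "indicator {w. \<forall>j<Suc i. jump_bit n c w j = b j} w * f (remaining_clocks n c w (Suc i)) =
      indicator {w. \<forall>j<i. jump_bit n c w j = b j} w * g (remaining_clocks n c w i)" for w
    proof (cases "\<forall>j<i. jump_bit n c w j = b j")
      case True
      then have "cell_hazard n (jump_bit n c w) i = cell_hazard n b i" by (intro cell_hazard_cong) auto
      then have a': "c * cell_hazard n (jump_bit n c w) i = a" by (simp add: a_def)
      have bi: "b i = 0 \<or> b i = 1" using b[of i] by linarith
      show ?thesis
      proof (cases "a < remaining_clocks n c w i 0")
        case less: True
        then have "jump_bit n c w i = 0 \<and> remaining_clocks n c w (Suc i) = (remaining_clocks n c w i)(0 := remaining_clocks n c w i 0 - a)"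
          using remaining_clocks_Suc(1)[of w i] unfolding a' by simp
        then show ?thesis using True less bi by (auto simp: g_def less_Suc_eq indicator_def)
      next
        case le: False
        then have "jump_bit n c w i = 1 \<and> remaining_clocks n c w (Suc i) = (\<lambda>j. remaining_clocks n c w i (Suc j))"
          using remaining_clocks_Suc(2)[of w i] unfolding a' by simp
        then show ?thesis using True le bi by (auto simp: g_def less_Suc_eq indicator_def)
      qed
    next
      case False
      then have "\<not> (\<forall>j<Suc i. jump_bit n c w j = b j)" by (meson less_SucI)
      then have "w \<notin> {w. \<forall>j<Suc i. jump_bit n c w j = b j}" "w \<notin> {w. \<forall>j<i. jump_bit n c w j = b j}" using False by blast+
      from indicator_simps(2)[OF this(1)] indicator_simps(2)[OF this(2)] show ?thesis by (metis (no_types, lifting) mult_zero_left)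
    qed
    have nn: "0 \<le> (\<Prod>j<i. if b j = 0 then exp (- (c * cell_hazard n b j)) else 1 - exp (- (c * cell_hazard n b j)))"
      using c cell_hazard_nonneg by (intro prod_nonneg) auto
    have nn': "0 \<le> (if b i = 0 then exp (- a) else 1 - exp (- a))" using a by simp
    have "ennreal (\<Prod>j<Suc i. if b j = 0 then exp (- (c * cell_hazard n b j)) else 1 - exp (- (c * cell_hazard n b j))) =
      ennreal (\<Prod>j<i. if b j = 0 then exp (- (c * cell_hazard n b j)) else 1 - exp (- (c * cell_hazard n b j))) *
      ennreal (if b i = 0 then exp (- a) else 1 - exp (- a))"
      unfolding prod.lessThan_Suc a_def[symmetric] using nn nn' by (rule ennreal_mult)
    then show ?case unfolding eq using Suc.IH[OF g] unfolding gi by (simp only: mult.assoc)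
  qed
  note * = this
  show "(\<lambda>w. indicator {w. \<forall>j<i. jump_bit n c w j = b j} w * f (remaining_clocks n c w i)) \<in> borel_measurable clocks"
    using * by (rule conjunct1)
  show "(\<integral>\<^sup>+w. indicator {w. \<forall>j<i. jump_bit n c w j = b j} w * f (remaining_clocks n c w i) \<partial>clocks) =
      ennreal (\<Prod>j<i. if b j = 0 then exp (- (c * cell_hazard n b j)) else 1 - exp (- (c * cell_hazard n b j))) * (\<integral>\<^sup>+w. f w \<partial>clocks)"
    using * by (rule conjunct2)
qed

lemma jump_bit_prob:
  assumes b: "\<And>j. b j \<le> 1"
  shows "{w. \<forall>j<i. jump_bit n c w j = b j} \<in> sets clocks"
    and "measure clocks {w. \<forall>j<i. jump_bit n c w j = b j} =
      (\<Prod>j<i. if b j = 0 then exp (- (c * cell_hazard n b j)) else 1 - exp (- (c * cell_hazard n b j)))"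
proof -
  have "(\<lambda>w. indicator {w. \<forall>j<i. jump_bit n c w j = b j} w :: ennreal) \<in> borel_measurable clocks"
    using jump_bit_law(1)[where b = b and f = "\<lambda>_. 1" and i = i, OF b borel_measurable_const]
    by (simp only: mult_1_right)
  then show s: "{w. \<forall>j<i. jump_bit n c w j = b j} \<in> sets clocks"
    unfolding borel_measurable_indicator_iff by simp
  have "0 \<le> (\<Prod>j<i. if b j = 0 then exp (- (c * cell_hazard n b j)) else 1 - exp (- (c * cell_hazard n b j)))"
    using c cell_hazard_nonneg by (intro prod_nonneg) auto
  then show "measure clocks {w. \<forall>j<i. jump_bit n c w j = b j} =
      (\<Prod>j<i. if b j = 0 then exp (- (c * cell_hazard n b j)) else 1 - exp (- (c * cell_hazard n b j)))"
    using jump_bit_law(2)[where b = b and f = "\<lambda>_. 1" and i = i, OF b borel_measurable_const] s clocks.emeasure_space_1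
    by (simp only: mult_1_right nn_integral_indicator nn_integral_const space_clocks clocks.emeasure_eq_measure
         borel_measurable_const ennreal_inj measure_nonneg clocks.prob_space ennreal_1)
qed

end

end

section \<open>Convergence of paths in the Skorokhod distance\<close>

text \<open>Hat functions of height \<open>d j\<close> around the points \<open>p j\<close> are added to the identity. The sum of their
  Lipschitz constants is less than 1, which keeps the function strictly increasing.\<close>

lemma time_change_exists:
  fixes p d :: "nat \<Rightarrow> real"
  assumes \<delta>: "0 < \<delta>" and p: "\<And>j. j < k \<Longrightarrow> \<delta> \<le> p j" "\<And>j. j < k \<Longrightarrow> p j + \<delta> \<le> T"
    and sep: "\<And>i j. i < k \<Longrightarrow> j < k \<Longrightarrow> i \<noteq> j \<Longrightarrow> \<delta> \<le> \<bar>p i - p j\<bar>"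
    and d: "(\<Sum>j<k. \<bar>d j\<bar>) < \<delta>" and T: "0 < T"
  obtains u where "u \<in> time_changes T" "\<And>j. j < k \<Longrightarrow> u (p j) = p j + d j"
    "\<And>t. \<bar>u t - t\<bar> \<le> (\<Sum>j<k. \<bar>d j\<bar>)"
proof -
  define hat where "hat x = max 0 (1 - \<bar>x\<bar> / \<delta>)" for x
  define u where "u t = t + (\<Sum>j<k. d j * hat (t - p j))" for t
  have hat01: "0 \<le> hat x" "hat x \<le> 1" for x using \<delta> by (auto simp: hat_def)
  have hat0: "hat x = 0" if "\<delta> \<le> \<bar>x\<bar>" for x using \<delta> that by (auto simp: hat_def)
  have lip: "\<bar>hat x - hat y\<bar> \<le> \<bar>x - y\<bar> / \<delta>" for x y
  proof -
    have "\<bar>hat x - hat y\<bar> \<le> \<bar>(1 - \<bar>x\<bar> / \<delta>) - (1 - \<bar>y\<bar> / \<delta>)\<bar>" unfolding hat_def by (auto simp: max_def abs_if)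
    also have "\<dots> = \<bar>\<bar>y\<bar> - \<bar>x\<bar>\<bar> / \<delta>" using \<delta> by (simp add: diff_divide_distrib[symmetric])
    also have "\<dots> \<le> \<bar>x - y\<bar> / \<delta>" using \<delta> by (intro divide_right_mono) auto
    finally show ?thesis .
  qed
  have mono: "u s < u t" if "s < t" for s t
  proof -
    have "\<bar>(\<Sum>j<k. d j * hat (t - p j)) - (\<Sum>j<k. d j * hat (s - p j))\<bar> \<le> (\<Sum>j<k. \<bar>d j\<bar> * ((t - s) / \<delta>))"
    proof -
      have "\<bar>\<Sum>j<k. d j * hat (t - p j) - d j * hat (s - p j)\<bar> \<le> (\<Sum>j<k. \<bar>d j * hat (t - p j) - d j * hat (s - p j)\<bar>)"
        by (rule sum_abs)
      also have "\<dots> \<le> (\<Sum>j<k. \<bar>d j\<bar> * ((t - s) / \<delta>))"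
      proof (rule sum_mono)
        fix j
        have "\<bar>d j * hat (t - p j) - d j * hat (s - p j)\<bar> = \<bar>d j\<bar> * \<bar>hat (t - p j) - hat (s - p j)\<bar>"
          by (simp add: abs_mult right_diff_distrib[symmetric])
        also have "\<dots> \<le> \<bar>d j\<bar> * ((t - s) / \<delta>)"
          using lip[of "t - p j" "s - p j"] that by (intro mult_left_mono) auto
        finally show "\<bar>d j * hat (t - p j) - d j * hat (s - p j)\<bar> \<le> \<bar>d j\<bar> * ((t - s) / \<delta>)" .
      qed
      finally show ?thesis by (simp add: sum_subtractf)
    qed
    also have "\<dots> = (\<Sum>j<k. \<bar>d j\<bar>) / \<delta> * (t - s)" by (simp add: sum_distrib_right sum_divide_distrib)
    also have "\<dots> < 1 * (t - s)" using d \<delta> that by (intro mult_strict_right_mono) auto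
    finally show ?thesis unfolding u_def abs_less_iff by simp
  qed
  have bound: "\<bar>u t - t\<bar> \<le> (\<Sum>j<k. \<bar>d j\<bar>)" for t
  proof -
    have "\<bar>u t - t\<bar> \<le> (\<Sum>j<k. \<bar>d j * hat (t - p j)\<bar>)" unfolding u_def by simp
    also have "\<dots> \<le> (\<Sum>j<k. \<bar>d j\<bar>)"
      using hat01 by (intro sum_mono) (simp add: abs_mult mult_left_le)
    finally show ?thesis .
  qed
  have "hat (0 - p j) = 0" "hat (T - p j) = 0" if "j < k" for j
    using p(1)[OF that] p(2)[OF that] by (auto intro!: hat0)
  then have u0: "u 0 = 0" and uT: "u T = T" unfolding u_def by (auto intro!: sum.neutral)
  have up: "u (p j) = p j + d j" if "j < k" for j
  proof -
    have "(\<Sum>i<k. d i * hat (p j - p i)) = (\<Sum>i<k. if i = j then d j else 0)"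
    proof (intro sum.cong refl)
      fix i assume i: "i \<in> {..<k}"
      show "d i * hat (p j - p i) = (if i = j then d j else 0)"
      proof (cases "i = j")
        case True then show ?thesis by (simp add: hat_def)
      next
        case False then show ?thesis using sep[of j i] that i by (simp add: hat0)
      qed
    qed
    then show ?thesis using that by (simp add: u_def)
  qed
  have "continuous_on {0..T} u" unfolding u_def hat_def using \<delta> by (intro continuous_intros) auto
  have "bij_betw u {0..T} {0..T}"
  proof (rule bij_betw_imageI)
    show "inj_on u {0..T}" using mono by (metis inj_onI linorder_neqE_linordered_idom less_irrefl)
    show "u ` {0..T} = {0..T}"
    proof (intro set_eqI iffI)
      fix y assume "y \<in> u ` {0..T}"
      then obtain t where "t \<in> {0..T}" "y = u t" by auto
      then show "y \<in> {0..T}" using mono[of 0 t] mono[of t T] u0 uT by (cases "t = 0"; cases "t = T") auto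
    next
      fix y assume "y \<in> {0..T}"
      then have "\<exists>x\<ge>0. x \<le> T \<and> u x = y" using u0 uT T \<open>continuous_on {0..T} u\<close> by (intro IVT') auto
      then show "y \<in> u ` {0..T}" by auto
    qed
  qed
  then have "u \<in> time_changes T" using mono by (auto simp: time_changes_def strict_mono_on_def)
  then show ?thesis using up bound that by blast
qed

lemma cadlag_on_Pair:
  "cadlag_on T x \<Longrightarrow> cadlag_on T y \<Longrightarrow> cadlag_on T (\<lambda>t. (x t, y t))"
  unfolding cadlag_on_def
proof (intro conjI ballI; elim conjE)
  fix t assume t: "t \<in> {0..<T}" and "\<forall>t\<in>{0..<T}. (x \<longlongrightarrow> x t) (at_right t)" "\<forall>t\<in>{0..<T}. (y \<longlongrightarrow> y t) (at_right t)"
  then show "((\<lambda>t. (x t, y t)) \<longlongrightarrow> (x t, y t)) (at_right t)" by (intro tendsto_Pair) auto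
next
  fix t assume t: "t \<in> {0<..T}" and "\<forall>t\<in>{0<..T}. \<exists>l. (x \<longlongrightarrow> l) (at_left t)" "\<forall>t\<in>{0<..T}. \<exists>l. (y \<longlongrightarrow> l) (at_left t)"
  then obtain l1 l2 where "(x \<longlongrightarrow> l1) (at_left t)" "(y \<longlongrightarrow> l2) (at_left t)" by blast
  then show "\<exists>l. ((\<lambda>t. (x t, y t)) \<longlongrightarrow> l) (at_left t)" by (intro exI[of _ "(l1, l2)"] tendsto_Pair)
qed

lemma cadlag_on_continuous:
  assumes "\<And>t. isCont x t" shows "cadlag_on T x"
  using assms unfolding cadlag_on_def isCont_def by (meson filterlim_at_split)

lemma cadlag_on_cong:
  assumes "\<And>t. t \<in> {0..T} \<Longrightarrow> x t = y t" "cadlag_on T y" shows "cadlag_on T x"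
proof -
  have "(x \<longlongrightarrow> l) (at_right t) \<longleftrightarrow> (y \<longlongrightarrow> l) (at_right t)" if "0 \<le> t" "t < T" for t l
    using that assms(1) by (intro tendsto_cong) (auto simp: eventually_at_right_field intro!: exI[of _ T])
  moreover have "(x \<longlongrightarrow> l) (at_left t) \<longleftrightarrow> (y \<longlongrightarrow> l) (at_left t)" if "0 < t" "t \<le> T" for t l
    using that assms(1) by (intro tendsto_cong) (auto simp: eventually_at_left_field intro!: exI[of _ 0])
  ultimately show ?thesis using assms by (auto simp: cadlag_on_def)
qed

lemma cadlag_on_restrict: "cadlag_on T x \<Longrightarrow> cadlag_on T (restrict x {0..T})"
  by (rule cadlag_on_cong[of T _ x]) auto

lemma cadlag_on_step:
  fixes a :: real
  shows "cadlag_on T (\<lambda>t. if a \<le> t then 1 else 0 :: real)"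
  unfolding cadlag_on_def
proof (intro conjI ballI)
  fix t :: real
  have "\<forall>\<^sub>F s in at_right t. (if a \<le> s then 1 else 0 :: real) = (if a \<le> t then 1 else 0)"
    unfolding eventually_at_right_field by (intro exI[of _ "if a \<le> t then t + 1 else a"]) auto
  then show "((\<lambda>t. if a \<le> t then 1 else 0 :: real) \<longlongrightarrow> (if a \<le> t then 1 else 0)) (at_right t)"
    by (rule tendsto_eventually)
  have "\<forall>\<^sub>F s in at_left t. (if a \<le> s then 1 else 0 :: real) = (if a < t then 1 else 0)"
    unfolding eventually_at_left_field by (intro exI[of _ "if a < t then a else t - 1"]) auto
  then show "\<exists>l. ((\<lambda>t. if a \<le> t then 1 else 0 :: real) \<longlongrightarrow> l) (at_left t)"
    by (intro exI tendsto_eventually)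
qed

lemma cadlag_on_sum:
  fixes x :: "'i \<Rightarrow> real \<Rightarrow> real"
  assumes "\<And>i. i \<in> I \<Longrightarrow> cadlag_on T (x i)" shows "cadlag_on T (\<lambda>t. \<Sum>i\<in>I. x i t)"
  unfolding cadlag_on_def
proof (intro conjI ballI)
  fix t assume "t \<in> {0..<T}"
  then show "((\<lambda>t. \<Sum>i\<in>I. x i t) \<longlongrightarrow> (\<Sum>i\<in>I. x i t)) (at_right t)"
    using assms by (intro tendsto_sum) (auto simp: cadlag_on_def)
next
  fix t assume "t \<in> {0<..T}"
  then have "\<forall>i\<in>I. \<exists>l. (x i \<longlongrightarrow> l) (at_left t)" using assms by (auto simp: cadlag_on_def)
  then obtain l where "\<And>i. i \<in> I \<Longrightarrow> (x i \<longlongrightarrow> l i) (at_left t)" by metis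
  then show "\<exists>l. ((\<lambda>t. \<Sum>i\<in>I. x i t) \<longlongrightarrow> l) (at_left t)"
    by (intro exI[of _ "\<Sum>i\<in>I. l i"] tendsto_sum)
qed

lemma cadlag_on_cmult:
  fixes x :: "real \<Rightarrow> real"
  assumes "cadlag_on T x" shows "cadlag_on T (\<lambda>t. a * x t)"
  unfolding cadlag_on_def
proof (intro conjI ballI)
  fix t assume "t \<in> {0..<T}"
  then show "((\<lambda>t. a * x t) \<longlongrightarrow> a * x t) (at_right t)"
    using assms by (intro tendsto_mult_left) (auto simp: cadlag_on_def)
next
  fix t assume "t \<in> {0<..T}"
  then obtain l where "(x \<longlongrightarrow> l) (at_left t)" using assms unfolding cadlag_on_def by blast
  then show "\<exists>l. ((\<lambda>t. a * x t) \<longlongrightarrow> l) (at_left t)" by (intro exI[of _ "a * l"] tendsto_mult_left)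
qed

lemma steps_le_iff: "0 < n \<Longrightarrow> 0 < T \<Longrightarrow> 0 \<le> t \<Longrightarrow> m \<le> steps T n t \<longleftrightarrow> grid T n m \<le> t"
proof -
  assume a: "0 < n" "0 < T" "0 \<le> t"
  have "m \<le> steps T n t \<longleftrightarrow> int m \<le> \<lfloor>real n * t / T\<rfloor>" unfolding steps_def using a by (simp add: le_nat_iff)
  also have "\<dots> \<longleftrightarrow> real m \<le> real n * t / T" by (simp add: le_floor_iff)
  also have "\<dots> \<longleftrightarrow> grid T n m \<le> t" unfolding grid_def using a by (simp add: field_simps)
  finally show ?thesis .
qed

lemma steps_le:
  assumes n: "0 < n" and T: "0 < T" and t: "t \<in> {0..T}"
  shows "steps T n t \<le> n"
proof -
  have "grid T n (Suc n) = T + T / real n" using n by (simp add: grid_def field_simps)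
  moreover have "0 < T / real n" using n T by simp
  ultimately have "t < grid T n (Suc n)" using t by simp
  then have "\<not> Suc n \<le> steps T n t" using t by (subst steps_le_iff[OF n T]) auto
  then show ?thesis by simp
qed

lemma cadlag_on_steps:
  fixes F :: "nat \<Rightarrow> real"
  assumes n: "0 < n" and T: "0 < T"
  shows "cadlag_on T (\<lambda>t. \<Sum>i<steps T n t. F i)"
proof (rule cadlag_on_cong)
  show "cadlag_on T (\<lambda>t. \<Sum>i<n. F i * (if grid T n (Suc i) \<le> t then 1 else 0))"
    by (intro cadlag_on_sum cadlag_on_cmult cadlag_on_step)
  fix t assume t: "t \<in> {0..T}"
  have le: "steps T n t \<le> n" by (rule steps_le[OF n T t])
  have "(\<Sum>i<n. F i * (if grid T n (Suc i) \<le> t then 1 else 0)) = (\<Sum>i<n. if i < steps T n t then F i else 0)"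
    using steps_le_iff[OF n T, of t] t by (intro sum.cong) (auto simp: Suc_le_eq[symmetric])
  also have "\<dots> = (\<Sum>i<steps T n t. F i)"
    using le by (intro sum.mono_neutral_cong_right) auto
  finally show "(\<Sum>i<steps T n t. F i) = (\<Sum>i<n. F i * (if grid T n (Suc i) \<le> t then 1 else 0))" by simp
qed

context hawkes_clock
begin

definition scheme_path :: "nat \<Rightarrow> (nat \<Rightarrow> nat) \<Rightarrow> real \<Rightarrow> real \<times> real" where
  "scheme_path n b = (\<lambda>t\<in>{0..T}. (\<Sum>i<steps T n t. cell_hazard n b i + \<kappa> (grid T n 1) * real (b i), \<Sum>i<steps T n t. real (b i)))"

definition limit_path :: "(nat \<Rightarrow> real) \<Rightarrow> real \<Rightarrow> real \<times> real" where
  "limit_path w = (\<lambda>t\<in>{0..T}. (Lam w t, count w t))"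

lemma scheme_path_skorokhod: "0 < n \<Longrightarrow> scheme_path n b \<in> skorokhod_space T"
  unfolding skorokhod_space_def scheme_path_def using T
  by (auto intro!: cadlag_on_restrict cadlag_on_Pair cadlag_on_steps)

lemma number_of_jumps:
  assumes g: "good w"
  obtains k where "T < \<tau> w k" "\<And>j. j < k \<Longrightarrow> \<tau> w j < T"
proof -
  obtain m0 where m0: "T < \<tau> w m0" using g by (auto simp: good_def)
  define k where "k = (LEAST k. T < \<tau> w k)"
  have k1: "T < \<tau> w k" unfolding k_def using m0 by (rule LeastI)
  have "\<tau> w j < T" if "j < k" for j
  proof -
    have "\<tau> w j \<le> T" using not_less_Least[OF that[unfolded k_def]] by simp
    moreover have "\<tau> w j \<noteq> T"
    proof
      assume "\<tau> w j = T"
      then have "compensator w j T = (\<Sum>i<Suc j. w i)" using compensator_\<tau>[of w j] good_pos[OF g] by simp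
      then show False using g unfolding good_def by blast
    qed
    ultimately show ?thesis by simp
  qed
  then show ?thesis using k1 that by blast
qed

lemma cadlag_count:
  assumes g: "good w" shows "cadlag_on T (count w)"
proof -
  obtain k where k: "T < \<tau> w k" using number_of_jumps[OF g] by blast
  show ?thesis
  proof (rule cadlag_on_cong)
    show "cadlag_on T (\<lambda>t. \<Sum>j<k. if \<tau> w j \<le> t then 1 else 0 :: real)"
      by (intro cadlag_on_sum cadlag_on_step)
    show "count w t = (\<Sum>j<k. if \<tau> w j \<le> t then 1 else 0)" if "t \<in> {0..T}" for t
      using count_eq(1)[of w t k k] good_pos[OF g] k that by (simp add: counted_def)
  qed
qed

lemma limit_path_skorokhod:
  assumes g: "good w" shows "limit_path w \<in> skorokhod_space T"
proof -
  obtain k where k: "T < \<tau> w k" using number_of_jumps[OF g] by blast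
  have "cadlag_on T (Lam w)"
  proof (rule cadlag_on_cong)
    show "cadlag_on T (compensator w k)" using compensator_cont[of w k] by (intro cadlag_on_continuous) (simp add: continuous_on_eq_continuous_at)
    show "Lam w t = compensator w k t" if "t \<in> {0..T}" for t
      using count_eq(2)[of w t k k] good_pos[OF g] k that by simp
  qed
  then show ?thesis unfolding skorokhod_space_def limit_path_def
    by (auto intro!: cadlag_on_restrict cadlag_on_Pair cadlag_count g)
qed

text \<open>The increments of \<open>\<kappa>\<close> telescope, so the integrated intensity of the scheme has the same form as that of
  the limit.\<close>

lemma sum_cell_hazard:
  "(\<Sum>i<m. cell_hazard n b i + \<kappa> (grid T n 1) * real (b i)) = G (grid T n m) + (\<Sum>j<m. \<kappa> (grid T n (m - j)) * real (b j))"
proof (induction m)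
  case 0 then show ?case by (simp add: G_neg)
next
  case (Suc m)
  have "(\<Sum>j<m. (\<kappa> (grid T n (Suc (m - j))) - \<kappa> (grid T n (m - j))) * real (b j)) =
     (\<Sum>j<m. \<kappa> (grid T n (Suc m - j)) * real (b j)) - (\<Sum>j<m. \<kappa> (grid T n (m - j)) * real (b j))"
    unfolding sum_subtractf[symmetric] by (intro sum.cong) (auto simp: algebra_simps Suc_diff_le)
  then show ?case using Suc by (simp add: cell_hazard_def)
qed

lemma sum_jump_bit_le:
  fixes f :: "nat \<Rightarrow> real"
  assumes n: "0 < n" and c: "0 < c" and K: "m < jump_cell n c w (Suc K)"
  shows "(\<Sum>j<m. f j * real (jump_bit n c w j)) = (\<Sum>l<K. if jump_cell n c w (Suc l) \<le> m then f (jump_cell n c w (Suc l) - 1) else 0)"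
proof -
  define k where "k = jumps_before n c w m"
  have k: "jump_cell n c w k \<le> m" "m < jump_cell n c w (Suc k)" using jumps_before_props[OF n c] unfolding k_def by auto
  have "jump_cell n c w k < jump_cell n c w (Suc K)" using k K by simp
  then have kK: "k \<le> K" by (simp add: jump_cell_less_iff[OF n c])
  have iff: "jump_cell n c w (Suc l) \<le> m \<longleftrightarrow> l < k" for l
    using k jump_cell_le_iff[OF n c, of w "Suc l" k] jump_cell_le_iff[OF n c, of w "Suc k" "Suc l"] by (cases "l < k") auto
  show ?thesis unfolding sum_jump_bit[OF n c k] iff using kK
    by (intro sum.mono_neutral_cong_left) auto
qed

text \<open>A time change that maps the limiting jump times to those of the grid process makes the counting parts
  equal. The first components are then close by uniform continuity of \<open>G\<close> and \<open>\<kappa>\<close>, since all their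
  arguments are close.\<close>

lemma J1_convergence:
  assumes g: "good w" and c: "c \<longlonglongrightarrow> 1"
  shows "(\<lambda>n. skorokhod_dist T (scheme_path n (jump_bit n (c n) w)) (limit_path w)) \<longlonglongrightarrow> 0"
proof -
  obtain k where k: "T < \<tau> w k" "\<And>j. j < k \<Longrightarrow> \<tau> w j < T" using number_of_jumps[OF g] by blast
  define v where "v n j = grid T n (jump_cell n (c n) w (Suc j))" for n j
  define D where "D n = (\<Sum>j<k. \<bar>v n j - \<tau> w j\<bar>)" for n
  have v: "(\<lambda>n. v n j) \<longlonglongrightarrow> \<tau> w j" for j unfolding v_def by (rule tendsto_jump_cell[OF g c])
  have D: "D \<longlonglongrightarrow> 0"
  proof -
    have "D \<longlonglongrightarrow> (\<Sum>j<k. \<bar>\<tau> w j - \<tau> w j\<bar>)" unfolding D_def by (intro tendsto_intros v)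
    then show ?thesis by simp
  qed
  have D0: "0 \<le> D n" for n unfolding D_def by (intro sum_nonneg) auto
  \<comment> \<open>\<open>\<delta>\<close> is the smallest distance between jump times and end points; 1 is added in case there is no jump.\<close>
  define S where "S = {1} \<union> \<tau> w ` {..<k} \<union> (\<lambda>j. T - \<tau> w j) ` {..<k} \<union> (\<lambda>(i, j). \<bar>\<tau> w i - \<tau> w j\<bar>) ` {(i, j). i < k \<and> j < k \<and> i \<noteq> j}"
  have finS: "finite S"
  proof -
    have "finite {(i, j). i < k \<and> j < k \<and> i \<noteq> j}" by (rule finite_subset[of _ "{..<k} \<times> {..<k}"]) auto
    then show ?thesis unfolding S_def by auto
  qed
  define \<delta> where "\<delta> = Min S"
  have \<delta>: "0 < \<delta>" unfolding \<delta>_def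
  proof (subst Min_gr_iff[OF finS])
    show "S \<noteq> {}" by (auto simp: S_def)
    have "\<tau> w i \<noteq> \<tau> w j" if "i \<noteq> j" for i j
      using \<tau>_le_iff_index[of w i j] \<tau>_le_iff_index[of w j i] good_pos[OF g] that by auto
    then show "\<forall>a\<in>S. 0 < a" using \<tau>_pos[of w] good_pos[OF g] k by (auto simp: S_def)
  qed
  have \<delta>_le: "\<delta> \<le> x" if "x \<in> S" for x unfolding \<delta>_def using finS that by (rule Min_le)
  have \<delta>1: "\<delta> \<le> \<tau> w j" "\<tau> w j + \<delta> \<le> T" if "j < k" for j
    using \<delta>_le[of "\<tau> w j"] \<delta>_le[of "T - \<tau> w j"] that by (auto simp: S_def)
  have \<delta>2: "\<delta> \<le> \<bar>\<tau> w i - \<tau> w j\<bar>" if "i < k" "j < k" "i \<noteq> j" for i j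
    using that by (intro \<delta>_le) (auto simp: S_def)
  have uc: "uniformly_continuous_on {-2*T..2*T} G" "uniformly_continuous_on {-2*T..2*T} \<kappa>"
    using cont_G cont_\<kappa> by (auto intro!: compact_uniformly_continuous intro: continuous_on_subset)
  show ?thesis
  proof (rule LIMSEQ_I)
    fix r :: real assume r: "0 < r"
    define e where "e = r / (2 * (real k + 1))"
    have e: "0 < e" using r by (simp add: e_def)
    obtain e1 where e1: "0 < e1" "\<And>x y. x \<in> {-2*T..2*T} \<Longrightarrow> y \<in> {-2*T..2*T} \<Longrightarrow> \<bar>x - y\<bar> < e1 \<Longrightarrow> \<bar>G x - G y\<bar> < e"
      using uc(1) e unfolding uniformly_continuous_on_def dist_real_def by metis
    obtain e2 where e2: "0 < e2" "\<And>x y. x \<in> {-2*T..2*T} \<Longrightarrow> y \<in> {-2*T..2*T} \<Longrightarrow> \<bar>x - y\<bar> < e2 \<Longrightarrow> \<bar>\<kappa> x - \<kappa> y\<bar> < e"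
      using uc(2) e unfolding uniformly_continuous_on_def dist_real_def by metis
    have "\<forall>\<^sub>F n in sequentially. 0 < n \<and> 0 < c n"
      using eventually_gt_at_top[of 0] order_tendstoD(1)[OF c, of 0] by (auto intro: eventually_conj)
    moreover have "\<forall>\<^sub>F n in sequentially. D n < min \<delta> (min e (min e1 e2 / 4))"
      using \<delta> e e1 e2 by (intro order_tendstoD(2)[OF D]) auto
    moreover have "\<forall>\<^sub>F n in sequentially. grid T n 1 < min T (min e1 e2 / 4)"
      using T e1 e2 by (intro order_tendstoD(2)[OF tendsto_grid_1]) auto
    moreover have "\<forall>\<^sub>F n in sequentially. T < v n k" using k(1) by (intro order_tendstoD(1)[OF v])
    moreover have "\<forall>\<^sub>F n in sequentially. \<forall>j\<in>{..<k}. v n j < T"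
      using k(2) by (intro eventually_ball_finite ballI order_tendstoD(2)[OF v]) auto
    ultimately have "\<forall>\<^sub>F n in sequentially. norm (skorokhod_dist T (scheme_path n (jump_bit n (c n) w)) (limit_path w) - 0) < r"
    proof eventually_elim
      case (elim n)
      note n = elim(1)[THEN conjunct1] and cn = elim(1)[THEN conjunct2]
      have Dn: "D n < \<delta>" "D n < e" "D n < e1 / 4" "D n < e2 / 4" using elim(2) by auto
      have g1: "grid T n 1 < T" "grid T n 1 < e1 / 4" "grid T n 1 < e2 / 4" "0 \<le> grid T n 1" using elim(3) grid_nonneg by auto
      have vk: "v n j < T" if "j < k" for j using elim(5) that by auto
      have v0: "0 \<le> v n j" for j unfolding v_def by (rule grid_nonneg)
      have dj: "\<bar>v n j - \<tau> w j\<bar> \<le> D n" if "j < k" for j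
        unfolding D_def using that by (intro member_le_sum) auto
      have "(\<Sum>j<k. \<bar>v n j - \<tau> w j\<bar>) < \<delta>" using Dn(1) by (simp add: D_def)
      then obtain u where u: "u \<in> time_changes T" "\<And>j. j < k \<Longrightarrow> u (\<tau> w j) = \<tau> w j + (v n j - \<tau> w j)"
          "\<And>t. \<bar>u t - t\<bar> \<le> D n"
        unfolding D_def
        using time_change_exists[where p = "\<tau> w" and d = "\<lambda>j. v n j - \<tau> w j", OF \<delta> \<delta>1(1) \<delta>1(2) \<delta>2 _ T] by blast
      have "skorokhod_dist T (scheme_path n (jump_bit n (c n) w)) (limit_path w) \<le> (real k + 1) * e"
      proof (rule skorokhod_dist_le[OF T scheme_path_skorokhod[OF n] limit_path_skorokhod[OF g] u(1)])
        fix t assume t: "t \<in> {0..T}"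
        have "1 * e \<le> (real k + 1) * e" using e by (intro mult_right_mono) auto
        then show "\<bar>u t - t\<bar> \<le> (real k + 1) * e" using u(3)[of t] Dn(2) by simp
        define s where "s = u t"
        have s: "s \<in> {0..T}" unfolding s_def by (rule time_changesD[OF u(1) t])
        define m where "m = steps T n s"
        have gm: "grid T n m \<le> s" using steps_le_iff[OF n T, of s m] s by (simp add: m_def)
        have "\<not> Suc m \<le> steps T n s" by (simp add: m_def)
        then have gm': "s < grid T n m + grid T n 1" using steps_le_iff[OF n T, of s "Suc m"] s grid_add[of n m 1] by simp
        have mK: "m < jump_cell n (c n) w (Suc k)"
        proof -
          have "grid T n m < grid T n (jump_cell n (c n) w (Suc k))" using gm s elim(4) unfolding v_def by simp
          then show ?thesis using grid_less_iff[OF n] by blast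
        qed
        have v_le: "jump_cell n (c n) w (Suc j) \<le> m \<longleftrightarrow> \<tau> w j \<le> t" if "j < k" for j
        proof -
          have tj: "\<tau> w j \<in> {0..T}" using \<tau>_nonneg k(2)[OF that] by simp
          have "jump_cell n (c n) w (Suc j) \<le> m \<longleftrightarrow> v n j \<le> s"
            unfolding m_def v_def using s by (intro steps_le_iff[OF n T]) simp
          also have "\<dots> \<longleftrightarrow> u (\<tau> w j) \<le> u t" using u(2)[OF that] by (simp add: s_def)
          also have "\<dots> \<longleftrightarrow> \<tau> w j \<le> t"
            using u(1) tj t unfolding time_changes_def by (auto simp: strict_mono_on_less_eq)
          finally show ?thesis .
        qed
        have tk: "t < \<tau> w k" using t k(1) by simp
        have N: "(\<Sum>i<m. real (jump_bit n (c n) w i)) = count w t"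
        proof -
          have "(\<Sum>i<m. 1 * real (jump_bit n (c n) w i)) = (\<Sum>l<k. if jump_cell n (c n) w (Suc l) \<le> m then 1 else 0)"
            by (rule sum_jump_bit_le[OF n cn mK])
          also have "\<dots> = counted w k t" unfolding counted_def using v_le by (intro sum.cong) auto
          also have "\<dots> = count w t" using count_eq(1)[of w t k k] good_pos[OF g] tk by simp
          finally show ?thesis by simp
        qed
        have L: "(\<Sum>i<m. cell_hazard n (jump_bit n (c n) w) i + \<kappa> (grid T n 1) * real (jump_bit n (c n) w i)) =
          G (grid T n m) + (\<Sum>j<k. \<kappa> (grid T n m - v n j + grid T n 1))"
        proof -
          have "(\<Sum>j<m. \<kappa> (grid T n (m - j)) * real (jump_bit n (c n) w j)) =
            (\<Sum>j<k. if jump_cell n (c n) w (Suc j) \<le> m then \<kappa> (grid T n (m - (jump_cell n (c n) w (Suc j) - 1))) else 0)"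
            by (rule sum_jump_bit_le[OF n cn mK])
          also have "\<dots> = (\<Sum>j<k. \<kappa> (grid T n m - v n j + grid T n 1))"
          proof (intro sum.cong refl)
            fix j assume "j \<in> {..<k}"
            show "(if jump_cell n (c n) w (Suc j) \<le> m then \<kappa> (grid T n (m - (jump_cell n (c n) w (Suc j) - 1))) else 0) =
              \<kappa> (grid T n m - v n j + grid T n 1)"
            proof (cases "jump_cell n (c n) w (Suc j) \<le> m")
              case True
              have "0 < jump_cell n (c n) w (Suc j)" using jump_cell_less_iff[OF n cn, of w 0 "Suc j"] by simp
              then have e: "m - (jump_cell n (c n) w (Suc j) - 1) = m - jump_cell n (c n) w (Suc j) + 1" using True by simp
              show ?thesis unfolding e grid_add grid_diff[OF True] v_def using True by simp
            next
              case False
              then have "grid T n (m + 1) \<le> v n j" unfolding v_def by (intro grid_mono) simp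
              then have "grid T n m - v n j + grid T n 1 \<le> 0" unfolding grid_add by simp
              then show ?thesis using False by (simp only: \<kappa>_neg if_False)
            qed
          qed
          finally show ?thesis unfolding sum_cell_hazard by simp
        qed
        have near: "\<bar>grid T n m - t\<bar> \<le> grid T n 1 + D n" using gm gm' u(3)[of t] unfolding s_def by linarith
        have gmT: "0 \<le> grid T n m" "grid T n m \<le> T" using gm s grid_nonneg by auto
        have dG: "\<bar>G (grid T n m) - G t\<bar> \<le> e"
          using near Dn g1 t gmT T by (intro less_imp_le e1(2)) auto
        have d\<kappa>: "\<bar>\<kappa> (grid T n m - v n j + grid T n 1) - \<kappa> (t - \<tau> w j)\<bar> \<le> e" if "j < k" for j
        proof (intro less_imp_le e2(2))
          show "grid T n m - v n j + grid T n 1 \<in> {-2*T..2*T}" using gmT vk[OF that] v0[of j] g1 T by auto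
          show "t - \<tau> w j \<in> {-2*T..2*T}" using t k(2)[OF that] \<tau>_nonneg[of w j] T by auto
          have "\<bar>(grid T n m - v n j + grid T n 1) - (t - \<tau> w j)\<bar> \<le> \<bar>grid T n m - t\<bar> + \<bar>v n j - \<tau> w j\<bar> + grid T n 1"
            using g1(4) by linarith
          also have "\<dots> < e2" using near dj[OF that] Dn g1 by linarith
          finally show "\<bar>(grid T n m - v n j + grid T n 1) - (t - \<tau> w j)\<bar> < e2" .
        qed
        have Lt: "Lam w t = G t + (\<Sum>j<k. \<kappa> (t - \<tau> w j))"
          using count_eq(2)[of w t k k] good_pos[OF g] tk by (simp add: compensator_def)
        have "\<bar>(G (grid T n m) + (\<Sum>j<k. \<kappa> (grid T n m - v n j + grid T n 1))) - Lam w t\<bar>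
          \<le> \<bar>G (grid T n m) - G t\<bar> + (\<Sum>j<k. \<bar>\<kappa> (grid T n m - v n j + grid T n 1) - \<kappa> (t - \<tau> w j)\<bar>)"
        proof -
          have "\<bar>\<Sum>j<k. \<kappa> (grid T n m - v n j + grid T n 1) - \<kappa> (t - \<tau> w j)\<bar> \<le> (\<Sum>j<k. \<bar>\<kappa> (grid T n m - v n j + grid T n 1) - \<kappa> (t - \<tau> w j)\<bar>)"
            by (rule sum_abs)
          then show ?thesis unfolding Lt sum_subtractf by linarith
        qed
        also have "\<dots> \<le> e + real k * e"
          using dG sum_bounded_above[of "{..<k}" "\<lambda>j. \<bar>\<kappa> (grid T n m - v n j + grid T n 1) - \<kappa> (t - \<tau> w j)\<bar>" e] d\<kappa> by simp
        finally have "\<bar>(G (grid T n m) + (\<Sum>j<k. \<kappa> (grid T n m - v n j + grid T n 1))) - Lam w t\<bar> \<le> (real k + 1) * e"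
          by (simp add: algebra_simps)
        moreover have "scheme_path n (jump_bit n (c n) w) (u t) = (G (grid T n m) + (\<Sum>j<k. \<kappa> (grid T n m - v n j + grid T n 1)), count w t)"
          using s L N unfolding s_def[symmetric] by (simp add: scheme_path_def m_def[symmetric])
        moreover have "limit_path w t = (Lam w t, count w t)" using t by (simp add: limit_path_def)
        ultimately show "dist (scheme_path n (jump_bit n (c n) w) (u t)) (limit_path w t) \<le> (real k + 1) * e"
          by (simp add: dist_prod_def dist_real_def)
      qed
      also have "(real k + 1) * e = r / 2" unfolding e_def by (simp add: field_simps add_nonneg_eq_0_iff)
      also have "r / 2 < r" using r by simp
      finally show ?case using skorokhod_dist_nonneg[OF T, of "scheme_path n (jump_bit n (c n) w)" "limit_path w"] by simp
    qed
    then show "\<exists>N. \<forall>n\<ge>N. norm (skorokhod_dist T (scheme_path n (jump_bit n (c n) w)) (limit_path w) - 0) < r"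
      by (simp add: eventually_sequentially)
  qed
qed

end

section \<open>Measurability and comparison of laws\<close>

lemma measurable_borel_sigma:
  assumes "\<And>w. w \<in> space M \<Longrightarrow> f w \<in> topspace X"
    and "\<And>U. openin X U \<Longrightarrow> {w\<in>space M. f w \<in> U} \<in> sets M"
  shows "f \<in> M \<rightarrow>\<^sub>M borel_sigma X"
  unfolding borel_sigma_def
proof (rule measurable_measure_of)
  show "{U. openin X U} \<subseteq> Pow (topspace X)" using openin_subset by blast
  show "f \<in> space M \<rightarrow> topspace X" using assms(1) by blast
  fix U assume "U \<in> {U. openin X U}"
  moreover have "f -` U \<inter> space M = {w\<in>space M. f w \<in> U}" by auto
  ultimately show "f -` U \<inter> space M \<in> sets M" using assms(2) by simp
qed

lemma sets_borel_sigmaI: "openin X U \<Longrightarrow> U \<in> sets (borel_sigma X)"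
  unfolding borel_sigma_def
proof (rule in_measure_of)
  show "{U. openin X U} \<subseteq> Pow (topspace X)" using openin_subset by blast
qed simp

lemma continuous_map_borel_sigma:
  assumes "continuous_map X euclideanreal f"
  shows "f \<in> borel_measurable (borel_sigma X)"
proof (rule borel_measurableI)
  fix S :: "real set" assume "open S"
  then have "openin X {x\<in>topspace X. f x \<in> S}" using assms by (simp add: continuous_map_def)
  moreover have "f -` S \<inter> space (borel_sigma X) = {x\<in>topspace X. f x \<in> S}"
    by (auto simp: borel_sigma_def space_measure_of_conv)
  ultimately show "f -` S \<inter> space (borel_sigma X) \<in> sets (borel_sigma X)"
    by (simp add: sets_borel_sigmaI)
qed

text \<open>A limit belongs to the open set \<open>U\<close> iff the sequence eventually stays at some fixed distance from the
  complement of \<open>U\<close>.\<close>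

lemma (in Metric_space) limit_preimage_in_sets:
  fixes Z :: "'w \<Rightarrow> 'a"
  assumes U: "openin mtopology U"
    and Zn: "\<And>n W. {w\<in>space P. Zn n w \<in> W} \<in> sets P"
    and ZnM: "\<And>n w. Zn n w \<in> M" and ZM: "\<And>w. Z w \<in> M"
    and lim: "\<And>w. (\<lambda>n. d (Zn n w) (Z w)) \<longlonglongrightarrow> 0"
  shows "{w\<in>space P. Z w \<in> U} \<in> sets P"
proof -
  define F where "F m = {x\<in>M. \<forall>y\<in>M - U. 1 / (real m + 1) \<le> d x y}" for m :: nat
  have "{w\<in>space P. Z w \<in> U} = (\<Union>m. \<Union>N. \<Inter>n. {w\<in>space P. Zn (N + n) w \<in> F m})"
  proof (intro set_eqI iffI)
    fix w assume "w \<in> {w\<in>space P. Z w \<in> U}"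
    then have w: "w \<in> space P" "Z w \<in> U" by auto
    then obtain r where r: "r > 0" "mball (Z w) r \<subseteq> U" using U by (auto simp: openin_mtopology)
    obtain m where m: "1 / (real m + 1) < r / 2" using r(1) nat_approx_posE[of "r / 2"] by (auto simp: add.commute)
    have "\<forall>\<^sub>F n in sequentially. d (Zn n w) (Z w) < r / 2" using r by (intro order_tendstoD(2)[OF lim]) auto
    then obtain N where N: "\<And>n. n \<ge> N \<Longrightarrow> d (Zn n w) (Z w) < r / 2" by (auto simp: eventually_sequentially)
    have "Zn (N + n) w \<in> F m" for n
      unfolding F_def
    proof (intro CollectI conjI ballI ZnM)
      fix y assume y: "y \<in> M - U"
      then have "y \<notin> mball (Z w) r" using r(2) by blast
      then have "r \<le> d (Z w) y" using y ZM by (auto simp: in_mball)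
      also have "\<dots> \<le> d (Z w) (Zn (N + n) w) + d (Zn (N + n) w) y" using y ZM ZnM by (intro triangle) auto
      finally show "1 / (real m + 1) \<le> d (Zn (N + n) w) y" using N[of "N + n"] m by (simp add: commute)
    qed
    then show "w \<in> (\<Union>m. \<Union>N. \<Inter>n. {w\<in>space P. Zn (N + n) w \<in> F m})" using w by blast
  next
    fix w assume "w \<in> (\<Union>m. \<Union>N. \<Inter>n. {w\<in>space P. Zn (N + n) w \<in> F m})"
    then obtain m N where mN: "w \<in> space P" "\<And>n. Zn (N + n) w \<in> F m" by auto
    have "Z w \<in> U"
    proof (rule ccontr)
      assume "Z w \<notin> U"
      then have *: "1 / (real m + 1) \<le> d (Zn (N + n) w) (Z w)" for n using mN(2)[of n] ZM unfolding F_def by blast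
      have "\<forall>\<^sub>F n in sequentially. d (Zn n w) (Z w) < 1 / (real m + 1)" by (intro order_tendstoD(2)[OF lim]) auto
      then obtain N' where "\<And>n. n \<ge> N' \<Longrightarrow> d (Zn n w) (Z w) < 1 / (real m + 1)" by (auto simp: eventually_sequentially)
      from this[of "N + N'"] *[of N'] show False by simp
    qed
    then show "w \<in> {w\<in>space P. Z w \<in> U}" using mN by simp
  qed
  also have "\<dots> \<in> sets P" using Zn by (intro sets.countable_UN sets.countable_INT image_subsetI) auto
  finally show ?thesis .
qed

lemma one_minus_prod_le:
  fixes y :: "nat \<Rightarrow> real"
  assumes "\<And>j. 0 \<le> y j" "\<And>j. y j \<le> 1"
  shows "1 - (\<Prod>j<n. y j) \<le> (\<Sum>j<n. 1 - y j)"
proof (induction n)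
  case (Suc n)
  have P: "0 \<le> (\<Prod>j<n. y j)" "(\<Prod>j<n. y j) \<le> 1" using assms by (auto intro: prod_nonneg prod_le_1)
  have "(\<Prod>j<n. y j) * (1 - y n) \<le> 1 * (1 - y n)" using P assms by (intro mult_right_mono) auto
  then show ?case using Suc by (simp add: algebra_simps)
qed simp

text \<open>The 0/1 patterns of the first \<open>n\<close> cells, extended by 0 to make them unique.\<close>

definition configs :: "nat \<Rightarrow> (nat \<Rightarrow> nat) set" where
  "configs n = {b. \<forall>j. (j \<in> {..<n} \<longrightarrow> b j \<in> {0, 1}) \<and> (j \<notin> {..<n} \<longrightarrow> b j = 0)}"

lemma finite_configs: "finite (configs n)"
  unfolding configs_def by (rule finite_set_of_finite_funs) auto

lemma configs_le: "b \<in> configs n \<Longrightarrow> b j \<le> 1"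
  unfolding configs_def by (cases "j < n") auto

lemma configs_unique:
  assumes "b \<in> configs n" "b' \<in> configs n" "\<And>j. j < n \<Longrightarrow> b j = b' j" shows "b = b'"
proof
  fix j show "b j = b' j" using assms unfolding configs_def by (cases "j < n") auto
qed

lemma sum_configs_indicator:
  fixes h :: "(nat \<Rightarrow> nat) \<Rightarrow> real"
  assumes h: "\<And>b b'. (\<And>j. j < n \<Longrightarrow> b j = b' j) \<Longrightarrow> h b = h b'"
  shows "(\<Sum>b\<in>configs n. h b * indicator {w. \<forall>j<n. x w j = b j} w) = (if \<forall>j<n. x w j \<le> 1 then h (x w) else 0)"
proof (cases "\<forall>j<n. x w j \<le> 1")
  case True
  define b where "b j = (if j < n then x w j else 0)" for j
  have b: "b \<in> configs n" using True by (auto simp: b_def configs_def le_Suc_eq)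
  have "h b' * indicator {w. \<forall>j<n. x w j = b' j} w = (if b' = b then h (x w) else 0)" if "b' \<in> configs n" for b'
  proof (cases "b' = b")
    case True
    have "h b = h (x w)" by (rule h) (simp add: b_def)
    then show ?thesis using True by (simp add: b_def indicator_def)
  next
    case False
    then have "\<not> (\<forall>j<n. x w j = b' j)" using configs_unique[OF b that] by (auto simp: b_def)
    then show ?thesis using False by (simp add: indicator_def)
  qed
  then have "(\<Sum>b'\<in>configs n. h b' * indicator {w. \<forall>j<n. x w j = b' j} w) = (\<Sum>b'\<in>configs n. if b' = b then h (x w) else 0)"
    by (rule sum.cong[OF refl])
  also have "\<dots> = h (x w)" using b finite_configs by simp
  finally show ?thesis using True by simp
next
  case False
  then have "indicator {w. \<forall>j<n. x w j = b j} w = (0::real)" if "b \<in> configs n" for b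
    using configs_le[OF that] False by (auto simp: indicator_def)
  then have "(\<Sum>b\<in>configs n. h b * indicator {w. \<forall>j<n. x w j = b j} w) = 0"
    by (intro sum.neutral) simp
  then show ?thesis using False by (simp only: if_False)
qed

text \<open>If every 0/1 pattern has under the first law at least \<open>\<rho>\<close> times its probability under the second one,
  expectations of nonnegative functions compare accordingly. Patterns with larger values under the first
  law only help.\<close>

lemma expectation_comparison:
  fixes x :: "'a \<Rightarrow> nat \<Rightarrow> nat" and y :: "'c \<Rightarrow> nat \<Rightarrow> nat" and h \<rho> :: "(nat \<Rightarrow> nat) \<Rightarrow> real"
  assumes M: "prob_space M" and P: "prob_space P"
    and x: "\<And>b. b \<in> configs n \<Longrightarrow> {w\<in>space M. \<forall>j<n. x w j = b j} \<in> sets M"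
    and y: "\<And>b. b \<in> configs n \<Longrightarrow> {w\<in>space P. \<forall>j<n. y w j = b j} \<in> sets P"
    and y01: "\<And>w j. y w j \<le> 1"
    and h: "\<And>b b'. (\<And>j. j < n \<Longrightarrow> b j = b' j) \<Longrightarrow> h b = h b'" "\<And>b. 0 \<le> h b"
    and \<rho>: "\<And>b b'. (\<And>j. j < n \<Longrightarrow> b j = b' j) \<Longrightarrow> \<rho> b = \<rho> b'"
    and int: "integrable M (\<lambda>w. h (x w))"
    and le: "\<And>b. b \<in> configs n \<Longrightarrow>
       \<rho> b * measure P {w\<in>space P. \<forall>j<n. y w j = b j} \<le> measure M {w\<in>space M. \<forall>j<n. x w j = b j}"
  shows "(\<integral>w. h (y w) * \<rho> (y w) \<partial>P) \<le> (\<integral>w. h (x w) \<partial>M)" "integrable P (\<lambda>w. h (y w) * \<rho> (y w))"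
proof -
  interpret M: prob_space M by fact
  interpret P: prob_space P by fact
  have Py: "h (y w) * \<rho> (y w) = (\<Sum>b\<in>configs n. h b * \<rho> b * indicator {w\<in>space P. \<forall>j<n. y w j = b j} w)" if "w \<in> space P" for w
  proof -
    have "h (y w) * \<rho> (y w) = (\<Sum>b\<in>configs n. (h b * \<rho> b) * indicator {w. \<forall>j<n. y w j = b j} w)"
    proof -
      have h\<rho>: "h b * \<rho> b = h b' * \<rho> b'" if "\<And>j. j < n \<Longrightarrow> b j = b' j" for b b'
        using h(1)[of b b'] \<rho>[of b b'] that by presburger
      show ?thesis
        using sum_configs_indicator[where h = "\<lambda>b. h b * \<rho> b" and x = y and n = n and w = w, OF h\<rho>] y01[of w] by presburger
    qed
    also have "\<dots> = (\<Sum>b\<in>configs n. h b * \<rho> b * indicator {w\<in>space P. \<forall>j<n. y w j = b j} w)"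
      using that by (intro sum.cong refl arg_cong2[where f = "(*)"]) (auto simp: indicator_def)
    finally show ?thesis .
  qed
  have iP: "integrable P (indicator {w\<in>space P. \<forall>j<n. y w j = b j} :: _ \<Rightarrow> real)" if "b \<in> configs n" for b
    by (rule integrable_real_indicator[OF y[OF that]]) (simp only: P.emeasure_eq_measure ennreal_less_top infinity_ennreal_def)
  have iM: "integrable M (indicator {w\<in>space M. \<forall>j<n. x w j = b j} :: _ \<Rightarrow> real)" if "b \<in> configs n" for b
    by (rule integrable_real_indicator[OF x[OF that]]) (simp only: M.emeasure_eq_measure ennreal_less_top infinity_ennreal_def)
  have vP: "(\<integral>w. indicator {w\<in>space P. \<forall>j<n. y w j = b j} w \<partial>P) = measure P {w\<in>space P. \<forall>j<n. y w j = b j}" for b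
    unfolding Bochner_Integration.integral_indicator by (intro arg_cong[where f = "measure P"]) blast
  have vM: "(\<integral>w. indicator {w\<in>space M. \<forall>j<n. x w j = b j} w \<partial>M) = measure M {w\<in>space M. \<forall>j<n. x w j = b j}" for b
    unfolding Bochner_Integration.integral_indicator by (intro arg_cong[where f = "measure M"]) blast
  have "integrable P (\<lambda>w. \<Sum>b\<in>configs n. h b * \<rho> b * indicator {w\<in>space P. \<forall>j<n. y w j = b j} w)"
    by (intro Bochner_Integration.integrable_sum integrable_mult_right iP)
  then show "integrable P (\<lambda>w. h (y w) * \<rho> (y w))"
    by (subst Bochner_Integration.integrable_cong[OF refl Py])
  have "(\<integral>w. h (y w) * \<rho> (y w) \<partial>P) = (\<integral>w. (\<Sum>b\<in>configs n. h b * \<rho> b * indicator {w\<in>space P. \<forall>j<n. y w j = b j} w) \<partial>P)"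
    by (rule Bochner_Integration.integral_cong[OF refl Py])
  also have "\<dots> = (\<Sum>b\<in>configs n. h b * \<rho> b * measure P {w\<in>space P. \<forall>j<n. y w j = b j})"
    by (subst Bochner_Integration.integral_sum; (intro integrable_mult_right iP | simp only: integral_mult_right_zero vP))
  also have "\<dots> \<le> (\<Sum>b\<in>configs n. h b * measure M {w\<in>space M. \<forall>j<n. x w j = b j})"
    unfolding mult.assoc by (intro sum_mono mult_left_mono le h(2))
  also have "\<dots> = (\<integral>w. (\<Sum>b\<in>configs n. h b * indicator {w\<in>space M. \<forall>j<n. x w j = b j} w) \<partial>M)"
    by (subst Bochner_Integration.integral_sum; (intro integrable_mult_right iM | simp only: integral_mult_right_zero vM))
  also have "\<dots> \<le> (\<integral>w. h (x w) \<partial>M)"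
  proof (rule integral_mono[OF _ int])
    show "integrable M (\<lambda>w. \<Sum>b\<in>configs n. h b * indicator {w\<in>space M. \<forall>j<n. x w j = b j} w)"
      by (intro Bochner_Integration.integrable_sum integrable_mult_right iM)
    fix w assume w: "w \<in> space M"
    have "(\<Sum>b\<in>configs n. h b * indicator {w\<in>space M. \<forall>j<n. x w j = b j} w) = (\<Sum>b\<in>configs n. h b * indicator {w. \<forall>j<n. x w j = b j} w)"
      using w by (intro sum.cong refl arg_cong2[where f = "(*)"]) (auto simp: indicator_def)
    also have "\<dots> \<le> h (x w)"
    proof -
      have "(\<Sum>b\<in>configs n. h b * indicator {w. \<forall>j<n. x w j = b j} w) = (if \<forall>j<n. x w j \<le> 1 then h (x w) else 0)"
        by (rule sum_configs_indicator) (rule h(1))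
      also have "\<dots> \<le> h (x w)" by (rule if_split[where P = "\<lambda>z. z \<le> h (x w)", THEN iffD2]) (intro conjI impI order_refl h(2))
      finally show ?thesis .
    qed
    finally show "(\<Sum>b\<in>configs n. h b * indicator {w\<in>space M. \<forall>j<n. x w j = b j} w) \<le> h (x w)" .
  qed
  finally show "(\<integral>w. h (y w) * \<rho> (y w) \<partial>P) \<le> (\<integral>w. h (x w) \<partial>M)" .
qed

context hawkes_clock
begin

lemma jump_bit_le: "jump_bit n c w j \<le> 1"
  by (simp add: jump_bit_def)

lemma scheme_path_cong:
  assumes n: "0 < n" and b: "\<And>j. j < n \<Longrightarrow> b j = b' j"
  shows "scheme_path n b = scheme_path n b'"
  unfolding scheme_path_def
proof (rule restrict_ext)
  fix t assume t: "t \<in> {0..T}"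
  have "b j = b' j" if "j < steps T n t" for j using steps_le[OF n T t] that b by simp
  then show "(\<Sum>i<steps T n t. cell_hazard n b i + \<kappa> (grid T n 1) * real (b i), \<Sum>i<steps T n t. real (b i)) =
    (\<Sum>i<steps T n t. cell_hazard n b' i + \<kappa> (grid T n 1) * real (b' i), \<Sum>i<steps T n t. real (b' i))"
    by (auto intro!: sum.cong arg_cong2[where f = "(+)"] cell_hazard_cong)
qed

lemma jump_bit_path_sets:
  assumes n: "0 < n" and c: "0 < c"
  shows "{w. scheme_path n (jump_bit n c w) \<in> W} \<in> sets clocks"
proof -
  have "{w. scheme_path n (jump_bit n c w) \<in> W} = (\<Union>b\<in>{b\<in>configs n. scheme_path n b \<in> W}. {w. \<forall>j<n. jump_bit n c w j = b j})"
  proof (intro set_eqI iffI)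
    fix w assume in_W: "w \<in> {w. scheme_path n (jump_bit n c w) \<in> W}"
    define b where "b j = (if j < n then jump_bit n c w j else 0)" for j
    have "b \<in> configs n" using jump_bit_le[of n c w] by (auto simp: b_def configs_def jump_bit_def)
    moreover have "scheme_path n b = scheme_path n (jump_bit n c w)" by (rule scheme_path_cong[OF n]) (simp add: b_def)
    ultimately show "w \<in> (\<Union>b\<in>{b\<in>configs n. scheme_path n b \<in> W}. {w. \<forall>j<n. jump_bit n c w j = b j})"
      using in_W by (auto simp: b_def intro!: bexI[of _ b])
  next
    fix w assume "w \<in> (\<Union>b\<in>{b\<in>configs n. scheme_path n b \<in> W}. {w. \<forall>j<n. jump_bit n c w j = b j})"
    then obtain b where b: "scheme_path n b \<in> W" "\<And>j. j < n \<Longrightarrow> jump_bit n c w j = b j" by auto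
    have "scheme_path n (jump_bit n c w) = scheme_path n b" by (rule scheme_path_cong[OF n b(2)])
    then show "w \<in> {w. scheme_path n (jump_bit n c w) \<in> W}" using b by simp
  qed
  also have "\<dots> \<in> sets clocks"
  proof (rule sets.finite_UN)
    show "finite {b \<in> configs n. scheme_path n b \<in> W}" using finite_configs by simp
    fix b assume "b \<in> {b \<in> configs n. scheme_path n b \<in> W}"
    then have "\<And>j. b j \<le> 1" using configs_le by blast
    then show "{w. \<forall>j<n. jump_bit n c w j = b j} \<in> sets clocks" by (rule jump_bit_prob(1)[OF n c])
  qed
  finally show ?thesis .
qed

abbreviation "J1 \<equiv> (J1_topology T :: (real \<Rightarrow> real \<times> real) topology)"

lemma topspace_J1: "topspace J1 = skorokhod_space T"
proof -
  interpret Metric_space "skorokhod_space T :: (real \<Rightarrow> real \<times> real) set" "skorokhod_dist T"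
    by (rule Metric_space_skorokhod[OF T])
  show ?thesis unfolding J1_topology_def by simp
qed

lemma measurable_jump_bit_path:
  assumes "0 < n" "0 < c"
  shows "(\<lambda>w. scheme_path n (jump_bit n c w)) \<in> clocks \<rightarrow>\<^sub>M borel_sigma J1"
  using jump_bit_path_sets[OF assms] scheme_path_skorokhod[OF assms(1)]
  by (intro measurable_borel_sigma) (auto simp: topspace_J1)

text \<open>The limit is the pointwise limit of grid processes, each of which has only finitely many possible
  paths.\<close>

lemma measurable_limit_path: "(\<lambda>w. limit_path (regularised w)) \<in> clocks \<rightarrow>\<^sub>M borel_sigma J1"
proof (rule measurable_borel_sigma)
  show "limit_path (regularised w) \<in> topspace J1" for w using limit_path_skorokhod[OF good_regularised] by (simp add: topspace_J1)
  interpret Metric_space "skorokhod_space T :: (real \<Rightarrow> real \<times> real) set" "skorokhod_dist T"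
    by (rule Metric_space_skorokhod[OF T])
  fix U assume "openin J1 U"
  then have U: "openin mtopology U" by (simp add: J1_topology_def)
  show "{w\<in>space clocks. limit_path (regularised w) \<in> U} \<in> sets clocks"
  proof (rule limit_preimage_in_sets[OF U, where Zn = "\<lambda>n w. scheme_path (Suc n) (jump_bit (Suc n) 1 (regularised w))"])
    show "{w\<in>space clocks. scheme_path (Suc n) (jump_bit (Suc n) 1 (regularised w)) \<in> W} \<in> sets clocks" for n W
    proof -
      have "{w\<in>space clocks. scheme_path (Suc n) (jump_bit (Suc n) 1 (regularised w)) \<in> W} = regularised -` {w. scheme_path (Suc n) (jump_bit (Suc n) 1 w) \<in> W} \<inter> space clocks" by auto
      also have "\<dots> \<in> sets clocks" by (rule measurable_sets[OF meas_regularised jump_bit_path_sets]) auto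
      finally show ?thesis .
    qed
    show "(\<lambda>n. skorokhod_dist T (scheme_path (Suc n) (jump_bit (Suc n) 1 (regularised w))) (limit_path (regularised w))) \<longlonglongrightarrow> 0" for w
      using LIMSEQ_Suc[OF J1_convergence[OF good_regularised, of "\<lambda>_. 1"]] by simp
  qed (auto intro: scheme_path_skorokhod limit_path_skorokhod good_regularised)
qed

lemma jump_bit_path_expectation:
  assumes f: "continuous_map J1 euclideanreal f" and B: "\<And>x. x \<in> skorokhod_space T \<Longrightarrow> \<bar>f x\<bar> \<le> B"
    and c: "c \<longlonglongrightarrow> 1"
  shows "(\<lambda>n. \<integral>w. f (scheme_path n (jump_bit n (c n) w)) \<partial>clocks) \<longlonglongrightarrow> (\<integral>w. f (limit_path (regularised w)) \<partial>clocks)"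
proof -
  interpret Metric_space "skorokhod_space T :: (real \<Rightarrow> real \<times> real) set" "skorokhod_dist T"
    by (rule Metric_space_skorokhod[OF T])
  have "\<forall>\<^sub>F n in sequentially. 0 < n \<and> 0 < c n"
    using eventually_gt_at_top[of 0] order_tendstoD(1)[OF c, of 0] by (auto intro: eventually_conj)
  then obtain N where N: "\<And>n. n \<ge> N \<Longrightarrow> 0 < n \<and> 0 < c n" by (auto simp: eventually_sequentially)
  note mf = continuous_map_borel_sigma[OF f]
  have "(\<lambda>n. \<integral>w. f (scheme_path (n + N) (jump_bit (n + N) (c (n + N)) w)) \<partial>clocks) \<longlonglongrightarrow> (\<integral>w. f (limit_path (regularised w)) \<partial>clocks)"
  proof (rule integral_dominated_convergence[where w = "\<lambda>_. B"])
    show "(\<lambda>w. f (limit_path (regularised w))) \<in> borel_measurable clocks"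
      by (rule measurable_compose[OF measurable_limit_path mf])
    show "(\<lambda>w. f (scheme_path (n + N) (jump_bit (n + N) (c (n + N)) w))) \<in> borel_measurable clocks" for n
      using N[of "n + N"] by (intro measurable_compose[OF measurable_jump_bit_path mf]) auto
    show "AE w in clocks. norm (f (scheme_path (n + N) (jump_bit (n + N) (c (n + N)) w))) \<le> B" for n
      using B scheme_path_skorokhod N[of "n + N"] by auto
    show "AE w in clocks. (\<lambda>n. f (scheme_path (n + N) (jump_bit (n + N) (c (n + N)) w))) \<longlonglongrightarrow> f (limit_path (regularised w))"
      using AE_good
    proof eventually_elim
      case (elim w)
      have "limitin mtopology (\<lambda>n. scheme_path (n + N) (jump_bit (n + N) (c (n + N)) w)) (limit_path w) sequentially"
        unfolding limitin_metric
      proof (intro conjI allI impI)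
        show "limit_path w \<in> skorokhod_space T" by (rule limit_path_skorokhod[OF elim])
        fix e :: real assume "e > 0"
        then have "\<forall>\<^sub>F n in sequentially. skorokhod_dist T (scheme_path (n + N) (jump_bit (n + N) (c (n + N)) w)) (limit_path w) < e"
          using LIMSEQ_ignore_initial_segment[OF J1_convergence[OF elim c], of N] by (intro order_tendstoD(2)) auto
        then show "\<forall>\<^sub>F n in sequentially. scheme_path (n + N) (jump_bit (n + N) (c (n + N)) w) \<in> skorokhod_space T \<and>
          skorokhod_dist T (scheme_path (n + N) (jump_bit (n + N) (c (n + N)) w)) (limit_path w) < e"
          by eventually_elim (use scheme_path_skorokhod N in simp)
      qed
      then have "limitin euclideanreal (f \<circ> (\<lambda>n. scheme_path (n + N) (jump_bit (n + N) (c (n + N)) w))) (f (limit_path w)) sequentially"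
        using f unfolding J1_topology_def by (intro continuous_map_limit)
      then show ?case by (simp add: regularised_eq[OF elim] o_def)
    qed
  qed simp
  then show ?thesis by (rule LIMSEQ_offset)
qed

text \<open>A lower bound for the ratio of the probabilities of a pattern under the scheme and under the grid
  process: for each jump, \<open>exp (- c * a) * (d * a)\<close> is compared with \<open>1 - exp (- c * a) \<le> c * a\<close>.\<close>

definition law_ratio :: "nat \<Rightarrow> real \<Rightarrow> real \<Rightarrow> (nat \<Rightarrow> nat) \<Rightarrow> real" where
  "law_ratio n c d b = (\<Prod>j<n. if b j = 0 then 1 else d / c * exp (- (c * cell_hazard n b j)))"

lemma law_ratio_factor:
  assumes "0 < c" "0 < d" "d \<le> c"
  shows "0 \<le> (if b j = 0 then 1 else d / c * exp (- (c * cell_hazard n b j)))"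
    "(if b j = 0 then 1 else d / c * exp (- (c * cell_hazard n b j))) \<le> 1"
proof -
  have "d / c \<le> 1" using assms by simp
  moreover have "exp (- (c * cell_hazard n b j)) \<le> 1" using assms cell_hazard_nonneg[of n b j] by simp
  ultimately have "d / c * exp (- (c * cell_hazard n b j)) \<le> 1" using assms by (intro mult_le_one) auto
  then show "0 \<le> (if b j = 0 then 1 else d / c * exp (- (c * cell_hazard n b j)))"
    "(if b j = 0 then 1 else d / c * exp (- (c * cell_hazard n b j))) \<le> 1" using assms by auto
qed

lemma law_ratio_bounds:
  assumes "0 < c" "0 < d" "d \<le> c"
  shows "0 \<le> law_ratio n c d b" "law_ratio n c d b \<le> 1"
  unfolding law_ratio_def using law_ratio_factor[OF assms] by (auto intro!: prod_nonneg prod_le_1)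

lemma law_ratio_cong: 
  assumes "\<And>j. j < n \<Longrightarrow> b j = b' j"
  shows "law_ratio n c d b = law_ratio n c d b'"
proof -
  have "cell_hazard n b j = cell_hazard n b' j" if "j < n" for j using assms that by (intro cell_hazard_cong) auto
  then show ?thesis unfolding law_ratio_def using assms by (intro prod.cong) auto
qed

lemma law_ratio_le:
  assumes "0 < c" "0 < d" "d \<le> c"
  shows "law_ratio n c d b * (\<Prod>j<n. if b j = 0 then exp (- (c * cell_hazard n b j)) else 1 - exp (- (c * cell_hazard n b j))) \<le>
    (\<Prod>j<n. exp (- (c * cell_hazard n b j)) * (if b j = 0 then 1 else d * cell_hazard n b j))"
  unfolding law_ratio_def prod.distrib[symmetric]
proof (intro prod_mono conjI)
  fix j assume "j \<in> {..<n}"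
  have a: "0 \<le> c * cell_hazard n b j" using assms cell_hazard_nonneg[of n b j] by simp
  then show "0 \<le> (if b j = 0 then 1 else d / c * exp (- (c * cell_hazard n b j))) *
     (if b j = 0 then exp (- (c * cell_hazard n b j)) else 1 - exp (- (c * cell_hazard n b j)))"
    using assms by (auto intro!: mult_nonneg_nonneg)
  have "1 - exp (- (c * cell_hazard n b j)) \<le> c * cell_hazard n b j" using exp_ge_add_one_self[of "- (c * cell_hazard n b j)"] by simp
  then have "d / c * exp (- (c * cell_hazard n b j)) * (1 - exp (- (c * cell_hazard n b j))) \<le> d / c * exp (- (c * cell_hazard n b j)) * (c * cell_hazard n b j)"
    using assms by (intro mult_left_mono) auto
  also have "\<dots> = exp (- (c * cell_hazard n b j)) * (d * cell_hazard n b j)" using assms by simp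
  finally show "(if b j = 0 then 1 else d / c * exp (- (c * cell_hazard n b j))) *
     (if b j = 0 then exp (- (c * cell_hazard n b j)) else 1 - exp (- (c * cell_hazard n b j))) \<le>
     exp (- (c * cell_hazard n b j)) * (if b j = 0 then 1 else d * cell_hazard n b j)" by simp
qed

text \<open>Only boundedly many cells contain jumps, and the hazard of such a cell is an increment of the
  accumulated hazard over a vanishing interval.\<close>

lemma law_ratio_tendsto_1:
  assumes g: "good w" and c: "c \<longlonglongrightarrow> 1" and d: "d \<longlonglongrightarrow> 1"
    and cd: "\<forall>\<^sub>F n in sequentially. 0 < c n \<and> 0 < d n \<and> d n \<le> c n"
  shows "(\<lambda>n. law_ratio n (c n) (d n) (jump_bit n (c n) w)) \<longlonglongrightarrow> 1"
proof -
  obtain k where k: "T < \<tau> w k" using number_of_jumps[OF g] by blast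
  define a where "a n l = grid_compensator n (c n) w l (jump_cell n (c n) w (Suc l)) - grid_compensator n (c n) w l (jump_cell n (c n) w (Suc l) - 1)" for n l
  define E where "E n = (\<Sum>l<k. \<bar>1 - d n / c n * exp (- (c n * a n l))\<bar>)" for n
  have ev: "\<forall>\<^sub>F n in sequentially. 0 < n \<and> 0 < c n \<and> 0 < d n \<and> d n \<le> c n"
    using eventually_gt_at_top[of 0] cd by (auto intro: eventually_conj)
  have a: "(\<lambda>n. a n l) \<longlonglongrightarrow> 0" for l
  proof -
    have "(\<lambda>n. grid T n (jump_cell n (c n) w (Suc l)) - grid T n 1) \<longlonglongrightarrow> \<tau> w l - 0"
      by (intro tendsto_diff tendsto_jump_cell[OF g c] tendsto_grid_1)
    moreover have "\<forall>\<^sub>F n in sequentially. grid T n (jump_cell n (c n) w (Suc l)) - grid T n 1 = grid T n (jump_cell n (c n) w (Suc l) - 1)"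
      using ev
    proof eventually_elim
      case (elim n)
      then have "1 \<le> jump_cell n (c n) w (Suc l)" using jump_cell_props(1)[of n "c n" w l] by linarith
      then show ?case by (simp add: grid_diff)
    qed
    ultimately have "(\<lambda>n. grid T n (jump_cell n (c n) w (Suc l) - 1)) \<longlonglongrightarrow> \<tau> w l"
      by (simp add: tendsto_cong)
    then have "(\<lambda>n. grid_compensator n (c n) w l (jump_cell n (c n) w (Suc l) - 1)) \<longlonglongrightarrow> compensator w l (\<tau> w l)"
      by (intro tendsto_grid_compensator tendsto_jump_cell[OF g c])
    moreover have "(\<lambda>n. grid_compensator n (c n) w l (jump_cell n (c n) w (Suc l))) \<longlonglongrightarrow> compensator w l (\<tau> w l)"
      by (intro tendsto_grid_compensator tendsto_jump_cell[OF g c])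
    ultimately show ?thesis unfolding a_def using tendsto_diff by fastforce
  qed
  have E: "E \<longlonglongrightarrow> 0"
  proof -
    have "E \<longlonglongrightarrow> (\<Sum>l<k. \<bar>1 - 1 / 1 * exp (- (1 * 0))\<bar>)"
      unfolding E_def by (intro tendsto_intros a c d) simp
    then show ?thesis by simp
  qed
  have "\<forall>\<^sub>F n in sequentially. T < grid T n (jump_cell n (c n) w (Suc k))"
    by (intro order_tendstoD(1)[OF tendsto_jump_cell[OF g c]] k)
  with ev have low: "\<forall>\<^sub>F n in sequentially. 1 - E n \<le> law_ratio n (c n) (d n) (jump_bit n (c n) w)"
  proof eventually_elim
    case (elim n)
    then have n: "0 < n" and cn: "0 < c n" and dn: "0 < d n" "d n \<le> c n" by auto
    have "grid T n n = T" using n by (simp add: grid_def)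
    then have nU: "n < jump_cell n (c n) w (Suc k)" using elim grid_less_iff[OF n] by metis
    let ?b = "jump_bit n (c n) w"
    have "1 - law_ratio n (c n) (d n) ?b \<le> (\<Sum>j<n. 1 - (if ?b j = 0 then 1 else d n / c n * exp (- (c n * cell_hazard n ?b j))))"
      unfolding law_ratio_def by (rule one_minus_prod_le) (use law_ratio_factor[OF cn dn] in blast)+
    also have "\<dots> = (\<Sum>j<n. (1 - d n / c n * exp (- (c n * cell_hazard n ?b j))) * real (?b j))"
      by (intro sum.cong) (auto simp: jump_bit_def)
    also have "\<dots> = (\<Sum>l<k. if jump_cell n (c n) w (Suc l) \<le> n then 1 - d n / c n * exp (- (c n * cell_hazard n ?b (jump_cell n (c n) w (Suc l) - 1))) else 0)"
      by (rule sum_jump_bit_le[OF n cn nU])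
    also have "\<dots> \<le> E n" unfolding E_def
    proof (rule sum_mono)
      fix l
      have lt: "jump_cell n (c n) w l < jump_cell n (c n) w (Suc l)" by (rule jump_cell_props(1)[OF n cn])
      have "cell_hazard n ?b (jump_cell n (c n) w (Suc l) - 1) = grid_compensator n (c n) w l (Suc (jump_cell n (c n) w (Suc l) - 1)) - grid_compensator n (c n) w l (jump_cell n (c n) w (Suc l) - 1)"
        by (rule cell_hazard_jump_bit[OF n cn]) (use lt in auto)
      then have "cell_hazard n ?b (jump_cell n (c n) w (Suc l) - 1) = a n l" unfolding a_def using lt by simp
      then show "(if jump_cell n (c n) w (Suc l) \<le> n then 1 - d n / c n * exp (- (c n * cell_hazard n ?b (jump_cell n (c n) w (Suc l) - 1))) else 0) \<le>
        \<bar>1 - d n / c n * exp (- (c n * a n l))\<bar>"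
        by (cases "jump_cell n (c n) w (Suc l) \<le> n") (simp_all only: if_True if_False abs_ge_self abs_ge_zero)
    qed
    finally show ?case by simp
  qed
  show ?thesis
  proof (rule tendsto_sandwich[OF low])
    show "\<forall>\<^sub>F n in sequentially. law_ratio n (c n) (d n) (jump_bit n (c n) w) \<le> 1"
      using ev by eventually_elim (use law_ratio_bounds in auto)
    show "(\<lambda>n. 1 - E n) \<longlonglongrightarrow> 1" using tendsto_diff[OF tendsto_const E, of 1] by simp
  qed simp
qed

end

section \<open>Convergence in law\<close>

context hawkes_clock
begin

lemma measurable_jump_bit_fun:
  fixes F :: "(nat \<Rightarrow> nat) \<Rightarrow> real"
  assumes n: "0 < n" and c: "0 < c" and F: "\<And>b b'. (\<And>j. j < n \<Longrightarrow> b j = b' j) \<Longrightarrow> F b = F b'"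
  shows "(\<lambda>w. F (jump_bit n c w)) \<in> borel_measurable clocks"
proof -
  have "F (jump_bit n c w) = (\<Sum>b\<in>configs n. F b * indicator {w. \<forall>j<n. jump_bit n c w j = b j} w)" for w
  proof -
    have "(\<Sum>b\<in>configs n. F b * indicator {w. \<forall>j<n. jump_bit n c w j = b j} w) = (if \<forall>j<n. jump_bit n c w j \<le> 1 then F (jump_bit n c w) else 0)"
      by (rule sum_configs_indicator) (rule F)
    then show ?thesis by (simp only: jump_bit_le simp_thms if_True)
  qed
  moreover have "(\<lambda>w. \<Sum>b\<in>configs n. F b * indicator {w. \<forall>j<n. jump_bit n c w j = b j} w) \<in> borel_measurable clocks"
  proof (intro borel_measurable_sum borel_measurable_times borel_measurable_const borel_measurable_indicator)
    fix b assume "b \<in> configs n"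
    then have "\<And>j. b j \<le> 1" using configs_le by blast
    then show "{w. \<forall>j<n. jump_bit n c w j = b j} \<in> sets clocks" by (rule jump_bit_prob(1)[OF n c])
  qed
  ultimately show ?thesis by presburger
qed

text \<open>The comparison is applied to \<open>f + B\<close> and to \<open>B - f\<close>. This bounds the difference of the expectations
  under the scheme and under the grid process by \<open>2 * B\<close> times the expectation of \<open>1 - law_ratio\<close>.\<close>

lemma scheme_expectation_limit:
  fixes M :: "'a measure" and x :: "nat \<Rightarrow> 'a \<Rightarrow> nat \<Rightarrow> nat"
  assumes M: "prob_space M"
    and f: "continuous_map J1 euclideanreal f" and B: "\<And>x. x \<in> skorokhod_space T \<Longrightarrow> \<bar>f x\<bar> \<le> B"
    and c: "c \<longlonglongrightarrow> 1" and d: "d \<longlonglongrightarrow> 1"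
    and cd: "\<forall>\<^sub>F n in sequentially. 0 < c n \<and> 0 < d n \<and> d n \<le> c n"
    and meas: "\<forall>\<^sub>F n in sequentially. (\<lambda>w. scheme_path n (x n w)) \<in> M \<rightarrow>\<^sub>M borel_sigma J1"
    and sets: "\<forall>\<^sub>F n in sequentially. \<forall>b\<in>configs n. {w\<in>space M. \<forall>j<n. x n w j = b j} \<in> sets M"
    and law: "\<forall>\<^sub>F n in sequentially. \<forall>b\<in>configs n. measure M {w\<in>space M. \<forall>j<n. x n w j = b j} =
       (\<Prod>j<n. exp (- (c n * cell_hazard n b j)) * (if b j = 0 then 1 else d n * cell_hazard n b j))"
  shows "(\<lambda>n. \<integral>w. f (scheme_path n (x n w)) \<partial>M) \<longlonglongrightarrow> (\<integral>w. f (limit_path (regularised w)) \<partial>clocks)"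
proof -
  interpret M: prob_space M by fact
  let ?b = "\<lambda>n w. jump_bit n (c n) w"
  define R where "R n = (\<integral>w. 1 - law_ratio n (c n) (d n) (?b n w) \<partial>clocks)" for n
  have ev: "\<forall>\<^sub>F n in sequentially. 0 < n \<and> 0 < c n \<and> 0 < d n \<and> d n \<le> c n"
    using eventually_gt_at_top[of 0] cd by (auto intro: eventually_conj)
  then obtain N where N: "\<And>n. n \<ge> N \<Longrightarrow> 0 < n \<and> 0 < c n \<and> 0 < d n \<and> d n \<le> c n"
    by (auto simp: eventually_sequentially)
  have m_ratio: "(\<lambda>w. law_ratio n (c n) (d n) (?b n w)) \<in> borel_measurable clocks" if "n \<ge> N" for n
    using N[OF that] by (intro measurable_jump_bit_fun law_ratio_cong) auto
  have R: "R \<longlonglongrightarrow> 0"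
  proof -
    have "(\<lambda>n. R (n + N)) \<longlonglongrightarrow> (\<integral>w. (0::real) \<partial>clocks)"
      unfolding R_def
    proof (rule integral_dominated_convergence[where w = "\<lambda>_. 1"])
      show "(\<lambda>w. 1 - law_ratio (n + N) (c (n + N)) (d (n + N)) (?b (n + N) w)) \<in> borel_measurable clocks" for n
        by (intro borel_measurable_diff borel_measurable_const m_ratio) simp
      show "AE w in clocks. norm (1 - law_ratio (n + N) (c (n + N)) (d (n + N)) (?b (n + N) w)) \<le> 1" for n
      proof (rule AE_I2)
        fix w
        have "0 < c (n + N)" "0 < d (n + N)" "d (n + N) \<le> c (n + N)" using N[of "n + N"] by auto
        from law_ratio_bounds[OF this, of "n + N" "?b (n + N) w"]
        show "norm (1 - law_ratio (n + N) (c (n + N)) (d (n + N)) (?b (n + N) w)) \<le> 1" by simp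
      qed
      show "AE w in clocks. (\<lambda>n. 1 - law_ratio (n + N) (c (n + N)) (d (n + N)) (?b (n + N) w)) \<longlonglongrightarrow> 0"
        using AE_good
      proof eventually_elim
        case (elim w)
        from tendsto_diff[OF tendsto_const LIMSEQ_ignore_initial_segment[OF law_ratio_tendsto_1[OF elim c d cd], of N], of 1]
        show ?case by simp
      qed
    qed auto
    then show ?thesis by (intro LIMSEQ_offset[of R N]) simp
  qed
  note mf = continuous_map_borel_sigma[OF f]
  have "\<forall>\<^sub>F n in sequentially. \<bar>(\<integral>w. f (scheme_path n (x n w)) \<partial>M) - (\<integral>w. f (scheme_path n (?b n w)) \<partial>clocks)\<bar> \<le> 2 * B * R n"
    using eventually_ge_at_top[of N] meas sets law
  proof eventually_elim
    case (elim n)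
    have n: "0 < n" and cn: "0 < c n" and dn: "0 < d n" "d n \<le> c n" using N[OF elim(1)] by blast+
    have fb: "\<bar>f (scheme_path n b)\<bar> \<le> B" for b by (rule B[OF scheme_path_skorokhod[OF n]])
    have iM: "integrable M (\<lambda>w. f (scheme_path n (x n w)))"
      by (rule M.integrable_const_bound[where B = B]) (use fb measurable_compose[OF elim(2) mf] in auto)
    have iC: "integrable clocks (\<lambda>w. f (scheme_path n (?b n w)))"
      by (rule clocks.integrable_const_bound[where B = B]) (use fb measurable_compose[OF measurable_jump_bit_path[OF n cn] mf] in auto)
    have i_ratio: "integrable clocks (\<lambda>w. law_ratio n (c n) (d n) (?b n w))"
      by (rule clocks.integrable_const_bound[where B = 1]) (use law_ratio_bounds[OF cn dn] m_ratio[OF elim(1)] in auto)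
    have main: "(\<integral>w. h (?b n w) \<partial>clocks) - 2 * B * R n \<le> (\<integral>w. h (x n w) \<partial>M)"
      if hc: "\<And>b b'. (\<And>j. j < n \<Longrightarrow> b j = b' j) \<Longrightarrow> h b = h b'" and h0: "\<And>b. 0 \<le> h b" and hB: "\<And>b. h b \<le> 2 * B"
        and hM: "integrable M (\<lambda>w. h (x n w))" and hC: "integrable clocks (\<lambda>w. h (?b n w))" for h
    proof -
      have sp: "{w\<in>space clocks. \<forall>j<n. ?b n w j = b j} = {w. \<forall>j<n. ?b n w j = b j}" for b by simp
      have le: "law_ratio n (c n) (d n) b * measure clocks {w\<in>space clocks. \<forall>j<n. ?b n w j = b j} \<le>
          measure M {w\<in>space M. \<forall>j<n. x n w j = b j}" if b: "b \<in> configs n" for b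
      proof -
        have b1: "\<And>j. b j \<le> 1" using configs_le[OF b] .
        show ?thesis unfolding sp jump_bit_prob(2)[where b = b, OF n cn b1] bspec[OF elim(4) b] by (rule law_ratio_le[OF cn dn])
      qed
      have sC: "{w\<in>space clocks. \<forall>j<n. ?b n w j = b j} \<in> sets clocks" if b: "b \<in> configs n" for b
        unfolding sp using configs_le[OF b] by (rule jump_bit_prob(1)[OF n cn])
      note ec = expectation_comparison[where x = "x n" and y = "?b n" and h = h and \<rho> = "law_ratio n (c n) (d n)" and n = n,
          OF M prob_space_clocks bspec[OF elim(3)] sC jump_bit_le hc h0 law_ratio_cong hM le]
      have "(\<integral>w. h (?b n w) \<partial>clocks) - 2 * B * R n = (\<integral>w. h (?b n w) - 2 * B * (1 - law_ratio n (c n) (d n) (?b n w)) \<partial>clocks)"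
        unfolding R_def using hC i_ratio by simp
      also have "\<dots> \<le> (\<integral>w. h (?b n w) * law_ratio n (c n) (d n) (?b n w) \<partial>clocks)"
      proof (rule integral_mono)
        show "integrable clocks (\<lambda>w. h (?b n w) - 2 * B * (1 - law_ratio n (c n) (d n) (?b n w)))" using hC i_ratio by simp
        show "integrable clocks (\<lambda>w. h (?b n w) * law_ratio n (c n) (d n) (?b n w))" by (rule ec(2))
        fix w
        have "h (?b n w) * (1 - law_ratio n (c n) (d n) (?b n w)) \<le> 2 * B * (1 - law_ratio n (c n) (d n) (?b n w))"
          using hB law_ratio_bounds[OF cn dn, of n "?b n w"] by (intro mult_right_mono) auto
        then show "h (?b n w) - 2 * B * (1 - law_ratio n (c n) (d n) (?b n w)) \<le> h (?b n w) * law_ratio n (c n) (d n) (?b n w)"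
          by (simp add: algebra_simps)
      qed
      also have "\<dots> \<le> (\<integral>w. h (x n w) \<partial>M)" by (rule ec(1))
      finally show ?thesis .
    qed
    have dc: "scheme_path n b = scheme_path n b'" if "\<And>j. j < n \<Longrightarrow> b j = b' j" for b b' by (rule scheme_path_cong[OF n that])
    have "(\<integral>w. f (scheme_path n (?b n w)) + B \<partial>clocks) - 2 * B * R n \<le> (\<integral>w. f (scheme_path n (x n w)) + B \<partial>M)"
    proof (rule main[of "\<lambda>b. f (scheme_path n b) + B"])
      show "f (scheme_path n b) + B = f (scheme_path n b') + B" if "\<And>j. j < n \<Longrightarrow> b j = b' j" for b b' using dc[OF that] by simp
      show "0 \<le> f (scheme_path n b) + B" "f (scheme_path n b) + B \<le> 2 * B" for b using fb[of b] by auto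
    qed (use iM iC in auto)
    moreover have "(\<integral>w. B - f (scheme_path n (?b n w)) \<partial>clocks) - 2 * B * R n \<le> (\<integral>w. B - f (scheme_path n (x n w)) \<partial>M)"
    proof (rule main[of "\<lambda>b. B - f (scheme_path n b)"])
      show "B - f (scheme_path n b) = B - f (scheme_path n b')" if "\<And>j. j < n \<Longrightarrow> b j = b' j" for b b' using dc[OF that] by simp
      show "0 \<le> B - f (scheme_path n b)" "B - f (scheme_path n b) \<le> 2 * B" for b using fb[of b] by auto
    qed (use iM iC in auto)
    ultimately show ?case using iM iC by (simp add: M.prob_space clocks.prob_space[unfolded space_clocks])
  qed
  then have "\<forall>\<^sub>F n in sequentially. norm ((\<integral>w. f (scheme_path n (x n w)) \<partial>M) - (\<integral>w. f (scheme_path n (?b n w)) \<partial>clocks)) \<le> 2 * B * R n"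
    by simp
  moreover have "(\<lambda>n. 2 * B * R n) \<longlonglongrightarrow> 0" using tendsto_mult_right_zero[OF R] by simp
  ultimately have "(\<lambda>n. (\<integral>w. f (scheme_path n (x n w)) \<partial>M) - (\<integral>w. f (scheme_path n (?b n w)) \<partial>clocks)) \<longlonglongrightarrow> 0"
    by (rule Lim_null_comparison)
  from tendsto_add[OF this jump_bit_path_expectation[OF f B c]] show ?thesis by simp
qed

lemma jump_count:
  assumes g: "good w" and k: "T < \<tau> w k" and s: "s \<le> T"
  shows "jump (count w) s = (if s \<in> \<tau> w ` {..<k} then 1 else 0)"
proof -
  have cnt: "count w r = (\<Sum>j<k. if \<tau> w j \<le> r then 1 else 0)" if "r \<le> T" for r
    using count_eq(1)[of w r k k] good_pos[OF g] k that by (simp add: counted_def)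
  have "((\<lambda>r. \<Sum>j<k. if \<tau> w j \<le> r then 1 else 0 :: real) \<longlongrightarrow> (\<Sum>j<k. if \<tau> w j < s then 1 else 0)) (at_left s)"
  proof (intro tendsto_sum tendsto_eventually)
    fix j
    show "\<forall>\<^sub>F r in at_left s. (if \<tau> w j \<le> r then 1 else 0 :: real) = (if \<tau> w j < s then 1 else 0)"
      unfolding eventually_at_left_field by (intro exI[of _ "if \<tau> w j < s then \<tau> w j else s - 1"]) auto
  qed
  moreover have "\<forall>\<^sub>F r in at_left s. (\<Sum>j<k. if \<tau> w j \<le> r then 1 else 0) = count w r"
    unfolding eventually_at_left_field using cnt s by (intro exI[of _ "s - 1"]) auto
  ultimately have "(count w \<longlongrightarrow> (\<Sum>j<k. if \<tau> w j < s then 1 else 0)) (at_left s)"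
    by (rule Lim_transform_eventually)
  then have L: "Lim (at_left s) (count w) = (\<Sum>j<k. if \<tau> w j < s then 1 else 0)"
    by (intro tendsto_Lim) auto
  have inj: "\<tau> w i = \<tau> w j \<longleftrightarrow> i = j" for i j
    using \<tau>_le_iff_index[of w i j] \<tau>_le_iff_index[of w j i] good_pos[OF g] by auto
  have "jump (count w) s = (\<Sum>j<k. (if \<tau> w j \<le> s then 1 else 0) - (if \<tau> w j < s then 1 else 0))"
    unfolding jump_def L cnt[OF s] sum_subtractf ..
  also have "\<dots> = (\<Sum>j<k. if \<tau> w j = s then 1 else 0)" by (intro sum.cong) auto
  also have "\<dots> = (if s \<in> \<tau> w ` {..<k} then 1 else 0)"
  proof (cases "s \<in> \<tau> w ` {..<k}")
    case True
    then obtain i where "i < k" "s = \<tau> w i" by auto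
    then show ?thesis by (simp add: inj)
  next
    case False
    then show ?thesis by (auto intro!: sum.neutral)
  qed
  finally show ?thesis .
qed

lemma counting_path_count:
  assumes g: "good w" shows "counting_path T (count w)"
proof -
  obtain k where k: "T < \<tau> w k" using number_of_jumps[OF g] by blast
  have cnt: "count w r = (\<Sum>j<k. if \<tau> w j \<le> r then 1 else 0)" if "r \<le> T" for r
    using count_eq(1)[of w r k k] good_pos[OF g] k that by (simp add: counted_def)
  have "piecewise_constant_on T (count w)"
    unfolding piecewise_constant_on_def
  proof (intro exI[of _ "\<tau> w ` {..<k}"] conjI ballI impI)
    fix s t assume st: "s \<in> {0..T}" "t \<in> {0..T}" "s \<le> t \<and> {s<..t} \<inter> \<tau> w ` {..<k} = {}"
    have "\<tau> w j \<le> s \<longleftrightarrow> \<tau> w j \<le> t" if "j < k" for j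
    proof -
      have "\<tau> w j \<notin> {s<..t}" using st(3) that by blast
      then show ?thesis using st(3) by auto
    qed
    then show "count w s = count w t" using st by (subst (1 2) cnt) (auto intro!: sum.cong)
  qed simp
  moreover have "count w 0 = 0"
    using \<tau>_pos[of w] good_pos[OF g] T by (subst cnt) (auto intro!: sum.neutral simp: not_le)
  moreover have "jump (count w) t = 1" if "t \<in> {0<..T}" "jump (count w) t \<noteq> 0" for t
    using jump_count[OF g k, of t] that by (auto split: if_splits)
  ultimately show ?thesis unfolding counting_path_def using cadlag_count[OF g] by blast
qed

lemma intensity_count:
  assumes g: "good w" and k: "T < \<tau> w k" and s: "s \<le> T"
  shows "(\<Sum>r | 0 < r \<and> r < s \<and> jump (count w) r \<noteq> 0. K (s - r) * jump (count w) r) =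
    (\<Sum>j<k. if \<tau> w j < s then K (s - \<tau> w j) else 0)"
proof -
  have set: "{r. 0 < r \<and> r < s \<and> jump (count w) r \<noteq> 0} = \<tau> w ` {j\<in>{..<k}. \<tau> w j < s}"
  proof (intro set_eqI iffI)
    fix r assume "r \<in> {r. 0 < r \<and> r < s \<and> jump (count w) r \<noteq> 0}"
    then have "r < s" "jump (count w) r \<noteq> 0" by auto
    then show "r \<in> \<tau> w ` {j\<in>{..<k}. \<tau> w j < s}" using jump_count[OF g k, of r] s by (auto split: if_splits)
  next
    fix r assume "r \<in> \<tau> w ` {j\<in>{..<k}. \<tau> w j < s}"
    then obtain j where j: "j < k" "\<tau> w j < s" "r = \<tau> w j" by auto
    moreover have "0 < \<tau> w j" using \<tau>_pos[of w j] good_pos[OF g] by simp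
    ultimately show "r \<in> {r. 0 < r \<and> r < s \<and> jump (count w) r \<noteq> 0}" using jump_count[OF g k, of r] s by auto
  qed
  have inj: "inj_on (\<tau> w) {j\<in>{..<k}. \<tau> w j < s}"
  proof (rule inj_onI)
    fix i j assume "\<tau> w i = \<tau> w j"
    then show "i = j" using \<tau>_le_iff_index[of w i j] \<tau>_le_iff_index[of w j i] good_pos[OF g] by auto
  qed
  have "(\<Sum>r\<in>\<tau> w ` {j\<in>{..<k}. \<tau> w j < s}. K (s - r) * jump (count w) r) = (\<Sum>j\<in>{j\<in>{..<k}. \<tau> w j < s}. K (s - \<tau> w j))"
    unfolding sum.reindex[OF inj] using jump_count[OF g k] s by (intro sum.cong) auto
  also have "\<dots> = (\<Sum>j<k. if \<tau> w j < s then K (s - \<tau> w j) else 0)" by (rule sum.inter_filter) simp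
  finally show ?thesis unfolding set .
qed

end

definition primitive :: "real \<Rightarrow> (real \<Rightarrow> real) \<Rightarrow> real \<Rightarrow> real" where
  "primitive T f t = (LINT s:{0..min t T}|lebesgue. f s)"

lemma primitive_neg: "t \<le> 0 \<Longrightarrow> primitive T f t = 0"
proof -
  assume "t \<le> 0"
  then consider "{0..min t T} = {}" | "{0..min t T} = {0}" by (cases "min t T < 0") auto
  then show ?thesis
  proof cases
    case 1 then show ?thesis unfolding primitive_def by (simp add: set_lebesgue_integral_def)
  next
    case 2
    have "AE x in lebesgue. x \<noteq> (0::real)" by (intro AE_completion AE_lborel_singleton)
    then have "AE x in lebesgue. indicator {0} x *\<^sub>R f x = 0" by eventually_elim simp
    then show ?thesis unfolding primitive_def 2 set_lebesgue_integral_def by (rule integral_eq_zero_AE)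
  qed
qed

context
  fixes T :: real and f :: "real \<Rightarrow> real"
  assumes T: "0 < T" and f: "set_integrable lebesgue {0..T} f" and f0: "\<And>t. t \<in> {0..T} \<Longrightarrow> 0 \<le> f t"
begin

lemma integrable_subinterval: "0 \<le> a \<Longrightarrow> b \<le> T \<Longrightarrow> set_integrable lebesgue {a..b} f"
  by (rule set_integrable_subset[OF f]) auto

lemma set_integral_diff:
  assumes "0 \<le> a" "a \<le> b" "b \<le> T"
  shows "(LINT s:{a..b}|lebesgue. f s) = primitive T f b - primitive T f a"
proof -
  have i: "set_integrable lebesgue {0..b} f" "set_integrable lebesgue {0..a} f" "set_integrable lebesgue {a..b} f"
    using assms by (auto intro: integrable_subinterval)
  have m: "min b T = b" "min a T = a" using assms by auto
  show ?thesis unfolding primitive_def m i[THEN set_lebesgue_integral_eq_integral(2)]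
    using Henstock_Kurzweil_Integration.integral_combine[of 0 a b f] assms set_lebesgue_integral_eq_integral(1)[OF i(1)] by simp
qed

lemma primitive_eq: "primitive T f t = integral {0..max 0 (min t T)} f"
proof (cases "t \<le> 0")
  case True then show ?thesis using T by (simp add: primitive_neg)
next
  case False
  then have "max 0 (min t T) = min t T" using T by simp
  then show ?thesis unfolding primitive_def by (simp add: set_lebesgue_integral_eq_integral(2) integrable_subinterval)
qed

lemma continuous_primitive: "continuous_on UNIV (primitive T f)"
proof -
  have "continuous_on {0..T} (\<lambda>t. integral {0..t} f)"
    by (rule indefinite_integral_continuous_1[OF set_lebesgue_integral_eq_integral(1)[OF f]])
  then have "continuous_on UNIV (\<lambda>t. integral {0..max 0 (min t T)} f)"
    by (rule continuous_on_compose2) (use T in \<open>auto intro!: continuous_intros\<close>)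
  then show ?thesis by (simp add: primitive_eq[abs_def])
qed

lemma mono_primitive: "mono (primitive T f)"
proof (rule monoI)
  fix s t :: real assume st: "s \<le> t"
  let ?s = "max 0 (min s T)" and ?t = "max 0 (min t T)"
  have i: "set_integrable lebesgue {0..?t} f" "set_integrable lebesgue {?s..?t} f" using T by (auto intro!: integrable_subinterval)
  have "integral {0..?t} f = integral {0..?s} f + integral {?s..?t} f"
    using Henstock_Kurzweil_Integration.integral_combine[of 0 ?s ?t f] set_lebesgue_integral_eq_integral(1)[OF i(1)] st by auto
  moreover have "0 \<le> integral {?s..?t} f"
    using T f0 by (intro integral_nonneg set_lebesgue_integral_eq_integral(1)[OF i(2)]) auto
  ultimately show "primitive T f s \<le> primitive T f t" by (simp add: primitive_eq)
qed

lemma set_integral_shift: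
  assumes a: "0 \<le> a" and t: "t \<le> T"
  shows "set_integrable lebesgue {0..t} (\<lambda>s. if a < s then f (s - a) else 0)"
    and "(LINT s:{0..t}|lebesgue. if a < s then f (s - a) else 0) = primitive T f (t - a)"
proof -
  let ?h = "\<lambda>x. indicator {0<..t - a} x * f x"
  have i: "set_integrable lebesgue {0..t - a} f" using a t by (intro integrable_subinterval) auto
  have i': "integrable lebesgue ?h"
  proof -
    have "set_integrable lebesgue {0<..t - a} f" by (rule set_integrable_subset[OF i]) auto
    then show ?thesis by (simp only: set_integrable_def real_scaleR_def)
  qed
  have "primitive T f (t - a) = (LINT s:{0..t - a}|lebesgue. f s)" using a t by (simp add: primitive_def min_def)
  also have "\<dots> = (\<integral>x. ?h x \<partial>lebesgue)" unfolding set_lebesgue_integral_def real_scaleR_def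
  proof (rule integral_cong_AE)
    show "(\<lambda>x. indicator {0..t - a} x * f x) \<in> borel_measurable lebesgue" using i by (auto simp: set_integrable_def)
    show "?h \<in> borel_measurable lebesgue" using i' by simp
    have "AE x in lebesgue. x \<noteq> (0::real)" by (intro AE_completion AE_lborel_singleton)
    then show "AE x in lebesgue. indicator {0..t - a} x * f x = ?h x"
      by eventually_elim (auto simp: indicator_def)
  qed
  finally have "has_bochner_integral lebesgue ?h (primitive T f (t - a))" using i' by (simp add: has_bochner_integral_iff)
  then have "has_bochner_integral lebesgue (\<lambda>x. ?h (- a + 1 * x)) (primitive T f (t - a) /\<^sub>R \<bar>1\<bar>)"
    by (subst (asm) has_bochner_integral_lebesgue_real_affine_iff[where c = 1 and t = "- a"]) auto
  moreover have "?h (- a + 1 * x) = indicator {0..t} x *\<^sub>R (if a < x then f (x - a) else 0)" for x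
    using a by (auto simp: indicator_def)
  ultimately have "has_bochner_integral lebesgue (\<lambda>x. indicator {0..t} x *\<^sub>R (if a < x then f (x - a) else 0)) (primitive T f (t - a))"
    by simp
  then show "set_integrable lebesgue {0..t} (\<lambda>s. if a < s then f (s - a) else 0)"
    and "(LINT s:{0..t}|lebesgue. if a < s then f (s - a) else 0) = primitive T f (t - a)"
    by (auto simp: has_bochner_integral_iff set_integrable_def set_lebesgue_integral_def)
qed

end

lemma measurable_map_upt:
  fixes N :: "nat \<Rightarrow> 'a \<Rightarrow> nat"
  assumes N: "\<And>i. i < n \<Longrightarrow> N i \<in> M \<rightarrow>\<^sub>M count_space UNIV"
  shows "(\<lambda>w. map (\<lambda>i. N i w) [0..<n]) \<in> M \<rightarrow>\<^sub>M count_space UNIV"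
proof -
  let ?L = "\<lambda>w. map (\<lambda>i. N i w) [0..<n]"
  have "?L -` {l} \<inter> space M \<in> sets M" for l
  proof (cases "length l = n")
    case True
    have eq: "?L w = l \<longleftrightarrow> (\<forall>i\<in>{..<n}. N i w = l ! i)" for w
      unfolding list_eq_iff_nth_eq using True by (simp add: Ball_def)
    have "{w\<in>space M. \<forall>i\<in>{..<n}. N i w = l ! i} \<in> sets M"
    proof (rule sets.sets_Collect_finite_All)
      fix i assume "i \<in> {..<n}"
      then have "N i -` {l ! i} \<inter> space M \<in> sets M" by (intro measurable_sets[OF N]) auto
      moreover have "N i -` {l ! i} \<inter> space M = {w\<in>space M. N i w = l ! i}" by blast
      ultimately show "{w\<in>space M. N i w = l ! i} \<in> sets M" by simp
    qed simp
    moreover have "?L -` {l} \<inter> space M = {w\<in>space M. \<forall>i\<in>{..<n}. N i w = l ! i}"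
      using eq by blast
    ultimately show ?thesis by presburger
  next
    case False
    then have "?L -` {l} \<inter> space M = {}" by auto
    then show ?thesis by (simp only: sets.empty_sets)
  qed
  then show ?thesis by (subst measurable_count_space_eq2_countable) blast+
qed

lemma martingale_on_cong:
  assumes eq: "\<And>t. t \<in> {0..T} \<Longrightarrow> X t = Y t" and mart: "martingale_on M T F X"
  shows "martingale_on M T F Y"
  unfolding martingale_on_def
proof (intro conjI ballI)
  fix t assume t: "t \<in> {0..T}"
  show "integrable M (Y t)" "Y t \<in> borel_measurable (F t)"
    using mart t unfolding martingale_on_def eq[OF t, symmetric] by blast+
next
  fix s t assume st: "s \<in> {0..T}" "t \<in> {s..T}"
  then have t: "t \<in> {0..T}" by auto
  show "AE w in M. real_cond_exp M (F s) (Y t) w = Y s w"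
    using mart st unfolding martingale_on_def eq[OF t, symmetric] eq[OF st(1), symmetric] by blast
qed

theorem theorem3p1:
  fixes T :: real
    and g0 K :: "real \<Rightarrow> real"
    and M :: "'a measure"
    and \<xi> :: "nat \<Rightarrow> nat \<Rightarrow> 'a \<Rightarrow> real"
    and Nhat :: "nat \<Rightarrow> nat \<Rightarrow> 'a \<Rightarrow> nat"
  assumes "T > 0"
    and "set_integrable lebesgue {0..T} g0" and "\<And>t. t \<in> {0..T} \<Longrightarrow> 0 \<le> g0 t"
    and "set_integrable lebesgue {0..T} K" and "\<And>t. t \<in> {0..T} \<Longrightarrow> 0 \<le> K t"
    and "prob_space M" and "complete_measure M"
    and "\<And>n. n \<ge> scheme_start T K \<Longrightarrow> hawkes_iVi M T g0 K n (\<xi> n) (Nhat n)"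
  shows "\<exists>(M' :: (nat \<Rightarrow> real) measure) N.
           prob_space M' \<and> hawkes_process M' T g0 K N \<and>
           converges_in_law (J1_topology T :: (real \<Rightarrow> real \<times> real) topology)
             M (\<lambda>n. paths_on T (\<lambda>t \<omega>. (scheme_Lambda T g0 K n (Nhat n) t \<omega>, scheme_N T n (Nhat n) t \<omega>)))
             M' (paths_on T (\<lambda>t \<omega>. (hawkes_Lambda g0 K N t \<omega>, N t \<omega>)))"
proof -
  note T = assms(1) and g0 = assms(2,3) and K = assms(4,5) and M = assms(6) and S = assms(8)
  \<comment> \<open>The slope 1 after \<open>T\<close> makes every clock ring; it has no effect on \<open>[0, T]\<close>.\<close>
  define G where "G t = primitive T g0 t + max 0 (t - T)" for t
  define \<kappa> where "\<kappa> = primitive T K"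
  interpret M: prob_space M by (rule M)
  interpret hawkes_clock T G \<kappa>
  proof
    show "0 < T" by (rule T)
    show "continuous_on UNIV G" unfolding G_def by (intro continuous_intros continuous_primitive[OF T g0])
    show "mono G" unfolding G_def by (intro monoI add_mono monoD[OF mono_primitive[OF T g0]]) auto
    show "G t = 0" if "t \<le> 0" for t using that T by (simp add: G_def primitive_neg)
    show "filterlim G at_top at_top"
    proof (rule filterlim_at_top_mono)
      show "filterlim (\<lambda>t. t - T) at_top at_top" by real_asymp
      have "0 \<le> primitive T g0 t" for t
        using monoD[OF mono_primitive[OF T g0], of "min t 0" t] primitive_neg[of "min t 0" T g0] by simp
      then show "\<forall>\<^sub>F t in at_top. t - T \<le> G t" by (intro always_eventually) (auto simp: G_def add_increasing)
    qed
    show "continuous_on UNIV \<kappa>" unfolding \<kappa>_def by (rule continuous_primitive[OF T K])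
    show "mono \<kappa>" unfolding \<kappa>_def by (rule mono_primitive[OF T K])
    show "\<kappa> t = 0" if "t \<le> 0" for t using that by (simp add: \<kappa>_def primitive_neg)
    show "\<kappa> t = \<kappa> T" if "T \<le> t" for t using that by (simp add: \<kappa>_def primitive_def min_def)
  qed
  have G_le: "G t = primitive T g0 t" if "t \<le> T" for t using that by (simp add: G_def)
  have gridT: "grid T n m \<le> T" if "m \<le> n" "0 < n" for m n
    using that T by (simp add: grid_def field_simps mult_left_mono)
  have kincr: "kincr T K n j = \<kappa> (grid T n (Suc j)) - \<kappa> (grid T n j)" if "Suc j \<le> n" for n j
    unfolding kincr_def \<kappa>_def using that gridT[of "Suc j" n]
    by (intro set_integral_diff[OF T K]) (auto intro: grid_nonneg grid_mono)
  have kincr0: "kincr T K n 0 = \<kappa> (grid T n 1)" if "0 < n" for n using kincr[of 0 n] that \<kappa>_neg[of 0] by simp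
  have alpha_config: "alpha T g0 K n (\<lambda>j _. b j) i () = cell_hazard n b i" if "i < n" for n i and b :: "nat \<Rightarrow> nat"
  proof -
    have "(LINT s:{grid T n i..grid T n (Suc i)}|lebesgue. g0 s) = G (grid T n (Suc i)) - G (grid T n i)"
      using that gridT[of "Suc i" n] gridT[of i n] by (subst set_integral_diff[OF T g0]) (auto simp: G_le intro: grid_nonneg grid_mono)
    then show ?thesis unfolding alpha_def cell_hazard_def using that by (auto intro!: sum.cong simp: kincr)
  qed
  have alpha: "alpha T g0 K n N i w = cell_hazard n (\<lambda>j. N j w) i" if "i < n" for n i and N :: "nat \<Rightarrow> 'a \<Rightarrow> nat" and w
    using alpha_config[OF that, of "\<lambda>j. N j w"] by (simp add: alpha_def)
  have Lambda: "hawkes_Lambda g0 K hawkes_N t w = hawkes_L t w" if t: "t \<in> {0..T}" for t w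
  proof -
    define v where "v = regularised w"
    have g: "good v" unfolding v_def by (rule good_regularised)
    obtain k where k: "T < \<tau> v k" using number_of_jumps[OF g] by blast
    have "hawkes_intensity g0 K hawkes_N s w = g0 s + (\<Sum>j<k. if \<tau> v j < s then K (s - \<tau> v j) else 0)" if "s \<le> T" for s
      unfolding hawkes_intensity_def hawkes_N_def v_def[symmetric] intensity_count[OF g k that] ..
    then have "hawkes_Lambda g0 K hawkes_N t w = (LINT s:{0..t}|lebesgue. g0 s + (\<Sum>j<k. if \<tau> v j < s then K (s - \<tau> v j) else 0))"
      unfolding hawkes_Lambda_def using t by (intro set_lebesgue_integral_cong) auto
    also have "\<dots> = (LINT s:{0..t}|lebesgue. g0 s) + (\<Sum>j<k. LINT s:{0..t}|lebesgue. if \<tau> v j < s then K (s - \<tau> v j) else 0)"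
    proof -
      have 1: "set_integrable lebesgue {0..t} g0" using t by (intro integrable_subinterval[OF T g0]) auto
      have 2: "set_integrable lebesgue {0..t} (\<lambda>s. if \<tau> v j < s then K (s - \<tau> v j) else 0)" for j
        using t by (intro set_integral_shift[OF T K] \<tau>_nonneg) auto
      show ?thesis
        unfolding set_lebesgue_integral_def scaleR_add_right scaleR_sum_right
          Bochner_Integration.integral_add[OF 1[unfolded set_integrable_def]
            Bochner_Integration.integrable_sum[OF 2[unfolded set_integrable_def]]]
          Bochner_Integration.integral_sum[OF 2[unfolded set_integrable_def]] ..
    qed
    also have "\<dots> = primitive T g0 t + (\<Sum>j<k. \<kappa> (t - \<tau> v j))"
      using t set_integral_shift(2)[OF T K \<tau>_nonneg, of t v] by (simp add: primitive_def \<kappa>_def min_def)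
    also have "\<dots> = compensator v k t" using t by (simp add: compensator_def G_le)
    also have "\<dots> = Lam v t" using count_eq(2)[of v t k k] good_pos[OF g] k t by simp
    finally show ?thesis by (simp add: hawkes_L_def v_def)
  qed
  have "martingale_on clocks T hawkes_F (\<lambda>t w. hawkes_N t w - hawkes_Lambda g0 K hawkes_N t w)"
  proof -
    have e: "(\<lambda>w. hawkes_N t w - hawkes_L t w) = (\<lambda>w. hawkes_N t w - hawkes_Lambda g0 K hawkes_N t w)" if "t \<in> {0..T}" for t
      using Lambda[OF that] by simp
    show ?thesis by (rule martingale_on_cong[OF e martingale])
  qed
  then have hawkes: "hawkes_process clocks T g0 K hawkes_N"
    using counting_path_count[OF good_regularised] by (simp add: hawkes_process_def hawkes_N_def[abs_def] meas_hawkes_N[unfolded hawkes_N_def[abs_def]])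
  have limit: "paths_on T (\<lambda>t w. (hawkes_Lambda g0 K hawkes_N t w, hawkes_N t w)) = (\<lambda>w. limit_path (regularised w))"
    unfolding paths_on_def limit_path_def by (intro ext restrict_ext) (simp add: Lambda hawkes_L_def hawkes_N_def)
  define x where "x n w j = Nhat n j w" for n w j
  have path: "paths_on T (\<lambda>t w. (scheme_Lambda T g0 K n (Nhat n) t w, scheme_N T n (Nhat n) t w)) w = scheme_path n (x n w)"
    if n: "0 < n" for n w
    unfolding paths_on_def scheme_path_def
  proof (rule restrict_ext)
    fix t assume t: "t \<in> {0..T}"
    show "(scheme_Lambda T g0 K n (Nhat n) t w, scheme_N T n (Nhat n) t w) =
      (\<Sum>i<steps T n t. cell_hazard n (x n w) i + \<kappa> (grid T n 1) * real (x n w i), \<Sum>i<steps T n t. real (x n w i))"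
      unfolding scheme_Lambda_def scheme_N_def using steps_le[OF n T t] kincr0[OF n]
      by (auto intro!: sum.cong simp: alpha x_def[abs_def])
  qed
  define c where "c n = ivi_c (\<kappa> (grid T n 1))" for n
  define d where "d n = ivi_d (\<kappa> (grid T n 1))" for n
  have k0: "(\<lambda>n. \<kappa> (grid T n 1)) \<longlonglongrightarrow> 0" using tendsto_\<kappa>[OF tendsto_grid_1] \<kappa>_neg[of 0] by simp
  have c: "c \<longlonglongrightarrow> 1" unfolding c_def using isCont_tendsto_compose[OF isCont_ivi(1) k0] by (simp add: ivi_c_0)
  have d: "d \<longlonglongrightarrow> 1" unfolding d_def using isCont_tendsto_compose[OF isCont_ivi(2) k0] by (simp add: ivi_d_0)
  have k1: "\<forall>\<^sub>F n in sequentially. \<kappa> (grid T n 1) < 1" by (rule order_tendstoD(2)[OF k0]) simp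
  have cd: "\<forall>\<^sub>F n in sequentially. 0 < c n \<and> 0 < d n \<and> d n \<le> c n"
    using k1 by eventually_elim (simp add: c_def d_def ivi_c_pos ivi_d_pos ivi_d_le_c \<kappa>_nonneg)
  have large: "\<forall>\<^sub>F n in sequentially. 0 < n \<and> scheme_start T K \<le> n"
    by (intro eventually_conj eventually_gt_at_top eventually_ge_at_top)
  have meas_sets: "{w\<in>space M. Q (x n w)} \<in> sets M"
    if n: "scheme_start T K \<le> n" and Q: "\<And>b b'. (\<And>j. j < n \<Longrightarrow> b j = b' j) \<Longrightarrow> Q b = Q b'" for n Q
  proof -
    have N: "Nhat n i \<in> M \<rightarrow>\<^sub>M count_space UNIV" if "i < n" for i
      by (rule hawkes_iVi_measurable(2)[OF S[OF n] that])
    have L: "(\<lambda>w. map (\<lambda>i. Nhat n i w) [0..<n]) \<in> M \<rightarrow>\<^sub>M count_space UNIV"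
      by (rule measurable_map_upt[OF N])
    have "{w\<in>space M. Q (x n w)} = (\<lambda>w. map (\<lambda>i. Nhat n i w) [0..<n]) -` {l. Q (\<lambda>j. if j < n then l ! j else 0)} \<inter> space M"
    proof -
      have "Q (x n w) = Q (\<lambda>j. if j < n then map (\<lambda>i. Nhat n i w) [0..<n] ! j else 0)" for w
        by (rule Q) (simp add: x_def)
      then show ?thesis by blast
    qed
    also have "\<dots> \<in> sets M" by (rule measurable_sets[OF L]) simp
    finally show ?thesis .
  qed
  have meas: "\<forall>\<^sub>F n in sequentially. (\<lambda>w. scheme_path n (x n w)) \<in> M \<rightarrow>\<^sub>M borel_sigma J1"
    using large
  proof eventually_elim
    case (elim n)
    show ?case
    proof (rule measurable_borel_sigma)
      show "scheme_path n (x n w) \<in> topspace J1" for w using scheme_path_skorokhod elim by (simp add: topspace_J1)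
      fix U
      show "{w\<in>space M. scheme_path n (x n w) \<in> U} \<in> sets M"
      proof (rule meas_sets[of n "\<lambda>b. scheme_path n b \<in> U"])
        show "(scheme_path n b \<in> U) = (scheme_path n b' \<in> U)" if "\<And>j. j < n \<Longrightarrow> b j = b' j" for b b'
          using scheme_path_cong[of n b b'] that elim by simp
      qed (use elim in simp)
    qed
  qed
  have sets: "\<forall>\<^sub>F n in sequentially. \<forall>b\<in>configs n. {w\<in>space M. \<forall>j<n. x n w j = b j} \<in> sets M"
    using large
  proof eventually_elim
    case (elim n)
    show ?case
    proof
      fix b
      show "{w\<in>space M. \<forall>j<n. x n w j = b j} \<in> sets M"
        by (rule meas_sets[of n "\<lambda>b'. \<forall>j<n. b' j = b j"]) (use elim in auto)
    qed
  qed
  have law: "\<forall>\<^sub>F n in sequentially. \<forall>b\<in>configs n. measure M {w\<in>space M. \<forall>j<n. x n w j = b j} =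
       (\<Prod>j<n. exp (- (c n * cell_hazard n b j)) * (if b j = 0 then 1 else d n * cell_hazard n b j))"
    using large k1
  proof eventually_elim
    case (elim n)
    then have n: "0 < n" and k: "0 \<le> kincr T K n 0" "kincr T K n 0 < 1" and s: "scheme_start T K \<le> n"
      using kincr0 \<kappa>_nonneg by auto
    show ?case
    proof
      fix b assume b: "b \<in> configs n"
      have \<alpha>: "alpha T g0 K n (\<lambda>j _. b j) j () = cell_hazard n b j" if "j < n" for j
        by (rule alpha_config[OF that])
      have nn: "0 \<le> alpha T g0 K n (\<lambda>j _. b j) j ()" if "j < n" for j
        unfolding \<alpha>[OF that] by (rule cell_hazard_nonneg)
      have "measure M {w\<in>space M. \<forall>j<n. Nhat n j w = b j} =
        (\<Prod>j<n. exp (- (ivi_c (kincr T K n 0) * alpha T g0 K n (\<lambda>j _. b j) j ())) *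
          (if b j = 0 then 1 else ivi_d (kincr T K n 0) * alpha T g0 K n (\<lambda>j _. b j) j ()))"
        by (rule scheme_law[where b = b and i = n, OF M S[OF s] order_refl nn k configs_le[OF b]])
      also have "\<dots> = (\<Prod>j<n. exp (- (c n * cell_hazard n b j)) * (if b j = 0 then 1 else d n * cell_hazard n b j))"
        by (intro prod.cong refl) (simp add: \<alpha> c_def d_def kincr0[OF n])
      finally show "measure M {w\<in>space M. \<forall>j<n. x n w j = b j} =
       (\<Prod>j<n. exp (- (c n * cell_hazard n b j)) * (if b j = 0 then 1 else d n * cell_hazard n b j))" by (simp add: x_def)
    qed
  qed
  let ?Y = "\<lambda>n. paths_on T (\<lambda>t w. (scheme_Lambda T g0 K n (Nhat n) t w, scheme_N T n (Nhat n) t w))"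
  have Y: "?Y n = (\<lambda>w. scheme_path n (x n w))" if "0 < n" for n using path[OF that] by (rule ext)
  have measY: "\<forall>\<^sub>F n in sequentially. ?Y n \<in> M \<rightarrow>\<^sub>M borel_sigma J1"
    using meas eventually_gt_at_top[of 0] by eventually_elim (simp only: Y)
  have "weakly_converges J1 (\<lambda>n. distr M (borel_sigma J1) (?Y n)) (distr clocks (borel_sigma J1) (\<lambda>w. limit_path (regularised w)))"
    unfolding weakly_converges_def
  proof (intro allI impI; elim conjE)
    fix f :: "(real \<Rightarrow> real \<times> real) \<Rightarrow> real"
    assume f: "continuous_map J1 euclideanreal f" and "bounded (f ` topspace J1)"
    then obtain B where B: "\<And>x. x \<in> skorokhod_space T \<Longrightarrow> \<bar>f x\<bar> \<le> B"
      by (auto simp: bounded_real topspace_J1)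
    note mf = continuous_map_borel_sigma[OF f]
    have "(\<lambda>n. \<integral>w. f (scheme_path n (x n w)) \<partial>M) \<longlonglongrightarrow> (\<integral>w. f (limit_path (regularised w)) \<partial>clocks)"
      by (rule scheme_expectation_limit[OF M f B c d cd meas sets law])
    moreover have "\<forall>\<^sub>F n in sequentially. (\<integral>w. f (scheme_path n (x n w)) \<partial>M) = (\<integral>y. f y \<partial>distr M (borel_sigma J1) (?Y n))"
      using measY eventually_gt_at_top[of 0]
    proof eventually_elim
      case (elim n)
      show ?case unfolding integral_distr[OF elim(1) mf] unfolding path[OF elim(2)] ..
    qed
    ultimately have "(\<lambda>n. \<integral>y. f y \<partial>distr M (borel_sigma J1) (?Y n)) \<longlonglongrightarrow> (\<integral>w. f (limit_path (regularised w)) \<partial>clocks)"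
      by (rule Lim_transform_eventually)
    then show "(\<lambda>n. \<integral>y. f y \<partial>distr M (borel_sigma J1) (?Y n)) \<longlonglongrightarrow> (\<integral>y. f y \<partial>distr clocks (borel_sigma J1) (\<lambda>w. limit_path (regularised w)))"
      unfolding integral_distr[OF measurable_limit_path mf] .
  qed
  then have "converges_in_law J1 M ?Y clocks (paths_on T (\<lambda>t w. (hawkes_Lambda g0 K hawkes_N t w, hawkes_N t w)))"
    unfolding converges_in_law_def limit using measY measurable_limit_path by blast
  then show ?thesis using prob_space_clocks hawkes by blast
qed

end
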